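(* Let $G$ be a finite cyclic group and let $L$ be a $\mathbb{Z}G$-module whose underlying abelian group is finitely generated free. Suppose that the $G$-action on $L$ is free outside the origin, i.e., if for $g\in G$ and $x\in L$ we have $gx=x$, then $g=1$ or $x=0$. Then the Tate cohomology satisfies $$\widehat{H}^i(G;\Lambda^j(L))=0$$ for all integers $i$ and all $j\ge 0$ for which $i+j$ is odd.
   Context: $\Lambda^j(L)=\Lambda^j_{\mathbb{Z}}(L)$ denotes the $j$-th exterior power of the $\mathbb{Z}$-module $L$, with the induced diagonal $G$-action. $\widehat{H}^*(G;-)$ denotes Tate cohomology of the finite group $G$. *)

theory Defs
  imports "HOL-Algebra.Algebra"
begin

text \<open>Abelian groups are written multiplicatively, as \<^const>\<open>comm_group\<close> does: the sum of two
  elements of a module is \<open>x \<otimes>\<^bsub>M\<^esub> y\<close>, its zero element is \<open>\<one>\<^bsub>M\<^esub>\<close> and an integer multiple is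
  \<open>x [^]\<^bsub>M\<^esub> (k::int)\<close>.\<close>

text \<open>A (left) \<open>\<int>G\<close>-module, given as an abelian group with a homomorphism from \<open>G\<close> to its
  automorphism group.\<close>

locale group_ring_module = G: group G + M: comm_group M
  for G :: "('g, 'a) monoid_scheme" and M :: "('m, 'b) monoid_scheme"
    and act :: "'g \<Rightarrow> 'm \<Rightarrow> 'm" +
  assumes act_hom: "act \<in> hom G (AutoGroup M)"

lemma group_ring_moduleI:
  assumes G: "group G" and N: "comm_group N"
    and c: "\<And>g x. g \<in> carrier G \<Longrightarrow> x \<in> carrier N \<Longrightarrow> b g x \<in> carrier N"
    and e: "\<And>g. g \<in> carrier G \<Longrightarrow> b g \<in> extensional (carrier N)"
    and m: "\<And>g x y. g \<in> carrier G \<Longrightarrow> x \<in> carrier N \<Longrightarrow> y \<in> carrier N \<Longrightarrow>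
       b g (x \<otimes>\<^bsub>N\<^esub> y) = b g x \<otimes>\<^bsub>N\<^esub> b g y"
    and a: "\<And>g h x. g \<in> carrier G \<Longrightarrow> h \<in> carrier G \<Longrightarrow> x \<in> carrier N \<Longrightarrow>
       b (g \<otimes>\<^bsub>G\<^esub> h) x = b g (b h x)"
    and o: "\<And>x. x \<in> carrier N \<Longrightarrow> b \<one>\<^bsub>G\<^esub> x = x"
  shows "group_ring_module G N b"
proof -
  interpret G: group G by fact
  interpret N: comm_group N by fact
  have bij: "bij_betw (b g) (carrier N) (carrier N)" if g: "g \<in> carrier G" for g
    by (rule bij_betw_byWitness[where f' = "b (inv\<^bsub>G\<^esub> g)"])
       (use g in \<open>auto simp: c o simp flip: a\<close>)
  have au: "b g \<in> auto N" if g: "g \<in> carrier G" for g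
    using g bij[OF g] by (auto simp: auto_def hom_def Bij_def c m e)
  have "b \<in> hom G (AutoGroup N)"
  proof (rule homI)
    fix g assume "g \<in> carrier G" then show "b g \<in> carrier (AutoGroup N)"
      by (simp add: AutoGroup_def au)
  next
    fix g h assume gh: "g \<in> carrier G" "h \<in> carrier G"
    then have "b (g \<otimes>\<^bsub>G\<^esub> h) = compose (carrier N) (b g) (b h)"
      by (intro extensionalityI[OF e compose_extensional]) (auto simp: a compose_def)
    then show "b (g \<otimes>\<^bsub>G\<^esub> h) = b g \<otimes>\<^bsub>AutoGroup N\<^esub> b h"
      using au[OF gh(1)] au[OF gh(2)] by (simp add: AutoGroup_def BijGroup_def auto_def)
  qed
  then show ?thesis by unfold_locales
qed

context group_ring_module begin

lemma act_auto: "g \<in> carrier G \<Longrightarrow> act g \<in> auto M"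
  using act_hom by (auto simp: hom_def AutoGroup_def)

lemma act_closed [simp]: "g \<in> carrier G \<Longrightarrow> x \<in> carrier M \<Longrightarrow> act g x \<in> carrier M"
  using act_auto by (auto simp: auto_def hom_def)

lemma act_bij: "g \<in> carrier G \<Longrightarrow> bij_betw (act g) (carrier M) (carrier M)"
  using act_auto by (auto simp: auto_def Bij_def)

lemma act_mult: "g \<in> carrier G \<Longrightarrow> x \<in> carrier M \<Longrightarrow> y \<in> carrier M \<Longrightarrow>
   act g (x \<otimes>\<^bsub>M\<^esub> y) = act g x \<otimes>\<^bsub>M\<^esub> act g y"
  using act_auto by (auto simp: auto_def hom_def)

lemma act_act: "g \<in> carrier G \<Longrightarrow> h \<in> carrier G \<Longrightarrow> x \<in> carrier M \<Longrightarrow>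
   act (g \<otimes>\<^bsub>G\<^esub> h) x = act g (act h x)"
  using hom_mult[OF act_hom, of g h] act_auto[of g] act_auto[of h]
  by (auto simp: AutoGroup_def BijGroup_def auto_def compose_def)

lemma act_one: assumes "x \<in> carrier M" shows "act \<one>\<^bsub>G\<^esub> x = x"
proof -
  have "act \<one>\<^bsub>G\<^esub> = \<one>\<^bsub>AutoGroup M\<^esub>"
    by (rule hom_one[OF act_hom G.is_group M.AutoGroup])
  then show ?thesis using assms by (simp add: AutoGroup_def BijGroup_def)
qed

end

definition fg_free_abelian :: "('m, 'b) monoid_scheme \<Rightarrow> bool" where
  "fg_free_abelian M \<longleftrightarrow> comm_group M \<and> (\<exists>n::nat. M \<cong> free_Abelian_group {..<n})"

definition tuples :: "'c set \<Rightarrow> nat \<Rightarrow> 'c list set" where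
  "tuples A n = {xs. set xs \<subseteq> A \<and> length xs = n}"

text \<open>The relations impose additivity in each slot and the vanishing of every
  \<open>x\<^sub>1 \<and> \<dots> \<and> x\<^sub>j\<close> with a repeated entry, so the quotient below is \<open>\<Lambda>\<^sup>j\<close> over \<open>\<int>\<close>: the
  target of the universal alternating multilinear map \<open>M\<^sup>j \<rightarrow> \<Lambda>\<^sup>j(M)\<close>.\<close>

definition exterior_relations :: "('m, 'b) monoid_scheme \<Rightarrow> nat \<Rightarrow> ('m list \<Rightarrow>\<^sub>0 int) set" where
  "exterior_relations M j =
     {frag_of (xs[k := x \<otimes>\<^bsub>M\<^esub> y]) - frag_of (xs[k := x]) - frag_of (xs[k := y]) | xs k x y.
        xs \<in> tuples (carrier M) j \<and> k < j \<and> x \<in> carrier M \<and> y \<in> carrier M} \<union>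
     {frag_of xs | xs. xs \<in> tuples (carrier M) j \<and> \<not> distinct xs}"

definition exterior_power ::
    "('m, 'b) monoid_scheme \<Rightarrow> nat \<Rightarrow> ('m list \<Rightarrow>\<^sub>0 int) set monoid" where
  "exterior_power M j =
     (let F = free_Abelian_group (tuples (carrier M) j)
      in F Mod generate F (exterior_relations M j))"

lemma exterior_relations_closed:
  assumes "comm_group M"
  shows "exterior_relations M j \<subseteq> carrier (free_Abelian_group (tuples (carrier M) j))"
proof -
  interpret M: comm_group M by fact
  have u: "xs[k := z] \<in> tuples (carrier M) j" if "xs \<in> tuples (carrier M) j" "z \<in> carrier M" for xs k z
    using that set_update_subset_insert[of xs k z] by (auto simp: tuples_def)
  have d: "frag_of a - frag_of b - frag_of c \<in> carrier (free_Abelian_group S)"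
    if "a \<in> S" "b \<in> S" "c \<in> S" for a b c :: "'a list" and S
    using that keys_diff[of "frag_of a - frag_of b" "frag_of c"] keys_diff[of "frag_of a" "frag_of b"]
    by auto
  show ?thesis
    unfolding exterior_relations_def by (auto simp del: carrier_free_Abelian_group_iff intro!: d u) 
qed

lemma normal_exterior:
  assumes "comm_group M"
  shows "generate (free_Abelian_group (tuples (carrier M) j)) (exterior_relations M j)
    \<lhd> free_Abelian_group (tuples (carrier M) j)"
proof -
  interpret F: comm_group "free_Abelian_group (tuples (carrier M) j)"
    by (rule abelian_free_Abelian_group)
  show ?thesis
    using exterior_relations_closed[OF assms(1), of j]
    by (intro F.subgroup_imp_normal F.generate_is_subgroup)
qed

lemma comm_group_exterior_power:
  assumes "comm_group M"
  shows "comm_group (exterior_power M j)"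
proof -
  let ?F = "free_Abelian_group (tuples (carrier M) j)"
  interpret F: comm_group ?F by (rule abelian_free_Abelian_group)
  show ?thesis
    using normal_exterior[OF assms, of j] unfolding exterior_power_def Let_def
    by (intro F.abelian_FactGroup normal_imp_subgroup)
qed

text \<open>The diagonal action \<open>g (x\<^sub>1 \<and> \<dots> \<and> x\<^sub>j) = g x\<^sub>1 \<and> \<dots> \<and> g x\<^sub>j\<close>, computed on cosets.\<close>

definition exterior_act ::
    "('m, 'b) monoid_scheme \<Rightarrow> ('g \<Rightarrow> 'm \<Rightarrow> 'm) \<Rightarrow> nat
      \<Rightarrow> 'g \<Rightarrow> ('m list \<Rightarrow>\<^sub>0 int) set \<Rightarrow> ('m list \<Rightarrow>\<^sub>0 int) set" where
  "exterior_act M act j g =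
     (\<lambda>C \<in> carrier (exterior_power M j). frag_extend (frag_of \<circ> map (act g)) ` C)"

lemma (in group_ring_module) exterior_group_ring_module:
  "group_ring_module G (exterior_power M j) (exterior_act M act j)"
proof -
  define S where "S = tuples (carrier M) j"
  define F where "F = free_Abelian_group S"
  define R where "R = exterior_relations M j"
  define N where "N = generate F R"
  define T where "T g = frag_extend (frag_of \<circ> map (act g))" for g
  have cM: "comm_group M" by (rule M.comm_group_axioms)
  interpret F: comm_group F unfolding F_def by (rule abelian_free_Abelian_group)
  have R: "R \<subseteq> carrier F" using exterior_relations_closed[OF cM] by (simp add: R_def F_def S_def)
  have N: "N \<lhd> F" using normal_exterior[OF cM] by (simp add: N_def F_def S_def R_def)
  interpret N: normal N F by (rule N)
  have P: "exterior_power M j = F Mod N"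
    by (simp add: exterior_power_def Let_def N_def F_def S_def R_def)
  have mapS: "map (act g) xs \<in> S" if "g \<in> carrier G" "xs \<in> S" for g xs
    using that by (auto simp: S_def tuples_def)
  have Tc: "T g c \<in> carrier F" if "g \<in> carrier G" "c \<in> carrier F" for g c
    using that keys_frag_extend[of "frag_of \<circ> map (act g)" c] mapS by (fastforce simp: F_def T_def)
  have Tadd: "T g (c + d) = T g c + T g d" for g c d by (simp add: T_def frag_extend_add)
  have Tdiff: "T g (c - d) = T g c - T g d" for g c d by (simp add: T_def frag_extend_diff)
  have Tof: "T g (frag_of xs) = frag_of (map (act g) xs)" for g xs by (simp add: T_def)
  have TT: "T (g \<otimes>\<^bsub>G\<^esub> h) c = T g (T h c)" if "g \<in> carrier G" "h \<in> carrier G" "c \<in> carrier F" for g h c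
  proof -
    have "T g (T h c) = frag_extend ((frag_of \<circ> map (act g)) \<circ> map (act h)) c"
      unfolding T_def by (rule frag_extend_compose)
    also have "\<dots> = T (g \<otimes>\<^bsub>G\<^esub> h) c"
      unfolding T_def using that
      by (intro frag_extend_eq) (auto simp: F_def S_def tuples_def act_act subset_iff intro!: arg_cong[of _ _ frag_of])
    finally show ?thesis ..
  qed
  have T1: "T \<one>\<^bsub>G\<^esub> c = c" if "c \<in> carrier F" for c
  proof -
    have "T \<one>\<^bsub>G\<^esub> c = frag_extend frag_of c"
      unfolding T_def using that
      by (intro frag_extend_eq) (auto simp: F_def S_def tuples_def act_one subset_iff intro!: arg_cong[of _ _ frag_of] map_idI)
    then show ?thesis by (simp flip: frag_expansion)
  qed
  have TR: "T g c \<in> R" if g: "g \<in> carrier G" and c: "c \<in> R" for g c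
  proof -
    consider (add) xs k x y where "xs \<in> S" "k < j" "x \<in> carrier M" "y \<in> carrier M"
        "c = frag_of (xs[k := x \<otimes>\<^bsub>M\<^esub> y]) - frag_of (xs[k := x]) - frag_of (xs[k := y])"
      | (alt) xs where "xs \<in> S" "\<not> distinct xs" "c = frag_of xs"
      using c unfolding R_def exterior_relations_def S_def by blast
    then show ?thesis
    proof cases
      case add
      have "T g c = frag_of ((map (act g) xs)[k := act g x \<otimes>\<^bsub>M\<^esub> act g y])
          - frag_of ((map (act g) xs)[k := act g x]) - frag_of ((map (act g) xs)[k := act g y])"
        using add g by (simp add: Tdiff Tof map_update act_mult)
      then show ?thesis
        unfolding R_def exterior_relations_def
        using add g mapS[OF g, of xs] unfolding S_def by (intro UnI1) (blast intro: act_closed)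
    next
      case alt
      have "\<not> distinct (map (act g) xs)" using alt by (simp add: distinct_map)
      then show ?thesis
        using alt mapS[OF g, of xs] unfolding R_def exterior_relations_def S_def
        by (intro UnI2) (auto simp: Tof)
    qed
  qed
  have Thom: "group_hom F F (T g)" if "g \<in> carrier G" for g
    by unfold_locales (use that in \<open>auto simp: hom_def Tc, simp add: F_def Tadd\<close>)
  have TN: "T g c \<in> N" if "g \<in> carrier G" "c \<in> N" for g c
  proof -
    have "T g ` N = generate F (T g ` R)"
      using group_hom.generate_img[OF Thom[OF that(1)] R] by (simp add: N_def)
    also have "\<dots> \<subseteq> N" unfolding N_def using TR[OF that(1)] by (intro F.mono_generate) auto
    finally show ?thesis using that by auto
  qed
  have NF: "N \<subseteq> carrier F" by (rule N.subset)
  have TNeq: "T g ` N = N" if g: "g \<in> carrier G" for g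
  proof -
    have "c \<in> T g ` N" if "c \<in> N" for c
    proof (rule image_eqI)
      show "T (inv\<^bsub>G\<^esub> g) c \<in> N" using TN g that by simp
      show "c = T g (T (inv\<^bsub>G\<^esub> g) c)" using g that NF by (simp add: subset_iff T1 flip: TT)
    qed
    then show ?thesis using TN[OF g] by auto
  qed
  have Tcoset: "T g ` (N #>\<^bsub>F\<^esub> c) = N #>\<^bsub>F\<^esub> T g c" if g: "g \<in> carrier G" for g c
  proof -
    have "T g ` (N #>\<^bsub>F\<^esub> c) = (\<lambda>n. n + T g c) ` (T g ` N)"
      by (auto simp: r_coset_def F_def Tadd image_iff)
    then show ?thesis using TNeq[OF g] by (auto simp: r_coset_def F_def)
  qed
  have E: "exterior_act M act j g (N #>\<^bsub>F\<^esub> c) = N #>\<^bsub>F\<^esub> T g c"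
    if "g \<in> carrier G" "c \<in> carrier F" for g c
    using Tcoset[OF that(1), of c] that
    by (auto simp: exterior_act_def P FactGroup_def RCOSETS_def T_def)
  have car: "\<exists>c \<in> carrier F. C = N #>\<^bsub>F\<^esub> c" if "C \<in> carrier (exterior_power M j)" for C
    using that by (auto simp: P FactGroup_def RCOSETS_def)
  have car': "N #>\<^bsub>F\<^esub> c \<in> carrier (exterior_power M j)" if "c \<in> carrier F" for c
    using that by (auto simp: P FactGroup_def RCOSETS_def)
  have mul: "(N #>\<^bsub>F\<^esub> c) \<otimes>\<^bsub>exterior_power M j\<^esub> (N #>\<^bsub>F\<^esub> d) = N #>\<^bsub>F\<^esub> (c + d)"
    if "c \<in> carrier F" "d \<in> carrier F" for c d
    using N.rcos_sum[OF that] by (simp add: P FactGroup_def F_def)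
  have addF: "c + d \<in> carrier F" if "c \<in> carrier F" "d \<in> carrier F" for c d
    using F.m_closed[OF that] by (simp add: F_def)
  show ?thesis
  proof (rule group_ring_moduleI[OF G.is_group comm_group_exterior_power[OF cM]])
    fix g C D assume g: "g \<in> carrier G" and CD: "C \<in> carrier (exterior_power M j)"
      "D \<in> carrier (exterior_power M j)"
    obtain c d where cd: "c \<in> carrier F" "C = N #>\<^bsub>F\<^esub> c" "d \<in> carrier F" "D = N #>\<^bsub>F\<^esub> d" 
      using car CD by meson
    show "exterior_act M act j g (C \<otimes>\<^bsub>exterior_power M j\<^esub> D) =
       exterior_act M act j g C \<otimes>\<^bsub>exterior_power M j\<^esub> exterior_act M act j g D"
      using g cd by (simp add: mul E addF Tc Tadd)
  next
    fix g assume "g \<in> carrier G"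
    show "exterior_act M act j g \<in> extensional (carrier (exterior_power M j))"
      by (simp add: exterior_act_def)
  next
    fix g C assume g: "g \<in> carrier G" and "C \<in> carrier (exterior_power M j)"
    then show "exterior_act M act j g C \<in> carrier (exterior_power M j)"
      using car[of C] by (auto simp: E car' Tc)
  next
    fix g h C assume "g \<in> carrier G" "h \<in> carrier G" "C \<in> carrier (exterior_power M j)"
    then show "exterior_act M act j (g \<otimes>\<^bsub>G\<^esub> h) C = exterior_act M act j g (exterior_act M act j h C)"
      using car[of C] by (auto simp: E Tc TT)
  next
    fix C assume "C \<in> carrier (exterior_power M j)"
    then show "exterior_act M act j \<one>\<^bsub>G\<^esub> C = C"
      using car[of C] by (auto simp: E T1)
  qed
qed

text \<open>Tate cohomology is the cohomology of \<open>Hom\<^sub>G(X, M)\<close> for the standard complete resolution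
  \<open>X\<close> of a finite group \<open>G\<close>. For \<open>i \<ge> 0\<close>, \<open>X\<^sub>i\<close> is free abelian on \<open>G\<^sup>i\<^sup>+\<^sup>1\<close> with the diagonal
  action, and
    \<open>d (g\<^sub>0, \<dots>, g\<^sub>i) = \<Sum>\<^sub>k (-1)\<^sup>k (g\<^sub>0, \<dots>, g\<^sub>k\<^sub>-\<^sub>1, g\<^sub>k\<^sub>+\<^sub>1, \<dots>, g\<^sub>i)\<close>  for \<open>i \<ge> 1\<close>;
  for \<open>s \<ge> 1\<close>, \<open>X\<^sub>-\<^sub>s\<close> is the dual of \<open>X\<^sub>s\<^sub>-\<^sub>1\<close>, free abelian on (the dual basis indexed by) \<open>G\<^sup>s\<close>,
  and
    \<open>d (g\<^sub>1, \<dots>, g\<^sub>s) = \<Sum>\<^sub>g \<Sum>\<^sub>k (-1)\<^sup>k (g\<^sub>1, \<dots>, g\<^sub>k, g, g\<^sub>k\<^sub>+\<^sub>1, \<dots>, g\<^sub>s)\<close>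
  is dual to the differential of \<open>X\<^sub>s\<close>. The two halves are spliced by \<open>d (g\<^sub>0) = \<Sum>\<^sub>g (g)\<close> from
  \<open>X\<^sub>0\<close> to \<open>X\<^sub>-\<^sub>1\<close>, the augmentation \<open>X\<^sub>0 \<rightarrow> \<int>\<close> followed by its dual \<open>\<int> \<rightarrow> X\<^sub>-\<^sub>1\<close>. Hence a
  cochain of degree \<open>i\<close> is an equivariant map from tuples of the following length to \<open>M\<close>.\<close>

definition tate_len :: "int \<Rightarrow> nat" where
  "tate_len i = (if i \<ge> 0 then nat (i + 1) else nat (- i))"

definition tate_cochains ::
    "('g, 'a) monoid_scheme \<Rightarrow> ('m, 'b) monoid_scheme \<Rightarrow> ('g \<Rightarrow> 'm \<Rightarrow> 'm) \<Rightarrow> int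
      \<Rightarrow> ('g list \<Rightarrow> 'm) monoid" where
  "tate_cochains G M act i =
     (product_group (tuples (carrier G) (tate_len i)) (\<lambda>_. M))
       \<lparr>carrier := {f \<in> tuples (carrier G) (tate_len i) \<rightarrow>\<^sub>E carrier M.
          \<forall>g \<in> carrier G. \<forall>xs \<in> tuples (carrier G) (tate_len i).
            f (map (\<lambda>x. g \<otimes>\<^bsub>G\<^esub> x) xs) = act g (f xs)}\<rparr>"

definition tate_d ::
    "('g, 'a) monoid_scheme \<Rightarrow> ('m, 'b) monoid_scheme \<Rightarrow> int \<Rightarrow> ('g list \<Rightarrow> 'm) \<Rightarrow> 'g list \<Rightarrow> 'm"
  where
  "tate_d G M i f = (\<lambda>xs \<in> tuples (carrier G) (tate_len (i + 1)).
     if i \<ge> 0 then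
       \<Otimes>\<^bsub>M\<^esub>k\<in>{..<length xs}. f (take k xs @ drop (Suc k) xs) [^]\<^bsub>M\<^esub> ((-1)^k :: int)
     else if i = -1 then
       \<Otimes>\<^bsub>M\<^esub>g\<in>carrier G. f [g]
     else
       \<Otimes>\<^bsub>M\<^esub>g\<in>carrier G. \<Otimes>\<^bsub>M\<^esub>k\<in>{..length xs}.
         f (take k xs @ g # drop k xs) [^]\<^bsub>M\<^esub> ((-1)^k :: int))"

definition tate_cohomology ::
    "('g, 'a) monoid_scheme \<Rightarrow> ('m, 'b) monoid_scheme \<Rightarrow> ('g \<Rightarrow> 'm \<Rightarrow> 'm) \<Rightarrow> int
      \<Rightarrow> ('g list \<Rightarrow> 'm) set monoid" where
  "tate_cohomology G M act i =
     (tate_cochains G M act i)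
       \<lparr>carrier := kernel (tate_cochains G M act i) (tate_cochains G M act (i + 1)) (tate_d G M i)\<rparr>
     Mod (tate_d G M (i - 1) ` carrier (tate_cochains G M act (i - 1)))"

end

theory Submission
  imports Defs "HOL-Library.Function_Algebras" "HOL-Library.Multiset"
    "HOL-Computational_Algebra.Polynomial" "HOL-Computational_Algebra.Primes"
begin

text \<open>Tate cohomology of a cyclic group is 2-periodic, so only degrees \<open>0\<close> and \<open>-1\<close> matter, and a
  transfer argument reduces these to a cyclic group \<open>\<langle>s\<rangle>\<close> of order \<open>p\<^sup>r\<close>. There freeness outside the
  origin makes \<open>L\<close> a module over \<open>\<int>[X]/\<Phi>\<close>, where \<open>\<Phi>\<close> is the \<open>p\<^sup>r\<close>-th cyclotomic polynomial, and up to an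
  index prime to \<open>p\<close> this module is free: it is a quotient \<open>F/K\<close>, where \<open>F\<close> has a basis of cells permuted
  freely by \<open>s\<close> and \<open>K\<close> is spanned by the sums over the orbits of the subgroup of order \<open>p\<close>. The part of the
  Koszul resolution \<open>Sym\<^sup>a(K) \<otimes> \<Lambda>\<^sup>j\<^sup>-\<^sup>a(F)\<close> of \<open>\<Lambda>\<^sup>j(F/K)\<close> whose multidegree is less than \<open>p\<close> at every
  orbit still resolves \<open>\<Lambda>\<^sup>j(F/K)\<close>, since \<open>F/K\<close> has rank \<open>p - 1\<close> at each orbit. In this part
  a subset of the basis stable under a nontrivial subgroup would contain a full orbit, so the terms with \<open>a < j\<close>
  are induced, while the term with \<open>a = j\<close> is a permutation module, whose cohomology vanishes in odd
  degrees. Shifting dimensions \<open>j\<close> times gives the result.\<close>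

section \<open>Norms and the vanishing of Tate cohomology in degrees 0 and -1\<close>

text \<open>Localised at p, the ring \<open>\<int>[X]/\<Phi>\<close> is a discrete valuation ring
  with uniformiser X - 1: \<Phi>(1) = p puts p into the ideal (X - 1, \<Phi>), and (X - 1)^P lies in
  (p, \<Phi>). A minimal generating set of the lattice modulo s - 1 is therefore a basis after
  localisation; the price is one integer \<open>q\<close> prime to p. The comparison with the Koszul
  complex is a retraction up to \<open>q ^ j\<close>: a map into the complex and a map out of it,
  compatible with the action up to boundaries, whose composite multiplies by \<open>q ^ j\<close>.
  Factors prime to p are removed at the end, over all primes at once. The truncation is forced: a
  full orbit of the subgroup of order p inside a wedge monomial is a stable set, so its term would
  not be induced, and for p = 2 the rotation may even reverse its sign. The parity in the theorem
  arises because the permutation module at the top has vanishing cohomology in degree -1, while each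
  shift along the resolution exchanges the degrees -1 and 0.\<close>

definition add_closed :: "'a::ab_group_add set \<Rightarrow> bool" where
  "add_closed S \<longleftrightarrow> 0 \<in> S \<and> (\<forall>x\<in>S. \<forall>y\<in>S. x - y \<in> S)"

lemma add_closed_zero: "add_closed S \<Longrightarrow> 0 \<in> S"
  and add_closed_diff: "add_closed S \<Longrightarrow> x \<in> S \<Longrightarrow> y \<in> S \<Longrightarrow> x - y \<in> S"
  by (auto simp: add_closed_def)

lemma add_closed_minus: "add_closed S \<Longrightarrow> x \<in> S \<Longrightarrow> - x \<in> S"
  using add_closed_diff[of S 0 x] add_closed_zero[of S] by simp

lemma add_closed_add: "add_closed S \<Longrightarrow> x \<in> S \<Longrightarrow> y \<in> S \<Longrightarrow> x + y \<in> S"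
  using add_closed_diff[of S x "- y"] add_closed_minus[of S y] by simp

lemma add_closed_sum: "add_closed S \<Longrightarrow> (\<And>i. i \<in> I \<Longrightarrow> f i \<in> S) \<Longrightarrow> sum f I \<in> S"
  by (induction I rule: infinite_finite_induct) (auto simp: add_closed_zero add_closed_add)

lemma add_closed_cancel: "add_closed S \<Longrightarrow> x - y \<in> S \<Longrightarrow> y \<in> S \<Longrightarrow> x \<in> S"
  using add_closed_add[of S "x - y" y] by simp

lemma add_closed_diff_swap: "add_closed S \<Longrightarrow> x - y \<in> S \<Longrightarrow> y - x \<in> S"
  using add_closed_minus[of S "x - y"] by simp

lemma add_closed_diff_trans: "add_closed S \<Longrightarrow> x - y \<in> S \<Longrightarrow> y - z \<in> S \<Longrightarrow> x - z \<in> S"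
  using add_closed_add[of S "x - y" "y - z"] by simp

lemma add_closed_singleton_zero [simp]: "add_closed {0}"
  by (simp add: add_closed_def)

lemma add_closed_image:
  assumes "additive f" "add_closed S" shows "add_closed (f ` S)"
  unfolding add_closed_def
proof (intro conjI ballI)
  show "0 \<in> f ` S"
    using additive.zero[OF assms(1)] add_closed_zero[OF assms(2)] by (metis image_eqI)
  fix x y assume "x \<in> f ` S" "y \<in> f ` S"
  then obtain a b where "a \<in> S" "b \<in> S" "x - y = f (a - b)"
    by (auto simp: additive.diff[OF assms(1)])
  then show "x - y \<in> f ` S" using add_closed_diff[OF assms(2)] by simp
qed

lemma additive_funpow: "additive (f :: 'a::ab_group_add \<Rightarrow> 'a) \<Longrightarrow> additive (f ^^ k)"
  by (induction k) (auto simp: additive_def)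

lemma funpow_closed: "(\<And>x. x \<in> S \<Longrightarrow> f x \<in> S) \<Longrightarrow> x \<in> S \<Longrightarrow> (f ^^ k) x \<in> S"
  by (induction k) auto

text \<open>For \<open>m\<close> the order of T this is the norm element; for other \<open>m\<close>
  it is the partial geometric sum through which T^m - 1 factors over T - 1. Both uses occur.\<close>

definition norm_op :: "nat \<Rightarrow> ('a::ab_group_add \<Rightarrow> 'a) \<Rightarrow> 'a \<Rightarrow> 'a" where
  "norm_op m T x = (\<Sum>k<m. (T ^^ k) x)"

lemma additive_norm_op: "additive T \<Longrightarrow> additive (norm_op m T)"
  unfolding norm_op_def using additive_funpow[of T] by (auto simp: additive_def sum.distrib)

lemma norm_op_closed: "add_closed S \<Longrightarrow> (\<And>x. x \<in> S \<Longrightarrow> T x \<in> S) \<Longrightarrow> x \<in> S \<Longrightarrow> norm_op m T x \<in> S"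
  unfolding norm_op_def by (intro add_closed_sum funpow_closed)

lemma norm_op_commute:
  assumes "additive f" "\<And>x. x \<in> S \<Longrightarrow> f (T x) = T' (f x)" "\<And>x. x \<in> S \<Longrightarrow> T x \<in> S" "x \<in> S"
  shows "f (norm_op m T x) = norm_op m T' (f x)"
proof -
  have "f ((T ^^ k) x) = (T' ^^ k) (f x)" for k
    by (induction k) (use assms funpow_closed[of S T x] in auto)
  then show ?thesis unfolding norm_op_def by (simp add: additive.sum[OF assms(1)])
qed

lemma norm_op_shift: "additive T \<Longrightarrow> norm_op m T (T x) = T (norm_op m T x)"
  using norm_op_commute[of T UNIV T T x m] by simp

lemma norm_op_telescope: "additive T \<Longrightarrow> T (norm_op m T x) - norm_op m T x = (T ^^ m) x - x"
  by (induction m) (auto simp: norm_op_def additive.zero additive.add algebra_simps)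

lemma funpow_diff_eq: "additive T \<Longrightarrow> (T ^^ k) x - x = T (norm_op k T x) - norm_op k T x"
  by (simp add: norm_op_telescope)

lemma norm_op_diff_fixed:
  "additive T \<Longrightarrow> norm_op m T (T x - x) = (T ^^ m) x - x"
  by (simp add: additive.diff[OF additive_norm_op] norm_op_shift norm_op_telescope)

text \<open>The vanishing of the Tate cohomology of \<open>C/Z\<close> in degrees \<open>0\<close> and \<open>-1\<close>, for a cyclic group of order
  \<open>m\<close> whose generator acts by \<open>T\<close>. Modules are given as such quotients, with \<open>C\<close> inside an additive type,
  and all identities are required only modulo \<open>Z\<close>.\<close>

definition tate0 :: "'a::ab_group_add set \<Rightarrow> 'a set \<Rightarrow> ('a \<Rightarrow> 'a) \<Rightarrow> nat \<Rightarrow> bool" where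
  "tate0 C Z T m \<longleftrightarrow> (\<forall>x\<in>C. T x - x \<in> Z \<longrightarrow> (\<exists>y\<in>C. x - norm_op m T y \<in> Z))"

definition tate1 :: "'a::ab_group_add set \<Rightarrow> 'a set \<Rightarrow> ('a \<Rightarrow> 'a) \<Rightarrow> nat \<Rightarrow> bool" where
  "tate1 C Z T m \<longleftrightarrow> (\<forall>x\<in>C. norm_op m T x \<in> Z \<longrightarrow> (\<exists>y\<in>C. x - (T y - y) \<in> Z))"

definition submodule_pair :: "'a::ab_group_add set \<Rightarrow> 'a set \<Rightarrow> ('a \<Rightarrow> 'a) \<Rightarrow> bool" where
  "submodule_pair C Z T \<longleftrightarrow> add_closed C \<and> add_closed Z \<and> Z \<subseteq> C \<and> additive T \<and>
     (\<forall>x\<in>C. T x \<in> C) \<and> (\<forall>x\<in>Z. T x \<in> Z)"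

lemma submodule_pairD:
  assumes "submodule_pair C Z T"
  shows "add_closed C" "add_closed Z" "Z \<subseteq> C" "additive T"
    "\<And>x. x \<in> C \<Longrightarrow> T x \<in> C" "\<And>x. x \<in> Z \<Longrightarrow> T x \<in> Z"
  using assms by (auto simp: submodule_pair_def)

text \<open>\<open>split\<close> says that the identity is the trace of E, with T^(m-k) in the role
  of the inverse of T^k: the usual criterion for relative projectivity over the trivial subgroup. On
  a fixed x the trace is the norm of E x.\<close>

lemma
  assumes P: "submodule_pair C Z T" and E: "additive E" "\<And>x. x \<in> C \<Longrightarrow> E x \<in> C" "\<And>x. x \<in> Z \<Longrightarrow> E x \<in> Z"
    and split: "\<And>x. x \<in> C \<Longrightarrow> (\<Sum>k<m. (T ^^ k) (E ((T ^^ (m - k)) x))) - x \<in> Z"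
  shows tate0_induced: "tate0 C Z T m" and tate1_induced: "tate1 C Z T m"
proof -
  note C = submodule_pairD[OF P]
  note Ta = additive_funpow[OF C(4)]
  show "tate0 C Z T m"
    unfolding tate0_def
  proof (intro ballI impI bexI)
    fix x assume x: "x \<in> C" "T x - x \<in> Z"
    have fix1: "(T ^^ k) x - x \<in> Z" for k
    proof (induction k)
      case 0 then show ?case by (simp add: add_closed_zero[OF C(2)])
    next
      case (Suc k)
      have "T ((T ^^ k) x) - T x \<in> Z" using C(6)[OF Suc] by (simp add: additive.diff[OF C(4)])
      then show ?case using add_closed_diff_trans[OF C(2) _ x(2)] by simp
    qed
    have "(T ^^ k) (E ((T ^^ l) x)) - (T ^^ k) (E x) \<in> Z" for k l
      using funpow_closed[of Z T, OF C(6) E(3)[OF fix1]]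
      by (simp add: additive.diff[OF Ta] additive.diff[OF E(1)])
    then have "(\<Sum>k<m. (T ^^ k) (E ((T ^^ (m - k)) x))) - norm_op m T (E x) \<in> Z"
      unfolding norm_op_def sum_subtractf[symmetric] by (intro add_closed_sum[OF C(2)])
    then show "x - norm_op m T (E x) \<in> Z"
      using split[OF x(1)] add_closed_diff_trans[OF C(2)] add_closed_diff_swap[OF C(2)] by blast
    show "E x \<in> C" using x E by simp
  qed
  show "tate1 C Z T m"
    unfolding tate1_def
  proof (intro ballI impI bexI)
    fix x assume x: "x \<in> C" "norm_op m T x \<in> Z"
    \<comment> \<open>Since T^k - 1 = (T - 1) N_k, applying T - 1 to this y gives the trace of E at
      x minus the sum of E over the translates of x. The latter is E (T (N x)), which lies in
      Z.\<close>
    define y where "y = (\<Sum>k<m. norm_op k T (E ((T ^^ (m - k)) x)))"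
    have "(\<Sum>k<m. E ((T ^^ (m - k)) x)) = E (\<Sum>k<m. (T ^^ (m - k)) x)"
      by (simp add: additive.sum[OF E(1)])
    also have "(\<Sum>k<m. (T ^^ (m - k)) x) = (\<Sum>k<m. (T ^^ Suc (m - Suc k)) x)"
      by (intro sum.cong) (auto simp only: Suc_diff_Suc lessThan_iff)
    also have "\<dots> = (\<Sum>k<m. (T ^^ Suc k) x)"
      by (rule sum.nat_diff_reindex)
    also have "\<dots> = (\<Sum>k<m. T ((T ^^ k) x))" by simp
    also have "\<dots> = T (norm_op m T x)" by (simp add: norm_op_def additive.sum[OF C(4)])
    finally have s: "(\<Sum>k<m. E ((T ^^ (m - k)) x)) \<in> Z" using C E x by simp
    have "T y - y = (\<Sum>k<m. (T ^^ k) (E ((T ^^ (m - k)) x)) - E ((T ^^ (m - k)) x))"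
    proof -
      have "T y = (\<Sum>k<m. T (norm_op k T (E ((T ^^ (m - k)) x))))"
        unfolding y_def by (rule additive.sum[OF C(4)])
      then have "T y - y = (\<Sum>k<m. T (norm_op k T (E ((T ^^ (m - k)) x))) - norm_op k T (E ((T ^^ (m - k)) x)))"
        unfolding sum_subtractf by (simp flip: y_def)
      also have "\<dots> = (\<Sum>k<m. (T ^^ k) (E ((T ^^ (m - k)) x)) - E ((T ^^ (m - k)) x))"
        by (subst norm_op_telescope[OF C(4)]) (rule refl)
      finally show ?thesis .
    qed
    then have "x - (T y - y) = (\<Sum>k<m. E ((T ^^ (m - k)) x)) - ((\<Sum>k<m. (T ^^ k) (E ((T ^^ (m - k)) x))) - x)"
      by (simp add: sum_subtractf)
    also have "\<dots> \<in> Z" using s split[OF x(1)] add_closed_diff[OF C(2)] by blast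
    finally show "x - (T y - y) \<in> Z" .
    show "y \<in> C" unfolding y_def
      by (intro add_closed_sum[OF C(1)] norm_op_closed[OF C(1)] C E funpow_closed[of C T] x)
  qed
qed

text \<open>Long exact sequence of B -> C -> C/B: the connecting map sends y, fixed modulo B, to T y
  - y, an element of B of norm zero. Thus degree -1 of B stands in for degree 1.\<close>

lemma tate0_quotient:
  assumes P: "submodule_pair C B T" and m: "\<And>x. x \<in> C \<Longrightarrow> (T ^^ m) x = x"
    and B: "tate1 B {0} T m" and C: "tate0 C {0} T m"
  shows "tate0 C B T m"
  unfolding tate0_def
proof (intro ballI impI)
  note D = submodule_pairD[OF P]
  fix y assume y: "y \<in> C" "T y - y \<in> B"
  have "norm_op m T (T y - y) = 0" using m y by (simp add: norm_op_diff_fixed[OF D(4)])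
  then obtain z where z: "z \<in> B" "T y - y = T z - z" using B y by (auto simp: tate1_def)
  have "T (y - z) - (y - z) = 0" using z by (simp add: additive.diff[OF D(4)] algebra_simps)
  moreover have "y - z \<in> C" using y z D add_closed_diff by blast
  ultimately obtain w where w: "w \<in> C" "norm_op m T w = y - z" using C by (auto simp: tate0_def)
  have "y - norm_op m T w = z" unfolding w by simp
  then show "\<exists>w\<in>C. y - norm_op m T w \<in> B" using z(1) w(1) by metis
qed

text \<open>Here the connecting map, from degree -1 to degree 0, is the norm.\<close>

lemma tate1_quotient:
  assumes P: "submodule_pair C B T" and m: "\<And>x. x \<in> C \<Longrightarrow> (T ^^ m) x = x"
    and B: "tate0 B {0} T m" and C: "tate1 C {0} T m"
  shows "tate1 C B T m"
  unfolding tate1_def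
proof (intro ballI impI)
  note D = submodule_pairD[OF P]
  fix y assume y: "y \<in> C" "norm_op m T y \<in> B"
  have "T (norm_op m T y) - norm_op m T y = 0" using m y by (simp add: norm_op_telescope[OF D(4)])
  then obtain z where z: "z \<in> B" "norm_op m T y = norm_op m T z" using B y by (auto simp: tate0_def)
  have "norm_op m T (y - z) = 0" using z by (simp add: additive.diff[OF additive_norm_op[OF D(4)]])
  moreover have "y - z \<in> C" using y z D add_closed_diff by blast
  ultimately obtain w where w: "w \<in> C" "T w - w = y - z" using C by (auto simp: tate1_def)
  have "y - (T w - w) = z" unfolding w by simp
  then show "\<exists>w\<in>C. y - (T w - w) \<in> B" using z(1) w(1) by metis
qed

text \<open>The map d identifies C/B with its image, so vanishing for the quotient becomes vanishing
  for a submodule of the next term of a complex.\<close>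

lemma
  assumes d: "additive d" "\<And>x. x \<in> C \<Longrightarrow> d (T x) = T' (d x)" "\<And>x. x \<in> C \<Longrightarrow> d x = 0 \<Longrightarrow> x \<in> B"
    "\<And>x. x \<in> B \<Longrightarrow> d x = 0" and P: "submodule_pair C B T"
  shows tate0_image: "tate0 C B T m \<Longrightarrow> tate0 (d ` C) {0} T' m"
    and tate1_image: "tate1 C B T m \<Longrightarrow> tate1 (d ` C) {0} T' m"
proof -
  note D = submodule_pairD[OF P]
  have N: "norm_op m T' (d x) = d (norm_op m T x)" if "x \<in> C" for x
    by (rule norm_op_commute[symmetric, where S = C]) (fact d D that)+
  show "tate0 (d ` C) {0} T' m" if A: "tate0 C B T m"
    unfolding tate0_def
  proof (safe)
    fix x assume x: "x \<in> C" "T' (d x) - d x = 0"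
    then have "T x - x \<in> B" using d D by (intro d(3) add_closed_diff[OF D(1)]) (auto simp: additive.diff)
    then obtain y where y: "y \<in> C" "x - norm_op m T y \<in> B" using A x(1) unfolding tate0_def by blast
    have "d x - d (norm_op m T y) = 0" using d(4)[OF y(2)] by (simp add: additive.diff[OF d(1)])
    then show "\<exists>y\<in>d ` C. d x - norm_op m T' y \<in> {0}" using N y by auto
  qed
  show "tate1 (d ` C) {0} T' m" if A: "tate1 C B T m"
    unfolding tate1_def
  proof (safe)
    fix x assume x: "x \<in> C" "norm_op m T' (d x) = 0"
    then have "norm_op m T x \<in> B" using d D N by (intro d(3) norm_op_closed[OF D(1)]) auto
    then obtain y where y: "y \<in> C" "x - (T y - y) \<in> B" using A x(1) unfolding tate1_def by blast
    have "d x - (d (T y) - d y) = 0" using d(4)[OF y(2)] by (simp add: additive.diff[OF d(1)])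
    then show "\<exists>y\<in>d ` C. d x - (T' y - y) \<in> {0}" using d y by auto
  qed
qed

section \<open>A truncated Koszul complex of permutation modules\<close>

text \<open>This is \<open>\<Sum>\<^sub>k (-1)\<^sup>k f x\<^sub>k (x\<^sub>0, \<dots>, x\<^sub>k\<^sub>-\<^sub>1, x\<^sub>k\<^sub>+\<^sub>1, \<dots>)\<close>; it serves both as the simplicial
  differential and as the exterior product with a vector.\<close>

fun del_sum :: "('x \<Rightarrow> 'x list \<Rightarrow> 'v::ab_group_add) \<Rightarrow> 'x list \<Rightarrow> 'v" where
  "del_sum f [] = 0"
| "del_sum f (x # xs) = f x xs - del_sum (\<lambda>y ys. f y (x # ys)) xs"

lemma del_sum_zero [simp]: "del_sum (\<lambda>x ys. 0) xs = 0"
  by (induction xs) auto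

lemma del_sum_add: "del_sum (\<lambda>x ys. f x ys + g x ys) xs = del_sum f xs + del_sum g xs"
  by (induction xs arbitrary: f g) (auto simp: algebra_simps)

lemma del_sum_diff: "del_sum (\<lambda>x ys. f x ys - g x ys) xs = del_sum f xs - del_sum g xs"
  by (induction xs arbitrary: f g) (auto simp: algebra_simps)

lemma del_sum_additive: "additive h \<Longrightarrow> h (del_sum f xs) = del_sum (\<lambda>x ys. h (f x ys)) xs"
  by (induction xs arbitrary: f) (auto simp: additive.zero additive.diff)

lemma del_sum_map: "del_sum f (map h xs) = del_sum (\<lambda>x ys. f (h x) (map h ys)) xs"
  by (induction xs arbitrary: f) auto

lemma del_sum_closed:
  assumes "add_closed S" "\<And>us x vs. xs = us @ x # vs \<Longrightarrow> f x (us @ vs) \<in> S"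
  shows "del_sum f xs \<in> S"
  using assms(2)
proof (induction xs arbitrary: f)
  case Nil then show ?case by (simp add: add_closed_zero[OF assms(1)])
next
  case (Cons y xs)
  have "del_sum (\<lambda>x ys. f x (y # ys)) xs \<in> S"
    using Cons.prems[of "y # _"] by (intro Cons.IH) auto
  then show ?case using Cons.prems[of "[]"] add_closed_diff[OF assms(1)] by simp
qed

lemma del_sum_cong:
  assumes "\<And>us x vs. xs = us @ x # vs \<Longrightarrow> f x (us @ vs) = g x (us @ vs)"
  shows "del_sum f xs = del_sum g xs"
proof -
  have "del_sum (\<lambda>x ys. f x ys - g x ys) xs \<in> {0}"
    by (rule del_sum_closed) (auto dest: assms)
  then show ?thesis by (simp add: del_sum_diff)
qed

lemma del_sum_nonzero:
  assumes "del_sum f xs \<noteq> 0"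
  obtains us x vs where "xs = us @ x # vs" "f x (us @ vs) \<noteq> 0"
  using del_sum_closed[of "{0}" xs f] assms by auto

text \<open>Removing the same two entries in the opposite order reverses the sign. Instances are d d
  = 0 and the anticommutativity of the exterior product.\<close>

lemma del_sum_del_sum:
  "del_sum (\<lambda>x. del_sum (g x)) xs = - del_sum (\<lambda>x. del_sum (\<lambda>y. g y x)) xs"
proof (induction xs arbitrary: g)
  case (Cons z xs)
  show ?case using Cons.IH[of "\<lambda>x y ys. g x y (z # ys)"] by (simp add: del_sum_diff)
qed simp

text \<open>Such an f is the coefficient function of an exterior form, with lists standing for wedge
  monomials in basis elements. Adjacent swaps generate all permutations; for integer values,
  vanishing on repeated entries follows from f = - f.\<close>

definition alternating :: "('x list \<Rightarrow> 'v::ab_group_add) \<Rightarrow> bool" where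
  "alternating f \<longleftrightarrow> (\<forall>us x y vs. f (us @ x # y # vs) = - f (us @ y # x # vs))"

lemma alternatingD: "alternating f \<Longrightarrow> f (us @ x # y # vs) = - f (us @ y # x # vs)"
  unfolding alternating_def by blast

lemma alternating_Cons: "alternating f \<Longrightarrow> alternating (\<lambda>ys. f (x # ys))"
  unfolding alternating_def by (metis append_Cons)

lemma alternating_del_sum:
  assumes "\<And>x. alternating (f x)" shows "alternating (del_sum f)"
  unfolding alternating_def
proof (intro allI)
  fix us x y vs
  show "del_sum f (us @ x # y # vs) = - del_sum f (us @ y # x # vs)"
    using assms
  proof (induction us arbitrary: f)
    case Nil
    have "(\<lambda>z ys. f z (x # y # ys)) = (\<lambda>z ys. - f z (y # x # ys))"
    proof (intro ext)
      show "f z (x # y # ys) = - f z (y # x # ys)" for z ys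
        using alternatingD[OF Nil[of z], of "[]" x y ys] by simp
    qed
    then have "del_sum (\<lambda>z ys. f z (x # y # ys)) vs = del_sum (\<lambda>z ys. - f z (y # x # ys)) vs"
      by (rule arg_cong)
    also have "\<dots> = - del_sum (\<lambda>z ys. f z (y # x # ys)) vs"
      by (rule del_sum_additive[symmetric]) (simp add: additive_def)
    finally show ?case by simp
  next
    case (Cons u us)
    have "alternating (\<lambda>ys. f z (u # ys))" for z using Cons.prems by (rule alternating_Cons)
    then have "del_sum (\<lambda>z ys. f z (u # ys)) (us @ x # y # vs) = - del_sum (\<lambda>z ys. f z (u # ys)) (us @ y # x # vs)"
      by (rule Cons.IH)
    then show ?case using alternatingD[OF Cons.prems[of u], of us x y vs] by simp
  qed
qed

lemma alternating_mset_cases: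
  assumes "alternating f" "mset xs = mset ys"
  shows "f xs = f ys \<or> f xs = - f ys"
proof -
  have *: "f (us @ xs) = f (us @ ys) \<or> f (us @ xs) = - f (us @ ys)" if "mset xs = mset ys" for us xs ys
    using that
  proof (induction "length xs" arbitrary: us xs ys)
    case 0 then show ?case by simp
  next
    case (Suc n)
    obtain x xs' where xs: "xs = x # xs'" using Suc by (cases xs) auto
    obtain as bs where ys: "ys = as @ x # bs" using Suc.prems xs by (metis list.set_intros(1) mset_eq_setD split_list)
    have move: "f (us @ as @ x # bs) = f (us @ x # as @ bs) \<or> f (us @ as @ x # bs) = - f (us @ x # as @ bs)" for us
    proof (induction as arbitrary: us)
      case (Cons a as)
      have "f (us @ a # x # as @ bs) = - f (us @ x # a # as @ bs)" using alternatingD[OF assms(1), of us a x "as @ bs"] by simp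
      then show ?case using Cons[of "us @ [a]"] by auto
    qed simp
    have "mset xs' = mset (as @ bs)" using Suc.prems xs ys by simp
    then have "f ((us @ [x]) @ xs') = f ((us @ [x]) @ as @ bs) \<or> f ((us @ [x]) @ xs') = - f ((us @ [x]) @ as @ bs)"
      using Suc by (intro Suc.hyps) (auto simp: xs)
    then show ?case using move[of us] by (auto simp: xs ys)
  qed
  show ?thesis using *[OF assms(2), of "[]"] by simp
qed

lemma alternating_not_distinct:
  fixes f :: "'x list \<Rightarrow> int"
  assumes "alternating f" "\<not> distinct xs"
  shows "f xs = 0"
proof -
  obtain as x bs cs where xs: "xs = as @ [x] @ bs @ [x] @ cs" using assms(2) not_distinct_decomp by blast
  have "f (as @ x # x # bs @ cs) = 0" using alternatingD[OF assms(1), of as x x "bs @ cs"] by simp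
  then show ?thesis using alternating_mset_cases[OF assms(1), of xs "as @ x # x # bs @ cs"] xs by auto
qed

text \<open>On a permutation module the sum over one period must vanish because a multiple of it does and \<open>\<int>\<close>
  is torsion-free; this makes the partial sums below independent of the way around the orbit.\<close>

lemma coboundary_of_cyclic_sum_zero:
  fixes f :: "'x \<Rightarrow> int"
  assumes P: "0 < P" "\<And>x. (r ^^ P) x = x" and z: "\<And>x. (\<Sum>k<P. f ((r ^^ k) x)) = 0"
  obtains g where "\<And>x. f x = g (r x) - g x"
proof -
  define orbit where "orbit x = {(r ^^ k) x | k. True}" for x
  \<comment> \<open>A base point shared by the whole orbit, since \<open>SOME\<close> sees only the
    orbit.\<close>
  define b where "b x = (SOME y. y \<in> orbit x)" for x
  define steps where "steps x = (LEAST k. (r ^^ k) (b x) = x)" for x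
  have r_inj: "x = y" if "r x = r y" for x y
    using P that by (metis Suc_pred' funpow_Suc_right o_apply)
  have orbit_r: "orbit (r x) = orbit x" for x
  proof -
    have "(r ^^ k) x = (r ^^ (k + (P - 1))) (r x)" for k
    proof -
      have "(r ^^ (k + (P - 1))) (r x) = (r ^^ (k + P)) x"
        using P(1) by (metis Nat.add_diff_assoc Suc_leI add.assoc add_Suc_right diff_Suc_1 funpow_Suc_right o_apply One_nat_def Suc_pred')
      then show ?thesis using P(2) by (simp add: funpow_add)
    qed
    moreover have "(r ^^ k) (r x) = (r ^^ Suc k) x" for k by (simp add: funpow_swap1)
    ultimately show ?thesis unfolding orbit_def by blast
  qed
  have b_r: "b (r x) = b x" for x by (simp add: b_def orbit_r)
  have ex: "\<exists>k. (r ^^ k) (b x) = x" for x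
  proof -
    have "x \<in> orbit x" by (auto simp: orbit_def intro: exI[of _ 0])
    then have "b x \<in> orbit x" unfolding b_def by (rule someI)
    then obtain k where k: "b x = (r ^^ k) x" by (auto simp: orbit_def)
    have PP: "(r ^^ (P * i)) y = y" for i y
      by (induction i) (auto simp: P funpow_add)
    have "(r ^^ (P * k - k)) (b x) = x"
      using PP[of k x] P(1) unfolding k by (simp flip: funpow_add o_apply[of "r ^^ _"])
    then show ?thesis by blast
  qed
  have steps: "(r ^^ steps x) (b x) = x" for x unfolding steps_def by (rule LeastI_ex[OF ex])
  have least: "steps x \<le> k" if "(r ^^ k) (b x) = x" for x k unfolding steps_def using that by (rule Least_le)
  \<comment> \<open>The sum of f along the path from the base point to x. Only the step that closes
    the cycle calls on the hypothesis.\<close>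
  define g where "g x = (\<Sum>l<steps x. f ((r ^^ l) (b x)))" for x
  have "f x = g (r x) - g x" for x
  proof -
    have s: "(r ^^ Suc (steps x)) (b x) = r x" using steps[of x] by simp
    show ?thesis
    proof (cases "steps (r x) = Suc (steps x)")
      case True
      then show ?thesis using steps[of x] by (simp add: g_def b_r)
    next
      case False
      have "steps (r x) \<le> Suc (steps x)" using least[of "Suc (steps x)" "r x"] s by (simp add: b_r)
      with False have lt: "steps (r x) < Suc (steps x)" by simp
      have "steps (r x) = 0"
      proof (rule ccontr)
        assume "steps (r x) \<noteq> 0"
        then obtain n where n: "steps (r x) = Suc n" using not0_implies_Suc by blast
        then have "r ((r ^^ n) (b x)) = r x" using steps[of "r x"] by (simp add: b_r)
        then have "(r ^^ n) (b x) = x" by (rule r_inj)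
        then show False using least[of n x] n lt by simp
      qed
      then have rx: "r x = b x" using steps[of "r x"] by (simp add: b_r)
      define d where "d = Suc (steps x)"
      have d: "(r ^^ d) (b x) = b x" using s rx by (simp add: d_def)
      \<comment> \<open>One full turn from the k-th point, with \<open>d\<close> steps closing the
        cycle. It does not depend on k, and P copies of it regroup into d of the sums known to
        vanish.\<close>
      define A where "A k = (\<Sum>l<d. f ((r ^^ (k + l)) (b x)))" for k
      have "A (Suc k) = A k" for k
      proof -
        have "A (Suc k) + f ((r ^^ k) (b x)) = (\<Sum>l<Suc d. f ((r ^^ (k + l)) (b x)))"
          unfolding A_def sum.lessThan_Suc_shift by simp
        also have "\<dots> = A k + f ((r ^^ k) (b x))" using d by (simp add: A_def funpow_add)
        finally show ?thesis by simp
      qed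
      then have A: "A k = A 0" for k by (induction k) auto
      have "of_nat P * A 0 = (\<Sum>k<P. A 0)" by simp
      also have "\<dots> = (\<Sum>k<P. A k)" by (intro sum.cong refl A[symmetric])
      also have "\<dots> = (\<Sum>l<d. \<Sum>k<P. f ((r ^^ k) ((r ^^ l) (b x))))"
        unfolding A_def by (subst sum.swap) (simp add: funpow_add)
      also have "\<dots> = 0" by (simp add: z)
      finally have "A 0 = 0" using P(1) by simp
      then have "g x + f x = 0" using steps[of x] by (simp add: A_def d_def g_def)
      moreover have "g (r x) = 0" using \<open>steps (r x) = 0\<close> by (simp add: g_def)
      ultimately show ?thesis by simp
    qed
  qed
  then show ?thesis by (rule that)
qed

text \<open>The value \<open>\<phi> \<alpha> xs\<close> is the coefficient of \<open>\<Prod>\<^sub>c\<^sub>\<in>\<^sub>\<alpha> v\<^sub>c \<otimes> xs\<^sub>1 \<and> \<dots> \<and> xs\<^sub>l\<close>, and the differential replaces one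
  \<open>v\<^sub>c\<close> by the exterior product with the sum of the basis elements in the orbit \<open>c\<close>. The multiset
  \<open>\<alpha> + image_mset orb (mset xs)\<close> is the multidegree, which the differential preserves.\<close>

definition koszul_d :: "('x \<Rightarrow> 'o) \<Rightarrow> ('o multiset \<Rightarrow> 'x list \<Rightarrow> int) \<Rightarrow> 'o multiset \<Rightarrow> 'x list \<Rightarrow> int" where
  "koszul_d orb \<phi> = (\<lambda>\<alpha>. del_sum (\<lambda>x. \<phi> (add_mset (orb x) \<alpha>)))"

definition koszul :: "('x \<Rightarrow> 'o) \<Rightarrow> 'o multiset set \<Rightarrow> nat \<Rightarrow> ('o multiset \<Rightarrow> 'x list \<Rightarrow> int) set" where
  "koszul orb Good a = {\<phi>. (\<forall>\<alpha>. alternating (\<phi> \<alpha>)) \<and>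
     (\<forall>\<alpha> xs. \<phi> \<alpha> xs \<noteq> 0 \<longrightarrow> size \<alpha> = a \<and> \<alpha> + image_mset orb (mset xs) \<in> Good)}"

lemma koszulI:
  assumes "\<And>\<alpha>. alternating (\<phi> \<alpha>)"
    "\<And>\<alpha> xs. \<phi> \<alpha> xs \<noteq> 0 \<Longrightarrow> size \<alpha> = a \<and> \<alpha> + image_mset orb (mset xs) \<in> Good"
  shows "\<phi> \<in> koszul orb Good a"
  using assms by (simp add: koszul_def)

lemma koszulD:
  assumes "\<phi> \<in> koszul orb Good a"
  shows "alternating (\<phi> \<alpha>)" "\<phi> \<alpha> xs \<noteq> 0 \<Longrightarrow> size \<alpha> = a"
    "\<phi> \<alpha> xs \<noteq> 0 \<Longrightarrow> \<alpha> + image_mset orb (mset xs) \<in> Good"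
  using assms by (auto simp: koszul_def)

lemma alternating_zero [simp]: "alternating (\<lambda>xs. 0)"
  by (simp add: alternating_def)

lemma alternating_diff:
  assumes "alternating f" "alternating g" shows "alternating (\<lambda>xs. f xs - g xs)"
  unfolding alternating_def
proof (intro allI)
  fix us x y vs
  show "f (us @ x # y # vs) - g (us @ x # y # vs) = - (f (us @ y # x # vs) - g (us @ y # x # vs))"
    using alternatingD[OF assms(1), of us x y vs] alternatingD[OF assms(2), of us x y vs] by simp
qed

lemma alternating_map:
  assumes "alternating f" shows "alternating (\<lambda>xs. f (map h xs))"
  unfolding alternating_def
proof (intro allI)
  show "f (map h (us @ x # y # vs)) = - f (map h (us @ y # x # vs))" for us x y vs
    using alternatingD[OF assms, of "map h us" "h x" "h y" "map h vs"] by simp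
qed

lemma add_closed_koszul: "add_closed (koszul orb Good a)"
proof -
  have "\<phi> - \<psi> \<in> koszul orb Good a" if "\<phi> \<in> koszul orb Good a" "\<psi> \<in> koszul orb Good a" for \<phi> \<psi>
  proof (rule koszulI)
    have "(\<phi> - \<psi>) \<alpha> = (\<lambda>xs. \<phi> \<alpha> xs - \<psi> \<alpha> xs)" for \<alpha> by (rule ext) simp
    then show "alternating ((\<phi> - \<psi>) \<alpha>)" for \<alpha>
      by (simp add: alternating_diff[OF koszulD(1)[OF that(1)] koszulD(1)[OF that(2)]])
    show "size \<alpha> = a \<and> \<alpha> + image_mset orb (mset xs) \<in> Good" if "(\<phi> - \<psi>) \<alpha> xs \<noteq> 0" for \<alpha> xs
      using that koszulD(2,3)[OF \<open>\<phi> \<in> _\<close>, of \<alpha> xs] koszulD(2,3)[OF \<open>\<psi> \<in> _\<close>, of \<alpha> xs]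
      by (cases "\<phi> \<alpha> xs = 0") auto
  qed
  moreover have "0 \<in> koszul orb Good a" by (rule koszulI) (auto simp: zero_fun_def)
  ultimately show ?thesis by (simp add: add_closed_def)
qed

lemma additive_koszul_d: "additive (koszul_d orb)"
  unfolding additive_def
proof (intro allI ext)
  fix \<phi> \<psi> \<alpha> and xs
  show "koszul_d orb (\<phi> + \<psi>) \<alpha> xs = (koszul_d orb \<phi> + koszul_d orb \<psi>) \<alpha> xs"
    using del_sum_add[of "\<lambda>x. \<phi> (add_mset (orb x) \<alpha>)" "\<lambda>x. \<psi> (add_mset (orb x) \<alpha>)" xs]
    by (simp add: koszul_d_def plus_fun_def)
qed

lemma koszul_d_closed:
  assumes "\<phi> \<in> koszul orb Good (Suc a)" shows "koszul_d orb \<phi> \<in> koszul orb Good a"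
proof (rule koszulI)
  show "alternating (koszul_d orb \<phi> \<alpha>)" for \<alpha>
    unfolding koszul_d_def by (intro alternating_del_sum koszulD(1)[OF assms])
  fix \<alpha> xs assume "koszul_d orb \<phi> \<alpha> xs \<noteq> 0"
  then obtain us x vs where "xs = us @ x # vs" "\<phi> (add_mset (orb x) \<alpha>) (us @ vs) \<noteq> 0"
    unfolding koszul_d_def by (rule del_sum_nonzero)
  then show "size \<alpha> = a \<and> \<alpha> + image_mset orb (mset xs) \<in> Good"
    using koszulD(2,3)[OF assms, of "add_mset (orb x) \<alpha>" "us @ vs"] by auto
qed

lemma koszul_d_d: "koszul_d orb (koszul_d orb \<phi>) = 0"
proof (intro ext)
  fix \<alpha> xs
  have "koszul_d orb (koszul_d orb \<phi>) \<alpha> xs = - koszul_d orb (koszul_d orb \<phi>) \<alpha> xs"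
    using del_sum_del_sum[of "\<lambda>x y. \<phi> (add_mset (orb y) (add_mset (orb x) \<alpha>))" xs]
    by (simp add: koszul_d_def add_mset_commute)
  then show "koszul_d orb (koszul_d orb \<phi>) \<alpha> xs = 0 \<alpha> xs" by simp
qed

text \<open>Contracting the complex of one orbit \<open>c\<close> by its section shows that a cocycle is cohomologous
  to one without \<open>c\<close> in the symmetric part; doing this for all orbits in turn kills it.\<close>

lemma koszul_exact:
  assumes orbs: "finite Orbs" "\<And>e. e \<in> Good \<Longrightarrow> set_mset e \<subseteq> Orbs" and sec: "\<And>c. c \<in> Orbs \<Longrightarrow> orb (sec c) = c"
    and \<phi>: "\<phi> \<in> koszul orb Good (Suc a)" "koszul_d orb \<phi> = 0"
  shows "\<phi> \<in> koszul_d orb ` koszul orb Good (Suc (Suc a))"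
proof -
  let ?K = "koszul orb Good" and ?d = "koszul_d orb"
  \<comment> \<open>Invariant of the elimination: up to a boundary, \<phi> vanishes on every
    \<alpha> that meets the orbits treated so far.\<close>
  have "\<exists>\<eta> \<in> ?K (Suc (Suc a)). \<forall>\<alpha>. set_mset \<alpha> \<inter> U \<noteq> {} \<longrightarrow> (\<phi> - ?d \<eta>) \<alpha> = 0"
    if "finite U" "U \<subseteq> Orbs" for U
    using that
  proof (induction U)
    case empty
    show ?case using add_closed_zero[OF add_closed_koszul] by auto
  next
    case (insert c U)
    then obtain \<eta> where \<eta>: "\<eta> \<in> ?K (Suc (Suc a))" "\<And>\<alpha>. set_mset \<alpha> \<inter> U \<noteq> {} \<Longrightarrow> (\<phi> - ?d \<eta>) \<alpha> = 0"
      by blast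
    define \<psi> where "\<psi> = \<phi> - ?d \<eta>"
    have \<psi>: "\<psi> \<in> ?K (Suc a)" unfolding \<psi>_def
      by (intro add_closed_diff[OF add_closed_koszul] \<phi> koszul_d_closed \<eta>)
    have d\<psi>: "?d \<psi> = 0"
      unfolding \<psi>_def by (simp add: additive.diff[OF additive_koszul_d] \<phi> koszul_d_d)
    \<comment> \<open>Contraction for the orbit c: it turns a basis element \<open>sec c\<close> of
      the wedge part into a factor c of the symmetric part. No division by a multiplicity occurs, so
      this works over the integers.\<close>
    define h where "h = (\<lambda>\<alpha> xs. if c \<in># \<alpha> then \<psi> (\<alpha> - {#c#}) (sec c # xs) else 0)"
    have c: "orb (sec c) = c" using insert sec by auto
    have h: "h \<in> ?K (Suc (Suc a))"
    proof (rule koszulI)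
      show "alternating (h \<alpha>)" for \<alpha>
        using alternating_Cons[OF koszulD(1)[OF \<psi>]] by (cases "c \<in># \<alpha>") (auto simp: h_def)
      fix \<alpha> xs assume "h \<alpha> xs \<noteq> 0"
      then obtain \<beta> where \<beta>: "\<alpha> = add_mset c \<beta>" "\<psi> \<beta> (sec c # xs) \<noteq> 0"
        by (auto simp: h_def split: if_splits dest: multi_member_split)
      then show "size \<alpha> = Suc (Suc a) \<and> \<alpha> + image_mset orb (mset xs) \<in> Good"
        using koszulD(2,3)[OF \<psi> \<beta>(2)] c by simp
    qed
    \<comment> \<open>Expanding the cocycle condition at a list headed by \<open>sec c\<close>
      leaves \<psi> minus the differential of h.\<close>
    have 1: "?d h (add_mset c \<beta>) xs = \<psi> (add_mset c \<beta>) xs" for \<beta> xs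
    proof -
      have "?d \<psi> \<beta> (sec c # xs) = 0" by (simp add: d\<psi>)
      moreover have "?d h (add_mset c \<beta>) xs = del_sum (\<lambda>x ys. \<psi> (add_mset (orb x) \<beta>) (sec c # ys)) xs"
        by (simp add: koszul_d_def h_def)
      ultimately show ?thesis by (simp add: koszul_d_def c)
    qed
    \<comment> \<open>Away from c, the correction does not disturb the vanishing already achieved
      for U.\<close>
    have 2: "?d h \<alpha> xs = 0" if "c \<notin># \<alpha>" "\<psi> \<alpha> = 0" for \<alpha> xs
    proof -
      have "h (add_mset (orb x) \<alpha>) = (\<lambda>ys. 0)" for x using that by (auto simp: h_def)
      then show ?thesis by (simp add: koszul_d_def)
    qed
    have "(\<phi> - ?d (\<eta> + h)) \<alpha> = 0" if "set_mset \<alpha> \<inter> insert c U \<noteq> {}" for \<alpha>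
    proof
      fix xs
      have "(\<phi> - ?d (\<eta> + h)) \<alpha> xs = \<psi> \<alpha> xs - ?d h \<alpha> xs"
        by (simp add: \<psi>_def additive.add[OF additive_koszul_d])
      also have "\<dots> = 0"
      proof (cases "c \<in># \<alpha>")
        case True
        then show ?thesis using 1 by (metis cancel_comm_monoid_add_class.diff_cancel multi_member_split)
      next
        case False
        then have "\<psi> \<alpha> = 0" using that \<eta>(2)[of \<alpha>] by (simp add: \<psi>_def)
        then show ?thesis using 2 False by simp
      qed
      finally show "(\<phi> - ?d (\<eta> + h)) \<alpha> xs = 0 xs" by simp
    qed
    moreover have "\<eta> + h \<in> ?K (Suc (Suc a))" by (intro add_closed_add[OF add_closed_koszul] h \<eta>)
    ultimately show ?case by blast
  qed
  then obtain \<eta> where \<eta>: "\<eta> \<in> ?K (Suc (Suc a))" "\<And>\<alpha>. set_mset \<alpha> \<inter> Orbs \<noteq> {} \<Longrightarrow> (\<phi> - ?d \<eta>) \<alpha> = 0"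
    using orbs(1) by blast
  have K: "\<phi> - ?d \<eta> \<in> ?K (Suc a)" by (intro add_closed_diff[OF add_closed_koszul] \<phi> koszul_d_closed \<eta>)
  have "\<phi> - ?d \<eta> = 0"
  proof (intro ext)
    fix \<alpha> xs
    show "(\<phi> - ?d \<eta>) \<alpha> xs = 0 \<alpha> xs"
    proof (rule ccontr)
      assume nz: "(\<phi> - ?d \<eta>) \<alpha> xs \<noteq> 0 \<alpha> xs"
      then have nz': "(\<phi> - ?d \<eta>) \<alpha> xs \<noteq> 0" by simp
      have "set_mset \<alpha> \<subseteq> Orbs" "size \<alpha> = Suc a" using koszulD(2,3)[OF K nz'] orbs(2) by fastforce+
      then have "set_mset \<alpha> \<inter> Orbs \<noteq> {}" by (auto simp: Int_absorb2)
      then show False using \<eta>(2)[of \<alpha>] nz' by simp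
    qed
  qed
  then show ?thesis using \<eta>(1) by auto
qed

text \<open>\<open>moved\<close> is what the truncation buys: in a good multidegree no nonempty set
  of basis elements is stable under a nontrivial power of r. The periods hold at every point, so r
  and r' are permutations of whole types.\<close>

locale koszul_action =
  fixes orb :: "'x \<Rightarrow> 'o" and r :: "'x \<Rightarrow> 'x" and r' :: "'o \<Rightarrow> 'o" and Good :: "'o multiset set"
    and Orbs :: "'o set" and sec :: "'o \<Rightarrow> 'x" and P j :: nat
  assumes finite_Orbs: "finite Orbs" and Good_Orbs: "e \<in> Good \<Longrightarrow> set_mset e \<subseteq> Orbs"
    and Good_size: "e \<in> Good \<Longrightarrow> size e = j"
    and orb_sec: "c \<in> Orbs \<Longrightarrow> orb (sec c) = c"
    and P_pos: "0 < P" and r_period: "(r ^^ P) x = x" and r'_period: "(r' ^^ P) c = c"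
    and orb_r: "orb (r x) = r' (orb x)"
    and Good_r': "image_mset r' e \<in> Good \<longleftrightarrow> e \<in> Good"
    and moved: "distinct xs \<Longrightarrow> xs \<noteq> [] \<Longrightarrow> \<alpha> + image_mset orb (mset xs) \<in> Good \<Longrightarrow> 0 < k \<Longrightarrow> k < P \<Longrightarrow>
       (r ^^ k) ` set xs \<noteq> set xs"
begin

abbreviation K where "K \<equiv> koszul orb Good"

abbreviation d where "d \<equiv> koszul_d orb"

text \<open>Substitution in coefficient functions acts as the inverse of r on monomials, so an
  operator that moves basis elements forward is modelled by an r that moves them backward.\<close>

definition shift :: "('o multiset \<Rightarrow> 'x list \<Rightarrow> int) \<Rightarrow> 'o multiset \<Rightarrow> 'x list \<Rightarrow> int" where
  "shift \<phi> = (\<lambda>\<alpha> xs. \<phi> (image_mset r' \<alpha>) (map r xs))"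

lemma additive_shift: "additive shift"
  by (auto simp: additive_def shift_def fun_eq_iff)

lemma funpow_shift: "(shift ^^ k) \<phi> \<alpha> xs = \<phi> (image_mset (r' ^^ k) \<alpha>) (map (r ^^ k) xs)"
proof (induction k arbitrary: \<alpha> xs)
  case 0 then show ?case by (simp add: multiset.map_id[unfolded id_def])
next
  case (Suc k)
  have "(shift ^^ Suc k) \<phi> \<alpha> xs = (shift ^^ k) \<phi> (image_mset r' \<alpha>) (map r xs)"
    by (simp add: shift_def)
  then show ?case unfolding Suc by (simp add: multiset.map_comp o_def funpow_swap1)
qed

lemma shift_period: "(shift ^^ P) \<phi> = \<phi>"
proof (intro ext)
  have "r ^^ P = (\<lambda>x. x)" "r' ^^ P = (\<lambda>x. x)" by (auto simp: r_period r'_period)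
  then show "(shift ^^ P) \<phi> \<alpha> xs = \<phi> \<alpha> xs" for \<alpha> xs by (simp add: funpow_shift)
qed

lemma orb_r_mset: "image_mset orb (mset (map r xs)) = image_mset r' (image_mset orb (mset xs))"
  by (induction xs) (auto simp: orb_r)

lemma shift_closed: "\<phi> \<in> K a \<Longrightarrow> shift \<phi> \<in> K a"
proof (rule koszulI)
  assume \<phi>: "\<phi> \<in> K a"
  show "alternating (shift \<phi> \<alpha>)" for \<alpha>
    unfolding shift_def by (rule alternating_map[OF koszulD(1)[OF \<phi>]])
  fix \<alpha> xs assume "shift \<phi> \<alpha> xs \<noteq> 0"
  then have nz: "\<phi> (image_mset r' \<alpha>) (map r xs) \<noteq> 0" by (simp add: shift_def)
  have "image_mset r' (\<alpha> + image_mset orb (mset xs)) \<in> Good"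
    using koszulD(3)[OF \<phi> nz] unfolding orb_r_mset by simp
  then have "\<alpha> + image_mset orb (mset xs) \<in> Good" by (simp only: Good_r')
  then show "size \<alpha> = a \<and> \<alpha> + image_mset orb (mset xs) \<in> Good"
    using koszulD(2)[OF \<phi> nz] by simp
qed

lemma d_shift: "d (shift \<phi>) = shift (d \<phi>)"
  by (intro ext) (simp add: koszul_d_def shift_def del_sum_map orb_r)

lemma submodule_pair_zero: "submodule_pair (K a) {0} shift"
  using add_closed_koszul[of orb Good a] additive_shift
  by (auto simp: submodule_pair_def shift_closed add_closed_zero additive.zero)

definition bdry where "bdry a = d ` K (Suc a)"

lemma submodule_pair_bdry: "submodule_pair (K a) (bdry a) shift"
  using add_closed_koszul[of orb Good a] additive_shift
    add_closed_image[OF additive_koszul_d[of orb] add_closed_koszul[of orb Good "Suc a"]]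
  by (auto simp: submodule_pair_def shift_closed koszul_d_closed bdry_def simp flip: d_shift)

text \<open>Depends only on the cycle of B, because the predicate under \<open>SOME\<close> is the
  same for all rotations of B. These representatives exhibit the terms of the complex as
  induced.\<close>

definition leader :: "'x set \<Rightarrow> 'x set" where
  "leader B = (SOME B'. \<exists>k<P. B' = (r ^^ k) ` B)"

lemma leader: "\<exists>k<P. leader B = (r ^^ k) ` B"
  unfolding leader_def by (rule someI_ex) (use P_pos in blast)

lemma r_period_image: "(r ^^ P) ` B = B"
  by (auto simp: r_period image_iff)

lemma r_funpow_mod_image: "(r ^^ (k mod P)) ` B = (r ^^ k) ` B"
proof -
  have "(r ^^ (P * i)) x = x" for i x by (induction i) (auto simp: funpow_add r_period)
  then have "(r ^^ k) x = (r ^^ (k mod P)) x" for x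
    using funpow_add[of "k mod P" "P * (k div P)" r] by simp
  then show ?thesis by simp
qed

lemma leader_image: "leader ((r ^^ l) ` B) = leader B"
proof -
  have "(\<exists>k<P. B' = (r ^^ k) ` (r ^^ l) ` B) \<longleftrightarrow> (\<exists>k<P. B' = (r ^^ k) ` B)" for B'
  proof
    assume "\<exists>k<P. B' = (r ^^ k) ` (r ^^ l) ` B"
    then obtain k where "B' = (r ^^ (k + l)) ` B" by (auto simp: funpow_add image_comp)
    then have "B' = (r ^^ ((k + l) mod P)) ` B" by (simp add: r_funpow_mod_image)
    then show "\<exists>k<P. B' = (r ^^ k) ` B" using P_pos mod_less_divisor by blast
  next
    assume "\<exists>k<P. B' = (r ^^ k) ` B"
    then obtain k where k: "B' = (r ^^ k) ` B" by auto
    \<comment> \<open>The exponent P * l - l serves as -l.\<close>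
    have "(r ^^ ((k + (P * l - l)) mod P)) ` (r ^^ l) ` B = (r ^^ (k + (P * l - l))) ` (r ^^ l) ` B"
      by (rule r_funpow_mod_image)
    also have "\<dots> = (r ^^ (k + (P * l - l) + l)) ` B" by (simp add: funpow_add image_comp o_assoc)
    also have "k + (P * l - l) + l = k + P * l" using P_pos by (cases P) auto
    also have "(r ^^ (k + P * l)) ` B = B'"
      using r_funpow_mod_image[of "k + P * l" B] r_funpow_mod_image[of k B] k by simp
    finally show "\<exists>k<P. B' = (r ^^ k) ` (r ^^ l) ` B" using P_pos by (metis mod_less_divisor)
  qed
  then show ?thesis by (simp add: leader_def)
qed

text \<open>E keeps the monomials whose underlying set is the leader of its cycle. By
  \<open>moved\<close> exactly one rotation takes a given set to its leader, so exactly one summand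
  of the trace returns \<phi>; the bound a < j makes the wedge part nonempty. E looks only at sets
  and so preserves alternation.\<close>

lemma induced:
  assumes a: "a < j"
  shows tate0_K: "tate0 (K a) {0} shift P" and tate1_K: "tate1 (K a) {0} shift P"
proof -
  define E where "E \<phi> = (\<lambda>\<alpha> xs. if leader (set xs) = set xs then \<phi> \<alpha> xs else 0)"
    for \<phi> :: "'o multiset \<Rightarrow> 'x list \<Rightarrow> int"
  have E_add: "additive E" by (auto simp: additive_def E_def fun_eq_iff)
  have E_K: "E \<phi> \<in> K a" if \<phi>: "\<phi> \<in> K a" for \<phi>
  proof (rule koszulI)
    show "alternating (E \<phi> \<alpha>)" for \<alpha>
      unfolding alternating_def
    proof (intro allI)
      fix us vs and x y :: 'x
      have "set (us @ x # y # vs) = set (us @ y # x # vs)" by auto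
      then show "E \<phi> \<alpha> (us @ x # y # vs) = - E \<phi> \<alpha> (us @ y # x # vs)"
        using alternatingD[OF koszulD(1)[OF \<phi>], of \<alpha> us x y vs] by (simp add: E_def)
    qed
    show "size \<alpha> = a \<and> \<alpha> + image_mset orb (mset xs) \<in> Good" if "E \<phi> \<alpha> xs \<noteq> 0" for \<alpha> xs
      using that koszulD(2,3)[OF \<phi>, of \<alpha> xs] by (auto simp: E_def split: if_splits)
  qed
  have split: "(\<Sum>k<P. (shift ^^ k) (E ((shift ^^ (P - k)) \<phi>))) - \<phi> \<in> {0}" if \<phi>: "\<phi> \<in> K a" for \<phi>
  proof -
    have "(\<Sum>k<P. (shift ^^ k) (E ((shift ^^ (P - k)) \<phi>))) \<alpha> xs = \<phi> \<alpha> xs" for \<alpha> xs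
    proof -
      have term_eq: "(shift ^^ k) (E ((shift ^^ (P - k)) \<phi>)) \<alpha> xs
          = (if leader (set xs) = (r ^^ k) ` set xs then \<phi> \<alpha> xs else 0)" if "k < P" for k
      proof -
        have "(shift ^^ (P - k)) \<phi> (image_mset (r' ^^ k) \<alpha>) (map (r ^^ k) xs) = (shift ^^ (k + (P - k))) \<phi> \<alpha> xs"
          by (subst funpow_add) (simp add: funpow_shift[of k])
        also have "\<dots> = \<phi> \<alpha> xs" using that by (simp add: shift_period)
        finally show ?thesis by (simp add: funpow_shift[of k] E_def leader_image)
      qed
      have apply_sum: "(\<Sum>k<n. F k) \<alpha> xs = (\<Sum>k<n. F k \<alpha> xs)"
        for F :: "nat \<Rightarrow> 'o multiset \<Rightarrow> 'x list \<Rightarrow> int" and n :: nat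
        by (induction n) auto
      show ?thesis
      proof (cases "\<phi> \<alpha> xs = 0")
        case True
        then show ?thesis by (auto simp: apply_sum term_eq intro!: sum.neutral)
      next
        case False
        have dist: "distinct xs" using alternating_not_distinct[OF koszulD(1)[OF \<phi>]] False by blast
        have good: "\<alpha> + image_mset orb (mset xs) \<in> Good" "size \<alpha> = a" using koszulD(2,3)[OF \<phi> False] by auto
        then have "xs \<noteq> []" using a Good_size[OF good(1)] by auto
        then have mv: "(r ^^ k) ` set xs \<noteq> set xs" if "0 < k" "k < P" for k using moved dist good that by blast
        obtain k where k: "k < P" "leader (set xs) = (r ^^ k) ` set xs" using leader by blast
        have uniq: "l = k" if l: "l < P" "leader (set xs) = (r ^^ l) ` set xs" for l
        proof (rule ccontr)
          assume "l \<noteq> k"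
          have False if "k' < l'" "l' < P" "(r ^^ k') ` set xs = (r ^^ l') ` set xs" for k' l'
          proof -
            have "(r ^^ (P - k')) ` (r ^^ k') ` set xs = (r ^^ (P - k')) ` (r ^^ l') ` set xs" using that by simp
            then have "(r ^^ (P - k' + k')) ` set xs = (r ^^ (P - k' + l')) ` set xs"
              unfolding funpow_add by (simp add: image_comp)
            moreover have "(r ^^ (P - k' + l')) ` set xs = (r ^^ (l' - k')) ` set xs"
            proof -
              have "P - k' + l' = P + (l' - k')" using that by simp
              then have "(P - k' + l') mod P = (l' - k') mod P" by simp
              then show ?thesis
                using r_funpow_mod_image[of "P - k' + l'" "set xs"] r_funpow_mod_image[of "l' - k'" "set xs"] by simp
            qed
            ultimately have "set xs = (r ^^ (l' - k')) ` set xs" using that r_period_image by simp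
            moreover have "0 < l' - k'" "l' - k' < P" using that by auto
            ultimately show False using mv[of "l' - k'"] by simp
          qed
          then show False using k l \<open>l \<noteq> k\<close> by (metis linorder_neqE_nat)
        qed
        have "(\<Sum>k<P. (shift ^^ k) (E ((shift ^^ (P - k)) \<phi>))) \<alpha> xs
            = (\<Sum>l<P. if leader (set xs) = (r ^^ l) ` set xs then \<phi> \<alpha> xs else 0)"
          unfolding apply_sum by (intro sum.cong refl term_eq) simp
        also have "\<dots> = (\<Sum>l<P. if l = k then \<phi> \<alpha> xs else 0)"
          using uniq k by (intro sum.cong) auto
        finally show ?thesis using k by simp
      qed
    qed
    then show ?thesis by (simp add: fun_eq_iff)
  qed
  show "tate0 (K a) {0} shift P" "tate1 (K a) {0} shift P"
    using tate0_induced tate1_induced submodule_pair_zero E_add E_K split additive.zero[OF E_add] singletonD by blast+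
qed

text \<open>At a = j the wedge part is empty, so no signs occur and \<phi> is a function on the good
  multidegrees, which r' permutes.\<close>

lemma tate1_K_top: "tate1 (K j) {0} shift P"
  unfolding tate1_def
proof (intro ballI impI)
  fix \<phi> assume \<phi>: "\<phi> \<in> K j" "norm_op P shift \<phi> \<in> {0}"
  have supp: "xs = []" "\<alpha> \<in> Good" if "\<phi> \<alpha> xs \<noteq> 0" for \<alpha> xs
  proof -
    show "xs = []" using koszulD(2,3)[OF \<phi>(1) that] Good_size[of "\<alpha> + image_mset orb (mset xs)"] by simp
    then show "\<alpha> \<in> Good" using koszulD(3)[OF \<phi>(1) that] by simp
  qed
  have apply_sum: "(\<Sum>k<n. F k) \<alpha> xs = (\<Sum>k<n. F k \<alpha> xs)"
    for F :: "nat \<Rightarrow> 'o multiset \<Rightarrow> 'x list \<Rightarrow> int" and n :: nat and \<alpha> xs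
    by (induction n) auto
  have pow: "(image_mset r' ^^ k) \<alpha> = image_mset (r' ^^ k) \<alpha>" for k \<alpha>
    by (induction k) (auto simp: multiset.map_id[unfolded id_def] multiset.map_comp o_def)
  obtain g where g: "\<And>\<alpha>. \<phi> \<alpha> [] = g (image_mset r' \<alpha>) - g \<alpha>"
  proof (rule coboundary_of_cyclic_sum_zero[OF P_pos, of "image_mset r'" "\<lambda>\<alpha>. \<phi> \<alpha> []"])
    have "r' ^^ P = (\<lambda>x. x)" by (auto simp: r'_period)
    then show "(image_mset r' ^^ P) \<alpha> = \<alpha>" for \<alpha> by (simp add: pow)
    have "norm_op P shift \<phi> \<alpha> [] = 0" for \<alpha> using \<phi>(2) by simp
    then show "(\<Sum>k<P. \<phi> ((image_mset r' ^^ k) \<alpha>) []) = 0" for \<alpha>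
      by (simp add: norm_op_def apply_sum funpow_shift pow)
  qed blast
  \<comment> \<open>The function g lives on all multisets; it can be cut down to \<open>Good\<close>
    because \<open>Good\<close> is stable under r'.\<close>
  define \<psi> where "\<psi> = (\<lambda>\<alpha> xs :: 'x list. if \<alpha> \<in> Good \<and> xs = [] then g \<alpha> else 0)"
  have "\<psi> \<in> K j"
    by (rule koszulI) (auto simp: \<psi>_def alternating_def Good_size split: if_splits)
  moreover have "\<phi> - (shift \<psi> - \<psi>) = 0"
  proof (intro ext)
    show "(\<phi> - (shift \<psi> - \<psi>)) \<alpha> xs = 0 \<alpha> xs" for \<alpha> xs
      using g[of \<alpha>] supp[of \<alpha> xs] by (cases "\<phi> \<alpha> xs = 0") (auto simp: \<psi>_def shift_def Good_r')
  qed
  ultimately show "\<exists>\<psi>\<in>K j. \<phi> - (shift \<psi> - \<psi>) \<in> {0}" by auto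
qed

lemma K_above: "K (Suc j) = {0}"
proof -
  have "\<phi> \<alpha> xs = 0" if "\<phi> \<in> K (Suc j)" for \<phi> \<alpha> xs
    using koszulD(2,3)[OF that, of \<alpha> xs] Good_size[of "\<alpha> + image_mset orb (mset xs)"] by fastforce
  then show ?thesis using add_closed_zero[OF add_closed_koszul, of orb Good "Suc j"] by (auto simp: fun_eq_iff)
qed

text \<open>The parity is arranged so that at a = j only degree -1 is asked for, the degree settled
  by \<open>tate1_K_top\<close>; below the top both degrees are available.\<close>

lemma tate_quotient:
  assumes "a \<le> j" and "if even (j - a) then tate0 (bdry a) {0} shift P else tate1 (bdry a) {0} shift P"
  shows "if even (j - a) then tate1 (K a) (bdry a) shift P else tate0 (K a) (bdry a) shift P"
proof -
  have "tate1 (K a) {0} shift P" using tate1_K[of a] tate1_K_top assms by (cases "a = j") auto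
  then show ?thesis
    using assms tate0_K[of a] tate0_quotient[OF submodule_pair_bdry] tate1_quotient[OF submodule_pair_bdry]
    by (cases "a = j") (auto simp: shift_period)
qed

text \<open>Dimension shifting downwards from a = j, where there are no nonzero boundaries:
  exactness identifies \<open>bdry a\<close> with the quotient of \<open>K (Suc a)\<close> by its
  own boundaries.\<close>

lemma tate_bdry:
  assumes "a \<le> j"
  shows "if even (j - a) then tate0 (bdry a) {0} shift P else tate1 (bdry a) {0} shift P"
  using assms
proof (induction a rule: inc_induct)
  case base
  show ?case
    by (auto simp: bdry_def K_above tate0_def additive.zero[OF additive_koszul_d]
        additive.zero[OF additive_norm_op[OF additive_shift]])
next
  case (step a)
  have zero: "x \<in> bdry (Suc a)" if "x \<in> K (Suc a)" "d x = 0" for x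
    using koszul_exact[OF finite_Orbs Good_Orbs orb_sec that] by (simp add: bdry_def)
  have zero': "d x = 0" if "x \<in> bdry (Suc a)" for x
    using that koszul_d_d by (auto simp: bdry_def)
  have "j - a = Suc (j - Suc a)" using step.hyps by simp
  then have "even (j - a) \<longleftrightarrow> odd (j - Suc a)" by simp
  moreover note tate_quotient[of "Suc a"] step.IH step.hyps
  moreover have "tate0 (K (Suc a)) (bdry (Suc a)) shift P \<Longrightarrow> tate0 (bdry a) {0} shift P"
    "tate1 (K (Suc a)) (bdry (Suc a)) shift P \<Longrightarrow> tate1 (bdry a) {0} shift P"
    unfolding bdry_def[of a]
    using tate0_image[where d = d and T = shift and T' = shift and m = P, OF _ _ zero zero' submodule_pair_bdry]
      tate1_image[where d = d and T = shift and T' = shift and m = P, OF _ _ zero zero' submodule_pair_bdry]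
      additive_koszul_d d_shift by blast+
  ultimately show ?case by (simp split: if_splits)
qed

lemma tate0_homology: "odd j \<Longrightarrow> tate0 (K 0) (bdry 0) shift P"
  and tate1_homology: "even j \<Longrightarrow> tate1 (K 0) (bdry 0) shift P"
  using tate_quotient[of 0] tate_bdry[of 0] by auto

end

section \<open>Periodicity of the Tate cohomology of cyclic groups\<close>

text \<open>A double complex with the d's in one direction and T - 1 and the norm in alternation in
  the other, exact in both directions modulo Z. \<open>vanish\<close> is exactness of the complex of
  T-invariants, and two steps of a staircase move it by two degrees.\<close>

lemma double_complex_shift:
  fixes C Z :: "int \<Rightarrow> 'f::ab_group_add set" and d :: "int \<Rightarrow> 'f \<Rightarrow> 'f"
  assumes P: "\<And>i. submodule_pair (C i) (Z i) T" and d: "\<And>i. additive (d i)"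
    and dC: "\<And>i x. x \<in> C i \<Longrightarrow> d i x \<in> C (i + 1)" and dZ: "\<And>i x. x \<in> Z i \<Longrightarrow> d i x \<in> Z (i + 1)"
    and dT: "\<And>i x. d i (T x) = T (d i x)" and dd: "\<And>i x. d (i + 1) (d i x) = 0"
    and exact: "\<And>i x. x \<in> C i \<Longrightarrow> d i x \<in> Z (i + 1) \<Longrightarrow> \<exists>y\<in>C (i - 1). x - d (i - 1) y \<in> Z i"
    and t0: "\<And>i. tate0 (C i) (Z i) T m" and t1: "\<And>i. tate1 (C i) (Z i) T m"
    and period: "\<And>i x. x \<in> C i \<Longrightarrow> (T ^^ m) x - x \<in> Z i"
  defines "vanish \<equiv> \<lambda>i. \<forall>f\<in>C i. T f - f \<in> Z i \<longrightarrow> d i f \<in> Z (i + 1) \<longrightarrow>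
      (\<exists>h\<in>C (i - 1). T h - h \<in> Z (i - 1) \<and> f - d (i - 1) h \<in> Z i)"
  shows "vanish (i - 2) \<longleftrightarrow> vanish i"
proof -
  note CZ = submodule_pairD[OF P]
  note T = CZ(4)
  note N = additive_norm_op[OF T, of m]
  have NC: "norm_op m T x \<in> C k" if "x \<in> C k" for x k by (rule norm_op_closed[OF CZ(1,5) that])
  have NZ: "norm_op m T x \<in> Z k" if "x \<in> Z k" for x k by (rule norm_op_closed[OF CZ(2,6) that])
  have dN: "d k (norm_op m T x) = norm_op m T (d k x)" for k x
    by (rule norm_op_commute[where S = UNIV]) (auto simp: d dT)
  have Ndiff: "norm_op m T x - norm_op m T y \<in> Z k" if "x - y \<in> Z k" for x y k
    using NZ[OF that] by (simp add: additive.diff[OF N])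
  have ddiff: "d k x - d k y \<in> Z (k + 1)" if "x - y \<in> Z k" for x y k
    using dZ[OF that] by (simp add: additive.diff[OF d])
  have i: "i - 2 + 1 = i - 1" "i - 1 + 1 = i" "i - 2 - 1 = i - 3" "i - 1 - 1 = i - 2" "i - 3 + 1 = i - 2" by auto
  have dd': "d i (d (i - 1) x) = 0" "d (i - 1) (d (i - 2) x) = 0" "d (i - 2) (d (i - 3) x) = 0" for x
    using dd[of "i - 1" x] dd[of "i - 2" x] dd[of "i - 3" x] by (simp_all add: i)
  have in_Z: "a \<in> Z k" if "a = b + c - e" "b \<in> Z k" "c \<in> Z k" "e \<in> Z k" for a b c e k
    unfolding that(1) by (intro add_closed_add add_closed_diff CZ(2) that)
  note Z0 = add_closed_zero[OF CZ(2)]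
  show ?thesis
  proof
    assume v: "vanish (i - 2)"
    show "vanish i" unfolding vanish_def
    proof (intro ballI impI)
      fix f assume f: "f \<in> C i" "T f - f \<in> Z i" "d i f \<in> Z (i + 1)"
      \<comment> \<open>Modulo Z: f = d h, then T h - h = d v, and w = N v is an invariant cocycle
        two degrees lower. Writing w = d z with z = N z' makes N vanish on v - d z', so this is T y
        - y, and subtracting d y from h makes it invariant.\<close>
      obtain h where h: "h \<in> C (i - 1)" "f - d (i - 1) h \<in> Z i" using exact f by blast
      define u where "u = T h - h"
      have u: "u \<in> C (i - 1)" unfolding u_def using h by (intro add_closed_diff CZ)
      have du: "d (i - 1) u = T (d (i - 1) h) - d (i - 1) h" by (simp add: u_def additive.diff[OF d] dT)
      have "T f - T (d (i - 1) h) \<in> Z i" using CZ(6)[OF h(2)] by (simp add: additive.diff[OF T])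
      then have "d (i - 1) u \<in> Z i"
        by (rule_tac in_Z[of _ "T f - f" "f - d (i - 1) h"]) (auto simp: du f h)
      then obtain v where v': "v \<in> C (i - 2)" "u - d (i - 2) v \<in> Z (i - 1)" using exact[OF u] i by auto
      define w where "w = norm_op m T v"
      have w: "w \<in> C (i - 2)" "T w - w \<in> Z (i - 2)"
        unfolding w_def norm_op_telescope[OF T] by (auto intro: NC v' period)
      have "norm_op m T u \<in> Z (i - 1)"
        using period[OF h(1)] by (simp add: u_def norm_op_diff_fixed[OF T])
      then have "d (i - 2) w \<in> Z (i - 1)"
        using Ndiff[OF v'(2)] add_closed_diff[OF CZ(2)[of "i - 1"]] unfolding w_def dN by fastforce
      then obtain z where z: "z \<in> C (i - 3)" "T z - z \<in> Z (i - 3)" "w - d (i - 3) z \<in> Z (i - 2)"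
        using v w unfolding vanish_def i by blast
      obtain z' where z': "z' \<in> C (i - 3)" "z - norm_op m T z' \<in> Z (i - 3)" using t0 z unfolding tate0_def by blast
      have "norm_op m T (v - d (i - 3) z') = (w - d (i - 3) z) + (d (i - 3) z - d (i - 3) (norm_op m T z')) - 0"
        by (simp add: additive.diff[OF N] w_def dN)
      then have "norm_op m T (v - d (i - 3) z') \<in> Z (i - 2)"
        by (rule in_Z) (use ddiff[OF z'(2)] z Z0 i in auto)
      moreover have vz: "v - d (i - 3) z' \<in> C (i - 2)" using dC[OF z'(1)] v' i by (intro add_closed_diff CZ) auto
      ultimately obtain y where y: "y \<in> C (i - 2)" "v - d (i - 3) z' - (T y - y) \<in> Z (i - 2)"
        using t1 unfolding tate1_def by blast
      define h' where "h' = h - d (i - 2) y"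
      have "h' \<in> C (i - 1)" unfolding h'_def using dC[OF y(1)] h i by (intro add_closed_diff CZ) auto
      moreover have "T h' - h' \<in> Z (i - 1)"
      proof (rule in_Z)
        show "T h' - h' = (u - d (i - 2) v) + (d (i - 2) (v - d (i - 3) z') - d (i - 2) (T y - y)) - 0"
          by (simp add: h'_def u_def additive.diff[OF d] additive.diff[OF T] dT dd')
        show "d (i - 2) (v - d (i - 3) z') - d (i - 2) (T y - y) \<in> Z (i - 1)" using ddiff[OF y(2)] i by simp
      qed (use v' Z0 in auto)
      moreover have "f - d (i - 1) h' \<in> Z i" using h by (simp add: h'_def additive.diff[OF d] dd')
      ultimately show "\<exists>h\<in>C (i - 1). T h - h \<in> Z (i - 1) \<and> f - d (i - 1) h \<in> Z i" by blast
    qed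
  next
    assume v: "vanish i"
    show "vanish (i - 2)" unfolding vanish_def i
    proof (intro ballI impI)
      fix w assume w: "w \<in> C (i - 2)" "T w - w \<in> Z (i - 2)" "d (i - 2) w \<in> Z (i - 1)"
      \<comment> \<open>The staircase read upwards: w = N v, then d v = T h - h, and d h is an
        invariant cocycle two degrees higher.\<close>
      obtain v where v': "v \<in> C (i - 2)" "w - norm_op m T v \<in> Z (i - 2)" using t0 w unfolding tate0_def by blast
      have "norm_op m T (d (i - 2) v) = d (i - 2) w + 0 - (d (i - 2) w - d (i - 2) (norm_op m T v))" by (simp add: dN)
      then have "norm_op m T (d (i - 2) v) \<in> Z (i - 1)" by (rule in_Z) (use w ddiff[OF v'(2)] i Z0 in auto)
      moreover have dv: "d (i - 2) v \<in> C (i - 1)" using dC[OF v'(1)] i by simp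
      ultimately obtain h where h: "h \<in> C (i - 1)" "d (i - 2) v - (T h - h) \<in> Z (i - 1)"
        using t1 unfolding tate1_def by blast
      have dh: "d (i - 1) h \<in> C i" using dC[OF h(1)] i by simp
      have "T (d (i - 1) h) - d (i - 1) h = 0 + 0 - (d (i - 1) (d (i - 2) v) - d (i - 1) (T h - h))"
        by (simp add: dd' additive.diff[OF d] dT)
      then have "T (d (i - 1) h) - d (i - 1) h \<in> Z i" by (rule in_Z) (use ddiff[OF h(2)] i Z0 in auto)
      moreover have "d i (d (i - 1) h) \<in> Z (i + 1)" by (simp add: dd' Z0)
      ultimately obtain k where k: "k \<in> C (i - 1)" "T k - k \<in> Z (i - 1)" "d (i - 1) h - d (i - 1) k \<in> Z i"
        using v dh unfolding vanish_def by blast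
      have hk: "h - k \<in> C (i - 1)" using h k by (intro add_closed_diff CZ)
      then obtain y where y: "y \<in> C (i - 2)" "h - k - d (i - 2) y \<in> Z (i - 1)"
        using exact[OF hk] k(3) i by (auto simp: additive.diff[OF d])
      have Ty: "T (h - k) - T (d (i - 2) y) \<in> Z (i - 1)" using CZ(6)[OF y(2)] by (simp add: additive.diff[OF T])
      have "d (i - 2) (v - (T y - y)) = (d (i - 2) v - (T h - h)) + (T (h - k) - T (d (i - 2) y) + (T k - k)) - (h - k - d (i - 2) y)"
        by (simp add: additive.diff[OF d] additive.diff[OF T] additive.add[OF d] additive.add[OF T] dT algebra_simps)
      then have "d (i - 2) (v - (T y - y)) \<in> Z (i - 1)"
        by (rule in_Z) (use h k y Ty in \<open>auto intro: add_closed_add CZ\<close>)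
      moreover have "v - (T y - y) \<in> C (i - 2)" using v' y by (intro add_closed_diff CZ)
      ultimately obtain z where z: "z \<in> C (i - 3)" "v - (T y - y) - d (i - 3) z \<in> Z (i - 2)"
        using exact[of "v - (T y - y)" "i - 2"] i by auto
      have "w - d (i - 3) (norm_op m T z) = (w - norm_op m T v) + (norm_op m T (v - (T y - y)) - norm_op m T (d (i - 3) z)) - (y - (T ^^ m) y)"
        by (simp add: additive.diff[OF N] norm_op_diff_fixed[OF T] dN flip: additive.diff[OF N, of "T y" y])
      then have "w - d (i - 3) (norm_op m T z) \<in> Z (i - 2)"
        by (rule in_Z) (use v' Ndiff[OF z(2)] add_closed_diff_swap[OF CZ(2) period[OF y(1)]] in auto)
      moreover have "T (norm_op m T z) - norm_op m T z \<in> Z (i - 3)"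
        unfolding norm_op_telescope[OF T] by (rule period[OF z(1)])
      ultimately show "\<exists>h\<in>C (i - 3). T h - h \<in> Z (i - 3) \<and> w - d (i - 3) h \<in> Z (i - 2)"
        using NC[OF z(1)] by blast
    qed
  qed
qed

section \<open>The complete resolution with values lifted to a free abelian group\<close>

fun ins_sum :: "'g \<Rightarrow> ('g list \<Rightarrow> 'v::ab_group_add) \<Rightarrow> 'g list \<Rightarrow> 'v" where
  "ins_sum g f [] = f [g]"
| "ins_sum g f (x # xs) = f (g # x # xs) - ins_sum g (\<lambda>ys. f (x # ys)) xs"

lemma ins_sum_diff: "ins_sum g (\<lambda>xs. f xs - h xs) xs = ins_sum g f xs - ins_sum g h xs"
  by (induction xs arbitrary: f h) (auto simp: algebra_simps)

lemma ins_sum_add: "ins_sum g (\<lambda>xs. f xs + h xs) xs = ins_sum g f xs + ins_sum g h xs"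
  by (induction xs arbitrary: f h) (auto simp: algebra_simps)

lemma ins_sum_zero [simp]: "ins_sum g (\<lambda>xs. 0) xs = 0"
  by (induction xs) auto

lemma ins_sum_additive: "additive h \<Longrightarrow> ins_sum g (\<lambda>xs. h (f xs)) xs = h (ins_sum g f xs)"
  by (induction xs arbitrary: f) (auto simp: additive.diff)

lemma ins_sum_map: "ins_sum (h g) f (map h xs) = ins_sum g (\<lambda>ys. f (map h ys)) xs"
  by (induction xs arbitrary: f) auto

lemma ins_sum_closed:
  assumes "add_closed S" "\<And>us vs. xs = us @ vs \<Longrightarrow> f (us @ g # vs) \<in> S"
  shows "ins_sum g f xs \<in> S"
  using assms(2)
proof (induction xs arbitrary: f)
  case (Cons y xs)
  have "ins_sum g (\<lambda>ys. f (y # ys)) xs \<in> S"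
    using Cons.prems[of "y # _"] by (intro Cons.IH) auto
  then show ?case using Cons.prems[of "[]"] add_closed_diff[OF assms(1)] by simp
qed simp

text \<open>As for deletions, inserting two letters in the opposite order reverses the sign; summed
  over all pairs of group elements this gives d d = 0 in negative degrees.\<close>

lemma ins_sum_ins_sum: "ins_sum g (ins_sum h f) xs + ins_sum h (ins_sum g f) xs = 0"
proof (induction xs arbitrary: f)
  case (Cons x xs)
  have step: "ins_sum g (ins_sum h f) (x # xs) = f (h # g # x # xs) - f (g # h # x # xs)
      + ins_sum h (\<lambda>ys. f (g # x # ys)) xs - ins_sum g (\<lambda>ys. f (h # x # ys)) xs
      + ins_sum g (ins_sum h (\<lambda>ys. f (x # ys))) xs" for g h
    by (simp only: ins_sum.simps ins_sum_diff) (simp add: algebra_simps)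
  show ?case using Cons.IH[of "\<lambda>ys. f (x # ys)"] unfolding step[of g h] step[of h g] by (simp add: algebra_simps)
qed simp

context group_ring_module
begin

definition frags :: "('m \<Rightarrow>\<^sub>0 int) set" where
  "frags = {c. Poly_Mapping.keys c \<subseteq> carrier M}"

text \<open>The canonical surjection from the free abelian group on the set of elements. Its kernel
  is \<open>rels\<close>, so M is presented as \<open>frags\<close> modulo
  \<open>rels\<close>.\<close>

definition eval_frag :: "('m \<Rightarrow>\<^sub>0 int) \<Rightarrow> 'm" where
  "eval_frag = (SOME h. h \<in> hom (free_Abelian_group (carrier M)) M \<and> (\<forall>x\<in>carrier M. h (frag_of x) = x))"

lemma eval_frag:
  shows eval_frag_hom: "eval_frag \<in> hom (free_Abelian_group (carrier M)) M"
    and eval_frag_of [simp]: "x \<in> carrier M \<Longrightarrow> eval_frag (frag_of x) = x"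
proof -
  obtain h where "h \<in> hom (free_Abelian_group (carrier M)) M" "\<And>x. x \<in> carrier M \<Longrightarrow> h (frag_of x) = x"
    by (rule M.free_Abelian_group_universal[of "\<lambda>x. x" "carrier M"]) auto
  then have "\<exists>h. h \<in> hom (free_Abelian_group (carrier M)) M \<and> (\<forall>x\<in>carrier M. h (frag_of x) = x)" by blast
  then have "eval_frag \<in> hom (free_Abelian_group (carrier M)) M \<and> (\<forall>x\<in>carrier M. eval_frag (frag_of x) = x)"
    unfolding eval_frag_def by (rule someI_ex)
  then show "eval_frag \<in> hom (free_Abelian_group (carrier M)) M"
    "x \<in> carrier M \<Longrightarrow> eval_frag (frag_of x) = x" by auto
qed

lemma frag_of_frags [simp]: "frag_of x \<in> frags \<longleftrightarrow> x \<in> carrier M"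
  by (auto simp: frags_def)

lemma add_closed_frags: "add_closed frags"
  unfolding add_closed_def frags_def using keys_diff by fastforce

lemma eval_frag_closed [simp]: "c \<in> frags \<Longrightarrow> eval_frag c \<in> carrier M"
  using eval_frag_hom by (auto simp: hom_def frags_def)

lemma eval_frag_add: "c \<in> frags \<Longrightarrow> c' \<in> frags \<Longrightarrow> eval_frag (c + c') = eval_frag c \<otimes>\<^bsub>M\<^esub> eval_frag c'"
  using hom_mult[OF eval_frag_hom] by (simp add: frags_def)

lemma eval_frag_zero [simp]: "eval_frag 0 = \<one>\<^bsub>M\<^esub>"
  using hom_one[OF eval_frag_hom] M.is_group by simp

lemma eval_frag_minus: "c \<in> frags \<Longrightarrow> eval_frag (- c) = inv\<^bsub>M\<^esub> (eval_frag c)"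
  using group_hom.hom_inv[of "free_Abelian_group (carrier M)" M eval_frag c] eval_frag_hom M.is_group
  by (simp add: frags_def group_hom_def group_hom_axioms_def)

lemma eval_frag_diff: "c \<in> frags \<Longrightarrow> c' \<in> frags \<Longrightarrow> eval_frag (c - c') = eval_frag c \<otimes>\<^bsub>M\<^esub> inv\<^bsub>M\<^esub> (eval_frag c')"
  using eval_frag_add[of c "- c'"] add_closed_minus[OF add_closed_frags, of c'] by (simp add: eval_frag_minus)

lemma eval_frag_eq_iff: "c \<in> frags \<Longrightarrow> c' \<in> frags \<Longrightarrow> eval_frag c = eval_frag c' \<longleftrightarrow> eval_frag (c - c') = \<one>\<^bsub>M\<^esub>"
  by (simp add: eval_frag_diff M.inv_solve_right')

lemma eval_frag_sum:
  assumes "\<And>i. i \<in> I \<Longrightarrow> c i \<in> frags"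
  shows "eval_frag (\<Sum>i\<in>I. c i) = (\<Otimes>\<^bsub>M\<^esub>i\<in>I. eval_frag (c i))"
  using assms
  by (induction I rule: infinite_finite_induct)
    (auto simp: eval_frag_add add_closed_sum[OF add_closed_frags] M.finprod_insert Pi_def)

lemma frag_cmul_frags: "c \<in> frags \<Longrightarrow> frag_cmul k c \<in> frags"
  using keys_cmul[of k c] by (auto simp: frags_def)

lemma eval_frag_cmul:
  assumes "c \<in> frags" shows "eval_frag (frag_cmul k c) = eval_frag c [^]\<^bsub>M\<^esub> k"
proof -
  have "eval_frag (c [^]\<^bsub>free_Abelian_group (carrier M)\<^esub> k) = eval_frag c [^]\<^bsub>M\<^esub> k"
    by (rule hom_int_pow[OF eval_frag_hom]) (use assms M.is_group in \<open>auto simp: frags_def\<close>)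
  then show ?thesis using assms by (simp add: frags_def)
qed

definition rels :: "('m \<Rightarrow>\<^sub>0 int) set" where
  "rels = {c \<in> frags. eval_frag c = \<one>\<^bsub>M\<^esub>}"

lemma rels_frags: "rels \<subseteq> frags"
  by (auto simp: rels_def)

lemma add_closed_rels: "add_closed rels"
  using add_closed_frags by (auto simp: add_closed_def rels_def eval_frag_diff)

lemma diff_rels_iff: "c \<in> frags \<Longrightarrow> c' \<in> frags \<Longrightarrow> c - c' \<in> rels \<longleftrightarrow> eval_frag c = eval_frag c'"
  by (simp add: rels_def eval_frag_eq_iff add_closed_diff[OF add_closed_frags])

definition lact :: "'g \<Rightarrow> ('m \<Rightarrow>\<^sub>0 int) \<Rightarrow> ('m \<Rightarrow>\<^sub>0 int)" where
  "lact g = frag_extend (frag_of \<circ> act g)"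

lemma additive_lact: "additive (lact g)"
  by (simp add: additive_def lact_def frag_extend_add)

lemma lact_frags: "g \<in> carrier G \<Longrightarrow> c \<in> frags \<Longrightarrow> lact g c \<in> frags"
  using keys_frag_extend[of "frag_of \<circ> act g" c] unfolding frags_def lact_def by fastforce

lemma eval_lact: "g \<in> carrier G \<Longrightarrow> c \<in> frags \<Longrightarrow> eval_frag (lact g c) = act g (eval_frag c)"
proof -
  assume g: "g \<in> carrier G" and "c \<in> frags"
  then have "Poly_Mapping.keys c \<subseteq> carrier M" by (simp add: frags_def)
  have act_hom: "group_hom M M (act g)"
    using g act_closed act_mult by unfold_locales (auto simp: hom_def)
  show ?thesis
    using \<open>Poly_Mapping.keys c \<subseteq> carrier M\<close>
  proof (induction c rule: free_Abelian_group_induct[consumes 1])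
    case 1
    then show ?case using group_hom.hom_one[OF act_hom] by (simp add: lact_def)
  next
    case (2 x y)
    then have "x \<in> frags" "y \<in> frags" by (auto simp: frags_def)
    then show ?case
      using 2 g group_hom.hom_inv[OF act_hom]
      by (simp add: additive.diff[OF additive_lact] eval_frag_diff lact_frags act_mult)
  next
    case (3 a)
    then show ?case using g by (simp add: lact_def)
  qed
qed

lemma lact_rels: "g \<in> carrier G \<Longrightarrow> c \<in> rels \<Longrightarrow> lact g c \<in> rels"
proof -
  assume g: "g \<in> carrier G" and c: "c \<in> rels"
  have "act g \<one>\<^bsub>M\<^esub> = \<one>\<^bsub>M\<^esub>" using eval_lact[OF g, of 0] add_closed_zero[OF add_closed_frags]
    by (simp add: additive.zero[OF additive_lact])
  then show ?thesis using g c by (simp add: rels_def lact_frags eval_lact)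
qed

lemma lact_lact:
  assumes "g \<in> carrier G" "h \<in> carrier G" "c \<in> frags"
  shows "lact (g \<otimes>\<^bsub>G\<^esub> h) c = lact g (lact h c)"
proof -
  have "lact g (lact h c) = frag_extend ((frag_of \<circ> act g) \<circ> act h) c"
    unfolding lact_def by (rule frag_extend_compose)
  also have "\<dots> = lact (g \<otimes>\<^bsub>G\<^esub> h) c"
    unfolding lact_def using assms by (intro frag_extend_eq) (auto simp: frags_def act_act subset_iff)
  finally show ?thesis ..
qed

lemma lact_one: assumes "c \<in> frags" shows "lact \<one>\<^bsub>G\<^esub> c = c"
proof -
  have "lact \<one>\<^bsub>G\<^esub> c = frag_extend frag_of c"
    unfolding lact_def using assms by (intro frag_extend_eq) (auto simp: frags_def act_one subset_iff)
  then show ?thesis by (simp flip: frag_expansion)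
qed

lemma tate_len_pos: "0 < tate_len i"
  by (simp add: tate_len_def)

lemma tuples_map: "g \<in> carrier G \<Longrightarrow> xs \<in> tuples (carrier G) n \<Longrightarrow> map ((\<otimes>\<^bsub>G\<^esub>) g) xs \<in> tuples (carrier G) n"
  by (auto simp: tuples_def)

text \<open>Values of cochains are lifted to the free abelian group on the set \<open>M\<close>, so that they can be added as
  elements of a type.\<close>

definition lifts :: "int \<Rightarrow> ('g list \<Rightarrow> 'm \<Rightarrow>\<^sub>0 int) set" where
  "lifts i = {F. \<forall>xs\<in>tuples (carrier G) (tate_len i). F xs \<in> frags}"

definition null_lifts :: "int \<Rightarrow> ('g list \<Rightarrow> 'm \<Rightarrow>\<^sub>0 int) set" where
  "null_lifts i = {F. \<forall>xs\<in>tuples (carrier G) (tate_len i). F xs \<in> rels}"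

text \<open>The length test in degree -1 makes d d vanish identically: a nonzero constant has a
  nonzero alternating sum over a list of odd length.\<close>

definition lift_d :: "int \<Rightarrow> ('g list \<Rightarrow> 'm \<Rightarrow>\<^sub>0 int) \<Rightarrow> 'g list \<Rightarrow> 'm \<Rightarrow>\<^sub>0 int" where
  "lift_d i F = (\<lambda>xs. if i \<ge> 0 then del_sum (\<lambda>_. F) xs else if i = -1 then if length xs = 1 then \<Sum>g\<in>carrier G. F [g] else 0
      else \<Sum>g\<in>carrier G. ins_sum g F xs)"

lemma add_closed_lifts: "add_closed (lifts i)" and add_closed_null_lifts: "add_closed (null_lifts i)"
  using add_closed_frags add_closed_rels by (auto simp: add_closed_def lifts_def null_lifts_def)

lemma additive_lift_d: "additive (lift_d i)"
  unfolding additive_def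
proof (intro allI ext)
  fix F F' and xs
  show "lift_d i (F + F') xs = (lift_d i F + lift_d i F') xs"
    using del_sum_add[of "\<lambda>_. F" "\<lambda>_. F'" xs]
    by (simp add: lift_d_def plus_fun_def ins_sum_add sum.distrib)
qed

lemma lift_d_closed:
  assumes S: "add_closed S" and F: "\<forall>xs\<in>tuples (carrier G) (tate_len i). F xs \<in> S"
    and xs: "xs \<in> tuples (carrier G) (tate_len (i + 1))"
  shows "lift_d i F xs \<in> S"
proof -
  consider "i \<ge> 0" | "i = -1" | "i < -1" by linarith
  then show ?thesis
  proof cases
    case 1
    have "F (us @ vs) \<in> S" if "xs = us @ x # vs" for us x vs
      using that xs F 1 by (auto simp: tuples_def tate_len_def)
    then show ?thesis using 1 S by (auto simp: lift_d_def intro!: del_sum_closed)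
  next
    case 2
    then show ?thesis using F S by (auto simp: lift_d_def tuples_def tate_len_def add_closed_zero intro!: add_closed_sum)
  next
    case 3
    have "F (us @ g # vs) \<in> S" if "xs = us @ vs" "g \<in> carrier G" for us g vs
      using that xs F 3 by (auto simp: tuples_def tate_len_def)
    then show ?thesis using 3 S by (auto simp: lift_d_def intro!: add_closed_sum ins_sum_closed)
  qed
qed

lemma lift_d_lifts: "F \<in> lifts i \<Longrightarrow> lift_d i F \<in> lifts (i + 1)"
  and lift_d_null_lifts: "F \<in> null_lifts i \<Longrightarrow> lift_d i F \<in> null_lifts (i + 1)"
  using lift_d_closed[OF add_closed_frags, of i F] lift_d_closed[OF add_closed_rels, of i F]
  by (auto simp: lifts_def null_lifts_def)

lemma lift_d_d: "lift_d (i + 1) (lift_d i F) = 0"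
proof (intro ext)
  fix xs
  consider "i \<ge> 0" | "i = -1" | "i = -2" | "i < -2" by linarith
  then show "lift_d (i + 1) (lift_d i F) xs = 0 xs"
  proof cases
    case 1
    have "del_sum (\<lambda>_. del_sum (\<lambda>_. F)) xs = - del_sum (\<lambda>_. del_sum (\<lambda>_. F)) xs"
      by (rule del_sum_del_sum)
    \<comment> \<open>An element equal to its negative is zero because the coefficients are
      integers.\<close>
    then have "Poly_Mapping.lookup (del_sum (\<lambda>_. del_sum (\<lambda>_. F)) xs) k
        = - Poly_Mapping.lookup (del_sum (\<lambda>_. del_sum (\<lambda>_. F)) xs) k" for k
      by (metis lookup_uminus)
    then have "del_sum (\<lambda>_. del_sum (\<lambda>_. F)) xs = 0" by (intro poly_mapping_eqI) simp
    then show ?thesis using 1 by (simp add: lift_d_def)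
  next
    case 2
    have "del_sum (\<lambda>_ ys. if length ys = 1 then c else 0) xs = 0" for c :: "'m \<Rightarrow>\<^sub>0 int"
    proof (cases "length xs = 2")
      case True
      then show ?thesis by (auto simp: length_Suc_conv numeral_2_eq_2)
    next
      case False
      show ?thesis
      proof (rule ccontr)
        assume "del_sum (\<lambda>_ ys. if length ys = 1 then c else 0) xs \<noteq> 0"
        then obtain us x vs where "xs = us @ x # vs" "(if length (us @ vs) = 1 then c else 0) \<noteq> 0"
          by (rule del_sum_nonzero)
        then show False using False by (auto split: if_splits)
      qed
    qed
    then show ?thesis using 2 by (simp add: lift_d_def)
  next
    case 3
    then show ?thesis by (simp add: lift_d_def sum_subtractf) (subst sum.swap, simp)
  next
    case 4
    have ins_sum_sum: "ins_sum g (\<lambda>xs. \<Sum>h\<in>H. f h xs) xs = (\<Sum>h\<in>H. ins_sum g (f h) xs)"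
      for g xs and H :: "'g set" and f :: "'g \<Rightarrow> 'g list \<Rightarrow> 'm \<Rightarrow>\<^sub>0 int"
      by (induction H rule: infinite_finite_induct) (auto simp: ins_sum_add)
    define A where "A g h = ins_sum g (ins_sum h F) xs" for g h
    have "lift_d (i + 1) (lift_d i F) xs = (\<Sum>g\<in>carrier G. \<Sum>h\<in>carrier G. A g h)"
      using 4 by (simp add: lift_d_def ins_sum_sum A_def)
    also have "\<dots> = - (\<Sum>g\<in>carrier G. \<Sum>h\<in>carrier G. A h g)"
      unfolding sum_negf[symmetric] A_def
      by (intro sum.cong refl) (simp add: eq_neg_iff_add_eq_0 ins_sum_ins_sum)
    also have "(\<Sum>g\<in>carrier G. \<Sum>h\<in>carrier G. A h g) = (\<Sum>g\<in>carrier G. \<Sum>h\<in>carrier G. A g h)"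
      by (rule sum.swap)
    finally have "lift_d (i + 1) (lift_d i F) xs = - lift_d (i + 1) (lift_d i F) xs"
      using 4 by (simp add: lift_d_def ins_sum_sum A_def)
    then have "Poly_Mapping.lookup (lift_d (i + 1) (lift_d i F) xs) k
        = - Poly_Mapping.lookup (lift_d (i + 1) (lift_d i F) xs) k" for k
      by (metis lookup_uminus)
    then show ?thesis by (intro poly_mapping_eqI) simp
  qed
qed

text \<open>Inserting the letter \<open>\<one>\<close> contracts the complex of all lifts, equivariant or not.\<close>

lemma lift_exact:
  assumes fin: "finite (carrier G)" and F: "F \<in> lifts i" "lift_d i F \<in> null_lifts (i + 1)"
  shows "\<exists>H\<in>lifts (i - 1). F - lift_d (i - 1) H \<in> null_lifts i"
proof -
  have dF: "lift_d i F xs \<in> rels" if "set xs \<subseteq> carrier G" "length xs = tate_len (i + 1)" for xs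
    using F(2) that by (auto simp: null_lifts_def tuples_def)
  have Fc: "F xs \<in> frags" if "set xs \<subseteq> carrier G" "length xs = tate_len i" for xs
    using F(1) that by (auto simp: lifts_def tuples_def)
  have one: "\<one>\<^bsub>G\<^esub> \<in> carrier G" by simp
  note rels0 = add_closed_zero[OF add_closed_rels] and frags0 = add_closed_zero[OF add_closed_frags]
  consider "i \<ge> 1" | "i = 0" | "i = -1" | "i < -1" by linarith
  then show ?thesis
  proof cases
    case 1
    define H where "H = (\<lambda>xs. F (\<one>\<^bsub>G\<^esub> # xs))"
    have "H \<in> lifts (i - 1)" using 1 Fc by (auto simp: lifts_def H_def tuples_def tate_len_def)
    moreover have "F xs - lift_d (i - 1) H xs \<in> rels" if "xs \<in> tuples (carrier G) (tate_len i)" for xs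
      using dF[of "\<one>\<^bsub>G\<^esub> # xs"] that 1 by (simp add: lift_d_def H_def tuples_def tate_len_def)
    ultimately show ?thesis by (auto simp: null_lifts_def)
  next
    case 2
    \<comment> \<open>At the splice the differential is a sum over G, so a cochain supported at the
      unit has the constant value of F there as its differential.\<close>
    define H where "H = (\<lambda>xs. if xs = [\<one>\<^bsub>G\<^esub>] then F [\<one>\<^bsub>G\<^esub>] else 0)"
    have "H \<in> lifts (i - 1)" using 2 Fc frags0 by (auto simp: lifts_def H_def tuples_def tate_len_def)
    moreover have "F xs - lift_d (i - 1) H xs \<in> rels" if xs: "xs \<in> tuples (carrier G) (tate_len i)" for xs
    proof -
      obtain x where x: "xs = [x]" "x \<in> carrier G" using xs 2 by (auto simp: tuples_def tate_len_def length_Suc_conv)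
      have "lift_d (i - 1) H xs = F [\<one>\<^bsub>G\<^esub>]" using 2 fin x by (simp add: lift_d_def H_def)
      then show ?thesis
        using dF[of "[\<one>\<^bsub>G\<^esub>, x]"] x 2 by (simp add: lift_d_def tate_len_def)
    qed
    ultimately show ?thesis by (auto simp: null_lifts_def)
  next
    case 3
    \<comment> \<open>Dually to the positive half, the contraction is supported on lists that begin
      with the unit and reads the remaining letters.\<close>
    define H where "H = (\<lambda>xs. if hd xs = \<one>\<^bsub>G\<^esub> then F (tl xs) else 0)"
    have "H \<in> lifts (i - 1)" using 3 Fc frags0
      by (auto simp: lifts_def H_def tuples_def tate_len_def length_Suc_conv numeral_2_eq_2)
    moreover have "F xs - lift_d (i - 1) H xs \<in> rels" if xs: "xs \<in> tuples (carrier G) (tate_len i)" for xs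
    proof -
      obtain x where x: "xs = [x]" "x \<in> carrier G" using xs 3 by (auto simp: tuples_def tate_len_def length_Suc_conv)
      have "lift_d (i - 1) H xs = F [x] - (if x = \<one>\<^bsub>G\<^esub> then lift_d i F xs else 0)"
        using 3 fin x by (simp add: lift_d_def H_def sum_subtractf)
      then show ?thesis
        using dF[of xs] x 3 rels0 by (auto simp: tate_len_def)
    qed
    ultimately show ?thesis by (auto simp: null_lifts_def)
  next
    case 4
    define H where "H = (\<lambda>xs. if hd xs = \<one>\<^bsub>G\<^esub> then F (tl xs) else 0)"
    have "H xs \<in> frags" if "xs \<in> tuples (carrier G) (tate_len (i - 1))" for xs
      using 4 Fc[of "tl xs"] frags0 that
      by (cases xs) (auto simp: H_def tuples_def tate_len_def nat_diff_distrib)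
    then have "H \<in> lifts (i - 1)" by (simp add: lifts_def)
    moreover have "F xs - lift_d (i - 1) H xs \<in> rels" if xs: "xs \<in> tuples (carrier G) (tate_len i)" for xs
    proof -
      have "length xs \<noteq> 0" using xs tate_len_pos[of i] by (auto simp: tuples_def)
      then obtain x ys where x: "xs = x # ys" by (cases xs) auto
      have ys: "set ys \<subseteq> carrier G" "length ys = tate_len (i + 1)" "x \<in> carrier G"
        using xs 4 by (auto simp: x tuples_def tate_len_def)
      have "ins_sum g (\<lambda>zs. H (x # zs)) ys = (if x = \<one>\<^bsub>G\<^esub> then ins_sum g F ys else 0)" for g
        by (cases "x = \<one>\<^bsub>G\<^esub>") (auto simp: H_def)
      then have "lift_d (i - 1) H xs = F xs - (if x = \<one>\<^bsub>G\<^esub> then lift_d i F ys else 0)"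
        using 4 fin ys by (simp add: lift_d_def x sum_subtractf) (simp add: H_def)
      then show ?thesis using dF[of ys] ys rels0 by simp
    qed
    ultimately show ?thesis by (auto simp: null_lifts_def)
  qed
qed

text \<open>Conjugation on functions; its fixed points modulo \<open>null_lifts\<close> are the
  lifts of equivariant cochains.\<close>

definition lift_act :: "'g \<Rightarrow> ('g list \<Rightarrow> 'm \<Rightarrow>\<^sub>0 int) \<Rightarrow> 'g list \<Rightarrow> 'm \<Rightarrow>\<^sub>0 int" where
  "lift_act g F = (\<lambda>xs. lact g (F (map ((\<otimes>\<^bsub>G\<^esub>) (inv\<^bsub>G\<^esub> g)) xs)))"

lemma additive_lift_act: "additive (lift_act g)"
  by (simp add: additive_def lift_act_def fun_eq_iff additive.add[OF additive_lact])

lemma lift_act_lifts: "g \<in> carrier G \<Longrightarrow> F \<in> lifts i \<Longrightarrow> lift_act g F \<in> lifts i"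
  and lift_act_null_lifts: "g \<in> carrier G \<Longrightarrow> F \<in> null_lifts i \<Longrightarrow> lift_act g F \<in> null_lifts i"
  by (simp_all add: lifts_def null_lifts_def lift_act_def lact_frags lact_rels tuples_map)

lemma lift_d_act:
  assumes g: "g \<in> carrier G" shows "lift_d i (lift_act g F) = lift_act g (lift_d i F)"
proof
  fix xs
  let ?h = "(\<otimes>\<^bsub>G\<^esub>) (inv\<^bsub>G\<^esub> g)"
  have bij: "bij_betw ?h (carrier G) (carrier G)"
    by (rule bij_betw_byWitness[where f' = "(\<otimes>\<^bsub>G\<^esub>) g"])
      (use g in \<open>auto simp: G.m_assoc[symmetric]\<close>)
  have 1: "del_sum (\<lambda>_. lift_act g F) xs = lact g (del_sum (\<lambda>_. F) (map ?h xs))"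
    unfolding del_sum_map del_sum_additive[OF additive_lact] lift_act_def ..
  have 2: "(\<Sum>x\<in>carrier G. lift_act g F [x]) = lact g (\<Sum>x\<in>carrier G. F [x])"
    using sum.reindex_bij_betw[OF bij, of "\<lambda>x. lact g (F [x])"]
    by (simp add: additive.sum[OF additive_lact] lift_act_def)
  have 3: "(\<Sum>x\<in>carrier G. ins_sum x (lift_act g F) xs) = lact g (\<Sum>x\<in>carrier G. ins_sum x F (map ?h xs))"
    using sum.reindex_bij_betw[OF bij, of "\<lambda>x. lact g (ins_sum x F (map ?h xs))"]
    by (simp add: additive.sum[OF additive_lact] lift_act_def ins_sum_map ins_sum_additive[OF additive_lact])
  have "lift_act g (lift_d i F) xs = lact g (lift_d i F (map ?h xs))" by (simp only: lift_act_def)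
  then show "lift_d i (lift_act g F) xs = lift_act g (lift_d i F) xs"
    unfolding lift_d_def 1 2 3 by (simp add: additive.zero[OF additive_lact])
qed

end

section \<open>Cohomology of a cyclic group through a generator\<close>

locale cyclic_module = group_ring_module +
  fixes t and m :: nat
  assumes t [simp]: "t \<in> carrier G" and m_pos: "0 < m" and t_m: "t [^]\<^bsub>G\<^esub> m = \<one>\<^bsub>G\<^esub>"
    and powers: "bij_betw (\<lambda>k. t [^]\<^bsub>G\<^esub> k) {..<m} (carrier G)"
begin

lemma finite_G: "finite (carrier G)"
  using powers bij_betw_finite by blast

lemma is_power: "g \<in> carrier G \<Longrightarrow> \<exists>k::nat. g = t [^]\<^bsub>G\<^esub> k"
  using bij_betw_imp_surj_on[OF powers] by blast

lemma pow_Suc2: "t [^]\<^bsub>G\<^esub> Suc k = t \<otimes>\<^bsub>G\<^esub> t [^]\<^bsub>G\<^esub> k"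
  by (rule G.nat_pow_Suc2) simp

lemma funpow_lact: "c \<in> frags \<Longrightarrow> (lact t ^^ k) c = lact (t [^]\<^bsub>G\<^esub> k) c"
proof (induction k)
  case (Suc k)
  then show ?case unfolding pow_Suc2 by (simp add: lact_lact)
qed (simp add: lact_one)

lemma funpow_lift_act:
  assumes "F \<in> lifts i" "xs \<in> tuples (carrier G) (tate_len i)"
  shows "(lift_act t ^^ k) F xs = lift_act (t [^]\<^bsub>G\<^esub> k) F xs"
  using assms(2)
proof (induction k arbitrary: xs)
  case 0
  have "map ((\<otimes>\<^bsub>G\<^esub>) \<one>\<^bsub>G\<^esub>) xs = xs" using 0 by (auto simp: tuples_def subset_iff intro!: map_idI)
  then show ?case using assms(1) 0 by (simp add: lift_act_def lact_one lifts_def)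
next
  case (Suc k)
  define u where "u = t [^]\<^bsub>G\<^esub> k"
  have u: "u \<in> carrier G" by (simp add: u_def)
  have xs: "map ((\<otimes>\<^bsub>G\<^esub>) (inv\<^bsub>G\<^esub> t)) xs \<in> tuples (carrier G) (tate_len i)"
    using Suc.prems by (intro tuples_map) auto
  have maps: "map ((\<otimes>\<^bsub>G\<^esub>) (inv\<^bsub>G\<^esub> u)) (map ((\<otimes>\<^bsub>G\<^esub>) (inv\<^bsub>G\<^esub> t)) xs) = map ((\<otimes>\<^bsub>G\<^esub>) (inv\<^bsub>G\<^esub> (t \<otimes>\<^bsub>G\<^esub> u))) xs"
    using Suc.prems u by (auto simp: tuples_def subset_iff G.inv_mult_group G.m_assoc)
  have "map ((\<otimes>\<^bsub>G\<^esub>) (inv\<^bsub>G\<^esub> (t \<otimes>\<^bsub>G\<^esub> u))) xs \<in> tuples (carrier G) (tate_len i)"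
    using Suc.prems u by (intro tuples_map) auto
  then have fr: "F (map ((\<otimes>\<^bsub>G\<^esub>) (inv\<^bsub>G\<^esub> (t \<otimes>\<^bsub>G\<^esub> u))) xs) \<in> frags" using assms(1) by (simp add: lifts_def)
  have "(lift_act t ^^ Suc k) F xs = lact t (lift_act u F (map ((\<otimes>\<^bsub>G\<^esub>) (inv\<^bsub>G\<^esub> t)) xs))"
    using Suc.IH[OF xs] by (simp add: lift_act_def[of t "(lift_act t ^^ k) F"] u_def)
  also have "\<dots> = lact t (lact u (F (map ((\<otimes>\<^bsub>G\<^esub>) (inv\<^bsub>G\<^esub> (t \<otimes>\<^bsub>G\<^esub> u))) xs)))"
    unfolding lift_act_def maps ..
  also have "\<dots> = lift_act (t \<otimes>\<^bsub>G\<^esub> u) F xs"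
    unfolding lift_act_def by (rule lact_lact[symmetric]) (use u fr in auto)
  finally show ?case unfolding u_def pow_Suc2 .
qed

lemma lift_period: "F \<in> lifts i \<Longrightarrow> (lift_act t ^^ m) F - F \<in> null_lifts i"
  using funpow_lift_act[of F i _ m] funpow_lift_act[of F i _ 0] add_closed_zero[OF add_closed_rels]
  by (simp add: null_lifts_def t_m)

lemma submodule_pair_lifts: "submodule_pair (lifts i) (null_lifts i) (lift_act t)"
  using rels_frags
  by (auto simp: submodule_pair_def add_closed_lifts add_closed_null_lifts additive_lift_act
      lift_act_lifts lift_act_null_lifts) (auto simp: lifts_def null_lifts_def)

text \<open>The functions on lists, equivariant or not, form an induced module: G acts simply
  transitively on the first letter, and E keeps the lists that begin with the unit.\<close>

lemma
  shows tate0_lifts: "tate0 (lifts i) (null_lifts i) (lift_act t) m"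
    and tate1_lifts: "tate1 (lifts i) (null_lifts i) (lift_act t) m"
proof -
  define E where "E F = (\<lambda>xs. if hd xs = \<one>\<^bsub>G\<^esub> then F xs else 0)" for F :: "'a list \<Rightarrow> 'c \<Rightarrow>\<^sub>0 int"
  have E: "additive E" by (auto simp: additive_def E_def fun_eq_iff)
  have EC: "E F \<in> lifts i" if "F \<in> lifts i" for F
    using that add_closed_zero[OF add_closed_frags] by (auto simp: lifts_def E_def)
  have EZ: "E F \<in> null_lifts i" if "F \<in> null_lifts i" for F
    using that add_closed_zero[OF add_closed_rels] by (auto simp: null_lifts_def E_def)
  have "(\<Sum>k<m. (lift_act t ^^ k) (E ((lift_act t ^^ (m - k)) F))) - F \<in> null_lifts i" if F: "F \<in> lifts i" for F
  proof -
    have "(\<Sum>k<m. (lift_act t ^^ k) (E ((lift_act t ^^ (m - k)) F))) xs = F xs"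
      if xs: "xs \<in> tuples (carrier G) (tate_len i)" for xs
    proof -
      have Fk: "(lift_act t ^^ k) F \<in> lifts i" for k
        by (rule funpow_closed[of "lifts i"]) (auto intro: lift_act_lifts F)
      have "xs \<noteq> []" using xs tate_len_pos[of i] by (auto simp: tuples_def)
      then have hd: "hd xs \<in> carrier G" using xs by (cases xs) (auto simp: tuples_def)
      have "(lift_act t ^^ k) (E ((lift_act t ^^ (m - k)) F)) xs = (if hd xs = t [^]\<^bsub>G\<^esub> k then F xs else 0)"
        if k: "k < m" for k
      proof -
        define u where "u = t [^]\<^bsub>G\<^esub> k"
        have u: "u \<in> carrier G" by (simp add: u_def)
        have hd': "hd (map ((\<otimes>\<^bsub>G\<^esub>) (inv\<^bsub>G\<^esub> u)) xs) = \<one>\<^bsub>G\<^esub> \<longleftrightarrow> hd xs = u"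
          using \<open>xs \<noteq> []\<close> hd u G.inv_equality[of "inv\<^bsub>G\<^esub> u" "hd xs"] by (auto simp: hd_map dest: G.inv_inj[THEN inj_onD])
        have "(lift_act t ^^ k) (E ((lift_act t ^^ (m - k)) F)) xs = lift_act u (E ((lift_act t ^^ (m - k)) F)) xs"
          unfolding u_def by (rule funpow_lift_act[OF EC[OF Fk] xs])
        also have "\<dots> = (if hd xs = u then lift_act u ((lift_act t ^^ (m - k)) F) xs else 0)"
          by (simp add: lift_act_def[of u] E_def hd' additive.zero[OF additive_lact])
        also have "lift_act u ((lift_act t ^^ (m - k)) F) xs = (lift_act t ^^ k) ((lift_act t ^^ (m - k)) F) xs"
          unfolding u_def by (rule funpow_lift_act[OF Fk xs, symmetric])
        also have "\<dots> = (lift_act t ^^ m) F xs"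
          using k by (simp flip: funpow_add o_apply[of "lift_act t ^^ k"])
        also have "\<dots> = F xs"
          using funpow_lift_act[OF F xs, of m] funpow_lift_act[OF F xs, of 0] by (simp add: t_m)
        finally show ?thesis by (simp add: u_def)
      qed
      moreover have "(\<Sum>k<n. H k) xs = (\<Sum>k<n. H k xs)" for H :: "nat \<Rightarrow> 'a list \<Rightarrow> 'c \<Rightarrow>\<^sub>0 int" and n :: nat
        by (induction n) auto
      ultimately have "(\<Sum>k<m. (lift_act t ^^ k) (E ((lift_act t ^^ (m - k)) F))) xs
          = (\<Sum>k<m. (if hd xs = t [^]\<^bsub>G\<^esub> k then F xs else 0))"
        by simp
      also have "\<dots> = (\<Sum>g\<in>carrier G. if hd xs = g then F xs else 0)"
        by (rule sum.reindex_bij_betw[OF powers])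
      also have "\<dots> = F xs" using hd finite_G by simp
      finally show ?thesis .
    qed
    then show ?thesis using add_closed_zero[OF add_closed_rels] by (simp add: null_lifts_def)
  qed
  then show "tate0 (lifts i) (null_lifts i) (lift_act t) m" "tate1 (lifts i) (null_lifts i) (lift_act t) m"
    using tate0_induced tate1_induced submodule_pair_lifts E EC EZ by blast+
qed

definition invariant_lifts :: "int \<Rightarrow> ('a list \<Rightarrow> 'c \<Rightarrow>\<^sub>0 int) set" where
  "invariant_lifts i = {F \<in> lifts i. lift_act t F - F \<in> null_lifts i}"

definition vanishing :: "int \<Rightarrow> bool" where
  "vanishing i \<longleftrightarrow> (\<forall>F\<in>lifts i. lift_act t F - F \<in> null_lifts i \<longrightarrow> lift_d i F \<in> null_lifts (i + 1) \<longrightarrow>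
      (\<exists>H\<in>lifts (i - 1). lift_act t H - H \<in> null_lifts (i - 1) \<and> F - lift_d (i - 1) H \<in> null_lifts i))"

lemma vanishing_periodic: "vanishing (i - 2) \<longleftrightarrow> vanishing i"
  unfolding vanishing_def
  by (rule double_complex_shift[where T = "lift_act t" and d = lift_d and C = lifts and Z = null_lifts and m = m])
    (rule submodule_pair_lifts additive_lift_d lift_d_lifts lift_d_null_lifts lift_d_act[OF t] lift_d_d
      lift_exact[OF finite_G] tate0_lifts tate1_lifts lift_period; assumption?)+

lemma vanishing_parity:
  assumes "vanishing k" "even (i - k)" shows "vanishing i"
proof -
  have "vanishing (k + 2 * n)" for n :: int
  proof (induction n rule: int_induct[of _ 0])
    case base then show ?case using assms by simp
  next
    case (step1 n) then show ?case using vanishing_periodic[of "k + 2 * (n + 1)"] by (simp add: algebra_simps)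
  next
    case (step2 n) then show ?case using vanishing_periodic[of "k + 2 * n"] by (simp add: algebra_simps)
  qed
  moreover have "i = k + 2 * ((i - k) div 2)" using assms(2) by simp
  ultimately show ?thesis by metis
qed

lemma diff_rels_trans: "a - b \<in> rels \<Longrightarrow> b - c \<in> rels \<Longrightarrow> a - c \<in> rels"
  by (rule add_closed_diff_trans[OF add_closed_rels])

lemma invariant_lift_translate:
  assumes F: "F \<in> lifts i" "lift_act t F - F \<in> null_lifts i" and g: "g \<in> carrier G"
    and xs: "xs \<in> tuples (carrier G) (tate_len i)"
  shows "F (map ((\<otimes>\<^bsub>G\<^esub>) g) xs) - lact g (F xs) \<in> rels"
proof -
  obtain k :: nat where "g = t [^]\<^bsub>G\<^esub> k" using is_power[OF g] by blast
  moreover have "F (map ((\<otimes>\<^bsub>G\<^esub>) (t [^]\<^bsub>G\<^esub> k)) xs) - lact (t [^]\<^bsub>G\<^esub> k) (F xs) \<in> rels" for k :: nat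
  proof (induction k)
    case 0
    have "map ((\<otimes>\<^bsub>G\<^esub>) \<one>\<^bsub>G\<^esub>) xs = xs" using xs by (auto simp: tuples_def subset_iff intro!: map_idI)
    then show ?case using F xs by (simp add: lact_one lifts_def add_closed_zero[OF add_closed_rels])
  next
    case (Suc k)
    define u where "u = t [^]\<^bsub>G\<^esub> k"
    have u: "u \<in> carrier G" by (simp add: u_def)
    let ?ys = "map ((\<otimes>\<^bsub>G\<^esub>) u) xs" and ?zs = "map ((\<otimes>\<^bsub>G\<^esub>) (t \<otimes>\<^bsub>G\<^esub> u)) xs"
    have zs: "?zs \<in> tuples (carrier G) (tate_len i)" using xs u by (intro tuples_map) auto
    have eq: "map ((\<otimes>\<^bsub>G\<^esub>) (inv\<^bsub>G\<^esub> t)) ?zs = ?ys"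
      using xs u by (auto simp: tuples_def subset_iff simp flip: G.m_assoc)
    have "lift_act t F ?zs = lact t (F ?ys)" by (simp only: lift_act_def eq)
    then have "lact t (F ?ys) - F ?zs \<in> rels"
      using bspec[OF F(2)[unfolded null_lifts_def mem_Collect_eq] zs] by simp
    moreover have "lact t (F ?ys) - lact t (lact u (F xs)) \<in> rels"
      using lact_rels[OF t Suc[folded u_def]] by (simp add: additive.diff[OF additive_lact])
    ultimately have "F ?zs - lact t (lact u (F xs)) \<in> rels"
      using diff_rels_trans add_closed_diff_swap[OF add_closed_rels] by blast
    then show ?case using F xs u unfolding pow_Suc2 u_def[symmetric] by (simp add: lact_lact lifts_def)
  qed
  ultimately show ?thesis by simp
qed

lemma norm_op_lact:
  assumes "c \<in> frags" shows "norm_op m (lact t) c = (\<Sum>g\<in>carrier G. lact g c)"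
  unfolding norm_op_def sum.reindex_bij_betw[OF powers, of "\<lambda>g. lact g c", symmetric]
  by (simp add: funpow_lact[OF assms])

text \<open>Modulo \<open>rels\<close>, a 0-cocycle is constant and invariance makes its value a
  fixed element. If that value is the norm of y, the cochain g -> g y of degree -1 has it as its
  differential.\<close>

lemma vanishing_0:
  assumes "tate0 frags rels (lact t) m" shows "vanishing 0"
  unfolding vanishing_def
proof (intro ballI impI)
  fix F assume F: "F \<in> lifts 0" "lift_act t F - F \<in> null_lifts 0" "lift_d 0 F \<in> null_lifts (0 + 1)"
  have tl: "tate_len (-1) = 1" "tate_len 0 = 1" "tate_len 1 = 2" "tate_len (0 - 1) = 1" by (auto simp: tate_len_def)
  have const: "F [y] - F [x] \<in> rels" if "x \<in> carrier G" "y \<in> carrier G" for x y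
    using bspec[OF F(3)[unfolded null_lifts_def mem_Collect_eq], of "[x, y]"] that
    by (simp add: lift_d_def tuples_def tl)
  have one: "[\<one>\<^bsub>G\<^esub>] \<in> tuples (carrier G) (tate_len 0)" by (simp add: tuples_def tl)
  then have F1: "F [\<one>\<^bsub>G\<^esub>] \<in> frags" using F(1) by (simp add: lifts_def)
  have "F [t] - lact t (F [\<one>\<^bsub>G\<^esub>]) \<in> rels" using invariant_lift_translate[OF F(1,2) t one] by simp
  then have "lact t (F [\<one>\<^bsub>G\<^esub>]) - F [\<one>\<^bsub>G\<^esub>] \<in> rels"
    using const[of "\<one>\<^bsub>G\<^esub>" t] diff_rels_trans add_closed_diff_swap[OF add_closed_rels] by (meson G.one_closed t)
  then obtain y where y: "y \<in> frags" "F [\<one>\<^bsub>G\<^esub>] - norm_op m (lact t) y \<in> rels"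
    using assms F1 by (auto simp: tate0_def)
  define H where "H xs = lact (hd xs) y" for xs
  have "H \<in> lifts (0 - 1)"
    by (auto simp: lifts_def H_def tuples_def tl length_Suc_conv lact_frags y)
  moreover have "lift_act t H xs = H xs" if "xs \<in> tuples (carrier G) (tate_len (0 - 1))" for xs
    using that y by (auto simp: lift_act_def H_def tuples_def tl length_Suc_conv simp flip: lact_lact G.m_assoc)
  then have "lift_act t H - H \<in> null_lifts (0 - 1)"
    using add_closed_zero[OF add_closed_rels] by (simp add: null_lifts_def)
  moreover have "F xs - lift_d (0 - 1) H xs \<in> rels" if xs: "xs \<in> tuples (carrier G) (tate_len 0)" for xs
  proof -
    obtain x where x: "xs = [x]" "x \<in> carrier G" using xs by (auto simp: tuples_def tl length_Suc_conv)
    have "lift_d (0 - 1) H xs = norm_op m (lact t) y"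
      using y x by (simp add: lift_d_def H_def norm_op_lact)
    then show ?thesis using const[of "\<one>\<^bsub>G\<^esub>" x] x y diff_rels_trans by auto
  qed
  ultimately show "\<exists>H\<in>lifts (0 - 1). lift_act t H - H \<in> null_lifts (0 - 1) \<and> F - lift_d (0 - 1) H \<in> null_lifts 0"
    by (intro bexI[of _ H]) (auto simp: null_lifts_def)
qed

lemma vanishing_minus_1:
  assumes "tate1 frags rels (lact t) m" shows "vanishing (-1)"
  unfolding vanishing_def
proof (intro ballI impI)
  fix F assume F: "F \<in> lifts (-1)" "lift_act t F - F \<in> null_lifts (-1)" "lift_d (-1) F \<in> null_lifts (-1 + 1)"
  have tl: "tate_len (-1) = 1" "tate_len (-1 + 1) = 1" "tate_len 0 = 1" "tate_len (-1 - 1) = 2" "tate_len (-2) = 2"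
    by (auto simp: tate_len_def)
  have one: "[\<one>\<^bsub>G\<^esub>] \<in> tuples (carrier G) (tate_len (-1))" by (simp add: tuples_def tl)
  then have F1: "F [\<one>\<^bsub>G\<^esub>] \<in> frags" using F(1) by (simp add: lifts_def)
  have Fg: "F [g] - lact g (F [\<one>\<^bsub>G\<^esub>]) \<in> rels" if "g \<in> carrier G" for g
    using invariant_lift_translate[OF F(1,2) that one] that by simp
  have "(\<Sum>g\<in>carrier G. F [g]) \<in> rels"
    using bspec[OF F(3)[unfolded null_lifts_def mem_Collect_eq], of "[\<one>\<^bsub>G\<^esub>]"]
    by (simp add: lift_d_def tuples_def tl)
  moreover have "(\<Sum>g\<in>carrier G. F [g]) - norm_op m (lact t) (F [\<one>\<^bsub>G\<^esub>]) \<in> rels"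
    unfolding norm_op_lact[OF F1] sum_subtractf[symmetric] by (intro add_closed_sum[OF add_closed_rels] Fg)
  ultimately have "norm_op m (lact t) (F [\<one>\<^bsub>G\<^esub>]) \<in> rels"
    using add_closed_diff_swap[OF add_closed_rels] add_closed_cancel[OF add_closed_rels] by blast
  then obtain y where y: "y \<in> frags" "F [\<one>\<^bsub>G\<^esub>] - (lact t y - y) \<in> rels"
    using assms F1 by (auto simp: tate1_def)
  \<comment> \<open>Supported on the pairs (a, b) with b = a t^(-1). In the differential at x,
    inserting in front leaves only g = x t and inserting behind only g = x t^(-1), so the value is x
    (t y - y).\<close>
  define H where "H xs = (if xs ! 1 = hd xs \<otimes>\<^bsub>G\<^esub> inv\<^bsub>G\<^esub> t then lact (hd xs) y else 0)" for xs
  note zero = add_closed_zero[OF add_closed_frags] add_closed_zero[OF add_closed_rels]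
  have pair: "\<exists>a b. xs = [a, b] \<and> a \<in> carrier G \<and> b \<in> carrier G" if "xs \<in> tuples (carrier G) (tate_len (-1 - 1))" for xs
    using that by (auto simp: tuples_def tl length_Suc_conv numeral_2_eq_2)
  have "H xs \<in> frags" if "xs \<in> tuples (carrier G) (tate_len (-1 - 1))" for xs
    using pair[OF that] zero y by (auto simp: H_def lact_frags)
  then have "H \<in> lifts (-1 - 1)" by (auto simp: lifts_def)
  moreover have "lift_act t H xs = H xs" if xs: "xs \<in> tuples (carrier G) (tate_len (-1 - 1))" for xs
  proof -
    obtain a b where ab: "xs = [a, b]" "a \<in> carrier G" "b \<in> carrier G" using pair[OF xs] by blast
    have "inv\<^bsub>G\<^esub> t \<otimes>\<^bsub>G\<^esub> b = inv\<^bsub>G\<^esub> t \<otimes>\<^bsub>G\<^esub> a \<otimes>\<^bsub>G\<^esub> inv\<^bsub>G\<^esub> t \<longleftrightarrow> b = a \<otimes>\<^bsub>G\<^esub> inv\<^bsub>G\<^esub> t"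
      using ab by (simp add: G.m_assoc)
    then show ?thesis
      using ab y by (auto simp: lift_act_def H_def additive.zero[OF additive_lact] simp flip: lact_lact G.m_assoc)
  qed
  then have "lift_act t H - H \<in> null_lifts (-1 - 1)" using zero by (simp add: null_lifts_def)
  moreover have "F xs - lift_d (-1 - 1) H xs \<in> rels" if xs: "xs \<in> tuples (carrier G) (tate_len (-1))" for xs
  proof -
    obtain x where x: "xs = [x]" "x \<in> carrier G" using xs by (auto simp: tuples_def tl length_Suc_conv)
    have "(\<Sum>g\<in>carrier G. H [g, x]) = (\<Sum>g\<in>carrier G. if x \<otimes>\<^bsub>G\<^esub> t = g then lact g y else 0)"
      by (rule sum.cong) (use x in \<open>auto simp: H_def G.m_assoc\<close>)
    also have "\<dots> = lact x (lact t y)" using x y finite_G by (simp add: lact_lact)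
    finally have 1: "(\<Sum>g\<in>carrier G. H [g, x]) = lact x (lact t y)" .
    have "(\<Sum>g\<in>carrier G. H [x, g]) = lact x y" using x finite_G by (simp add: H_def)
    with 1 have "lift_d (-1 - 1) H xs = lact x (lact t y - y)"
      using x by (simp add: lift_d_def sum_subtractf additive.diff[OF additive_lact])
    moreover have "lact x (F [\<one>\<^bsub>G\<^esub>]) - lact x (lact t y - y) \<in> rels"
      using lact_rels[OF x(2) y(2)] by (simp add: additive.diff[OF additive_lact])
    ultimately show ?thesis using Fg[OF x(2)] x(1) diff_rels_trans by metis
  qed
  ultimately show "\<exists>H\<in>lifts (-1 - 1). lift_act t H - H \<in> null_lifts (-1 - 1) \<and> F - lift_d (-1 - 1) H \<in> null_lifts (-1)"
    by (intro bexI[of _ H]) (auto simp: null_lifts_def)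
qed

definition realize :: "int \<Rightarrow> ('a list \<Rightarrow> 'c \<Rightarrow>\<^sub>0 int) \<Rightarrow> 'a list \<Rightarrow> 'c" where
  "realize i F = (\<lambda>xs\<in>tuples (carrier G) (tate_len i). eval_frag (F xs))"

lemma realize_eq_iff: "F \<in> lifts i \<Longrightarrow> F' \<in> lifts i \<Longrightarrow> realize i F = realize i F' \<longleftrightarrow> F - F' \<in> null_lifts i"
  by (auto simp: realize_def null_lifts_def lifts_def fun_eq_iff diff_rels_iff)

lemma realize_add:
  "F \<in> lifts i \<Longrightarrow> F' \<in> lifts i \<Longrightarrow>
     realize i (F + F') = realize i F \<otimes>\<^bsub>tate_cochains G M act i\<^esub> realize i F'"
  by (auto simp: realize_def lifts_def tate_cochains_def fun_eq_iff eval_frag_add)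

lemma lift_of_cochain:
  assumes f: "f \<in> carrier (tate_cochains G M act i)"
  shows "frag_of \<circ> f \<in> invariant_lifts i" "realize i (frag_of \<circ> f) = f"
proof -
  have fM: "f xs \<in> carrier M" if "xs \<in> tuples (carrier G) (tate_len i)" for xs
    using f that by (auto simp: tate_cochains_def)
  have eqv: "f (map ((\<otimes>\<^bsub>G\<^esub>) g) xs) = act g (f xs)" if "xs \<in> tuples (carrier G) (tate_len i)" "g \<in> carrier G" for g xs
    using f that by (auto simp: tate_cochains_def)
  have "lift_act t (frag_of \<circ> f) xs = frag_of (f xs)" if xs: "xs \<in> tuples (carrier G) (tate_len i)" for xs
  proof -
    have "f xs = f (map ((\<otimes>\<^bsub>G\<^esub>) t) (map ((\<otimes>\<^bsub>G\<^esub>) (inv\<^bsub>G\<^esub> t)) xs))"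
      using xs by (auto intro!: arg_cong[of _ _ f] map_idI[symmetric] simp: tuples_def subset_iff simp flip: G.m_assoc)
    also have "\<dots> = act t (f (map ((\<otimes>\<^bsub>G\<^esub>) (inv\<^bsub>G\<^esub> t)) xs))"
      by (rule eqv) (use xs tuples_map in auto)
    finally show ?thesis by (simp add: lift_act_def lact_def)
  qed
  then show "frag_of \<circ> f \<in> invariant_lifts i"
    using fM add_closed_zero[OF add_closed_rels] by (simp add: invariant_lifts_def lifts_def null_lifts_def)
  show "realize i (frag_of \<circ> f) = f"
  proof
    show "realize i (frag_of \<circ> f) xs = f xs" for xs
      using f fM by (auto simp: realize_def tate_cochains_def PiE_def extensional_def)
  qed
qed

lemma realize_closed:
  assumes "F \<in> invariant_lifts i" shows "realize i F \<in> carrier (tate_cochains G M act i)"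
proof -
  have F: "F \<in> lifts i" "lift_act t F - F \<in> null_lifts i" using assms by (auto simp: invariant_lifts_def)
  have Fc: "F xs \<in> frags" if "xs \<in> tuples (carrier G) (tate_len i)" for xs using F that by (simp add: lifts_def)
  have "eval_frag (F (map ((\<otimes>\<^bsub>G\<^esub>) g) xs)) = act g (eval_frag (F xs))"
    if "g \<in> carrier G" "xs \<in> tuples (carrier G) (tate_len i)" for g xs
    using invariant_lift_translate[OF F that] that
    by (simp add: diff_rels_iff Fc tuples_map lact_frags eval_lact)
  then show ?thesis by (auto simp: tate_cochains_def realize_def Fc tuples_map)
qed

lemma del_sum_eq_sum:
  "del_sum (\<lambda>_. F) xs = (\<Sum>k<length xs. frag_cmul ((-1) ^ k) (F (take k xs @ drop (Suc k) xs)))"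
  for F :: "'x list \<Rightarrow> 'y \<Rightarrow>\<^sub>0 int"
proof (induction xs arbitrary: F)
  case (Cons x xs)
  show ?case unfolding del_sum.simps Cons length_Cons sum.lessThan_Suc_shift
    by (simp add: sum_negf[symmetric] del: sum_negf)
qed simp

lemma ins_sum_eq_sum:
  "ins_sum g F xs = (\<Sum>k\<le>length xs. frag_cmul ((-1) ^ k) (F (take k xs @ g # drop k xs)))"
  for F :: "'x list \<Rightarrow> 'y \<Rightarrow>\<^sub>0 int"
proof (induction xs arbitrary: F)
  case (Cons x xs)
  show ?case unfolding ins_sum.simps Cons length_Cons sum.atMost_Suc_shift
    by (simp add: sum_negf[symmetric] del: sum_negf)
qed simp

lemma tate_d_realize:
  assumes F: "F \<in> lifts i" shows "tate_d G M i (realize i F) = realize (i + 1) (lift_d i F)"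
proof
  fix xs
  show "tate_d G M i (realize i F) xs = realize (i + 1) (lift_d i F) xs"
  proof (cases "xs \<in> tuples (carrier G) (tate_len (i + 1))")
    case False
    then show ?thesis by (simp add: tate_d_def realize_def)
  next
    case xs: True
    have R: "ys \<in> tuples (carrier G) (tate_len i) \<Longrightarrow> realize i F ys = eval_frag (F ys)" for ys
      by (simp add: realize_def)
    have Fc: "ys \<in> tuples (carrier G) (tate_len i) \<Longrightarrow> F ys \<in> frags" for ys using F by (simp add: lifts_def)
    consider "i \<ge> 0" | "i = -1" | "i < -1" by linarith
    then show ?thesis
    proof cases
      case 1
      have del: "take k xs @ drop (Suc k) xs \<in> tuples (carrier G) (tate_len i)" if "k < length xs" for k
        using xs that 1 set_take_subset[of k xs] set_drop_subset[of "Suc k" xs]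
        by (auto simp: tuples_def tate_len_def)
      have "tate_d G M i (realize i F) xs
          = (\<Otimes>\<^bsub>M\<^esub>k\<in>{..<length xs}. eval_frag (frag_cmul ((-1) ^ k) (F (take k xs @ drop (Suc k) xs))))"
        using xs 1 del by (auto simp: tate_d_def R Fc eval_frag_cmul intro!: M.finprod_cong')
      also have "\<dots> = eval_frag (del_sum (\<lambda>_. F) xs)"
        unfolding del_sum_eq_sum by (rule eval_frag_sum[symmetric]) (simp add: frag_cmul_frags Fc del)
      finally show ?thesis using xs 1 by (simp add: realize_def lift_d_def)
    next
      case 2
      have sing: "[g] \<in> tuples (carrier G) (tate_len i)" if "g \<in> carrier G" for g
        using that 2 by (simp add: tuples_def tate_len_def)
      have "tate_d G M i (realize i F) xs = (\<Otimes>\<^bsub>M\<^esub>g\<in>carrier G. eval_frag (F [g]))"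
        using xs 2 sing by (auto simp: tate_d_def R[unfolded 2] Fc[unfolded 2] intro!: M.finprod_cong')
      also have "\<dots> = eval_frag (\<Sum>g\<in>carrier G. F [g])"
        by (rule eval_frag_sum[symmetric]) (simp add: Fc sing)
      finally show ?thesis using xs 2 by (simp add: realize_def lift_d_def tuples_def tate_len_def)
    next
      case 3
      have ins: "take k xs @ g # drop k xs \<in> tuples (carrier G) (tate_len i)"
        if "k \<le> length xs" "g \<in> carrier G" for k g
        using xs that 3 set_take_subset[of k xs] set_drop_subset[of k xs]
        by (auto simp: tuples_def tate_len_def)
      have Fi: "frag_cmul ((-1) ^ k) (F (take k xs @ g # drop k xs)) \<in> frags"
        if "k \<le> length xs" "g \<in> carrier G" for k g
        using ins that by (simp add: frag_cmul_frags Fc)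
      have inner: "(\<Otimes>\<^bsub>M\<^esub>k\<in>{..length xs}. realize i F (take k xs @ g # drop k xs) [^]\<^bsub>M\<^esub> ((-1) ^ k :: int))
          = eval_frag (ins_sum g F xs)" if g: "g \<in> carrier G" for g
      proof -
        have "(\<Otimes>\<^bsub>M\<^esub>k\<in>{..length xs}. realize i F (take k xs @ g # drop k xs) [^]\<^bsub>M\<^esub> ((-1) ^ k :: int))
          = (\<Otimes>\<^bsub>M\<^esub>k\<in>{..length xs}. eval_frag (frag_cmul ((-1) ^ k) (F (take k xs @ g # drop k xs))))"
          using ins g by (auto simp: R Fc eval_frag_cmul intro!: M.finprod_cong')
        also have "\<dots> = eval_frag (ins_sum g F xs)"
          unfolding ins_sum_eq_sum by (rule eval_frag_sum[symmetric]) (simp add: Fi g)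
        finally show ?thesis .
      qed
      have If: "ins_sum g F xs \<in> frags" if "g \<in> carrier G" for g
        unfolding ins_sum_eq_sum by (rule add_closed_sum[OF add_closed_frags]) (simp add: Fi that)
      have "tate_d G M i (realize i F) xs = (\<Otimes>\<^bsub>M\<^esub>g\<in>carrier G. eval_frag (ins_sum g F xs))"
        using xs 3 by (auto simp: tate_d_def inner If intro!: M.finprod_cong')
      also have "\<dots> = eval_frag (\<Sum>g\<in>carrier G. ins_sum g F xs)"
        by (rule eval_frag_sum[symmetric]) (simp add: If)
      finally show ?thesis using xs 3 by (simp add: realize_def lift_d_def)
    qed
  qed
qed

text \<open>Under \<open>vanishing\<close> the kernel and the image are both the set of realised
  cocycles, so the quotient has a single coset.\<close>

lemma trivial_tate_cohomology:
  assumes v: "vanishing i" shows "trivial_group (tate_cohomology G M act i)"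
proof -
  define U where "U = {F \<in> invariant_lifts i. lift_d i F \<in> null_lifts (i + 1)}"
  define Ker where "Ker = (tate_cochains G M act i)
       \<lparr>carrier := kernel (tate_cochains G M act i) (tate_cochains G M act (i + 1)) (tate_d G M i)\<rparr>"
  define B where "B = tate_d G M (i - 1) ` carrier (tate_cochains G M act (i - 1))"
  have H: "tate_cohomology G M act i = Ker Mod B" by (simp add: tate_cohomology_def Ker_def B_def)
  have inv_lifts: "F \<in> lifts k" if "F \<in> invariant_lifts k" for F k using that by (simp add: invariant_lifts_def)
  have closed_inv: "add_closed (invariant_lifts k)" for k
  proof -
    have "F - F' \<in> invariant_lifts k" if F: "F \<in> invariant_lifts k" "F' \<in> invariant_lifts k" for F F'
    proof -
      have "lift_act t (F - F') - (F - F') = (lift_act t F - F) - (lift_act t F' - F')"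
        by (simp add: additive.diff[OF additive_lift_act])
      also have "\<dots> \<in> null_lifts k"
        by (rule add_closed_diff[OF add_closed_null_lifts]) (use F in \<open>auto simp: invariant_lifts_def\<close>)
      finally show ?thesis using F add_closed_diff[OF add_closed_lifts] by (simp add: invariant_lifts_def)
    qed
    moreover have "0 \<in> invariant_lifts k"
      using add_closed_zero[OF add_closed_lifts] add_closed_zero[OF add_closed_null_lifts]
      by (simp add: invariant_lifts_def additive.zero[OF additive_lift_act])
    ultimately show ?thesis by (simp add: add_closed_def)
  qed
  have closed_U: "add_closed U"
    using closed_inv[of i] add_closed_null_lifts[of "i + 1"]
    by (auto simp: add_closed_def U_def additive.zero[OF additive_lift_d] additive.diff[OF additive_lift_d])
  have U_lifts: "F \<in> lifts i" if "F \<in> U" for F using that inv_lifts by (simp add: U_def)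
  have one: "\<one>\<^bsub>tate_cochains G M act k\<^esub> = realize k 0" for k
    by (simp add: tate_cochains_def realize_def zero_fun_def)
  have zero_lifts: "0 \<in> lifts k" for k by (rule add_closed_zero[OF add_closed_lifts])
  have ker_iff: "tate_d G M i (realize i F) = \<one>\<^bsub>tate_cochains G M act (i + 1)\<^esub> \<longleftrightarrow> lift_d i F \<in> null_lifts (i + 1)"
    if "F \<in> lifts i" for F
    using that realize_eq_iff[OF lift_d_lifts[OF that] zero_lifts] by (simp add: tate_d_realize one)
  have Ker: "carrier Ker = realize i ` U"
  proof (intro equalityI subsetI)
    fix f assume "f \<in> carrier Ker"
    then have f: "f \<in> carrier (tate_cochains G M act i)" "tate_d G M i f = \<one>\<^bsub>tate_cochains G M act (i + 1)\<^esub>"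
      by (auto simp: Ker_def kernel_def)
    note l = lift_of_cochain[OF f(1)]
    have "frag_of \<circ> f \<in> U" using l f(2) ker_iff[OF inv_lifts[OF l(1)]] by (simp add: U_def)
    then show "f \<in> realize i ` U" using l(2) by force
  next
    fix f assume "f \<in> realize i ` U"
    then show "f \<in> carrier Ker"
      using ker_iff U_lifts realize_closed by (auto simp: Ker_def kernel_def U_def)
  qed
  have B_eq: "B = realize i ` U"
  proof (intro equalityI subsetI)
    fix f assume "f \<in> B"
    then obtain h where h: "h \<in> carrier (tate_cochains G M act (i - 1))" "f = tate_d G M (i - 1) h"
      by (auto simp: B_def)
    define K where "K = frag_of \<circ> h"
    have K: "K \<in> invariant_lifts (i - 1)" "realize (i - 1) K = h"
      unfolding K_def by (rule lift_of_cochain[OF h(1)])+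
    have "lift_act t (lift_d (i - 1) K) - lift_d (i - 1) K = lift_d (i - 1) (lift_act t K - K)"
      by (simp add: lift_d_act additive.diff[OF additive_lift_d])
    then have "lift_d (i - 1) K \<in> U"
      using K(1) lift_d_lifts[of K "i - 1"] lift_d_null_lifts[of "lift_act t K - K" "i - 1"] lift_d_d[of "i - 1" K]
        add_closed_zero[OF add_closed_null_lifts]
      by (simp add: U_def invariant_lifts_def)
    moreover have "f = realize i (lift_d (i - 1) K)"
      using tate_d_realize[OF inv_lifts[OF K(1)]] K(2) h(2) by simp
    ultimately show "f \<in> realize i ` U" by blast
  next
    fix f assume "f \<in> realize i ` U"
    then obtain F where F: "F \<in> U" "f = realize i F" by blast
    then obtain K where K: "K \<in> lifts (i - 1)" "lift_act t K - K \<in> null_lifts (i - 1)" "F - lift_d (i - 1) K \<in> null_lifts i"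
      using v unfolding vanishing_def U_def invariant_lifts_def by blast
    have "f = realize i (lift_d (i - 1) K)"
      using realize_eq_iff[OF U_lifts[OF F(1)], of "lift_d (i - 1) K"] lift_d_lifts[OF K(1)] K(3) F(2) by simp
    also have "\<dots> = tate_d G M (i - 1) (realize (i - 1) K)" using tate_d_realize[OF K(1)] by simp
    finally show "f \<in> B" using realize_closed[of K "i - 1"] K by (auto simp: B_def invariant_lifts_def)
  qed
  have mult: "realize i F \<otimes>\<^bsub>Ker\<^esub> realize i F' = realize i (F + F')" if "F \<in> U" "F' \<in> U" for F F'
    using realize_add[OF U_lifts[OF that(1)] U_lifts[OF that(2)]] by (simp add: Ker_def)
  have coset: "B #>\<^bsub>Ker\<^esub> realize i F = B" if F: "F \<in> U" for F
  proof -
    have "B #>\<^bsub>Ker\<^esub> realize i F = (\<lambda>F'. realize i (F' + F)) ` U"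
      using mult[OF _ F] by (auto simp: r_coset_def B_eq)
    also have "\<dots> = realize i ` (\<lambda>F'. F' + F) ` U" by (simp add: image_image)
    also have "(\<lambda>F'. F' + F) ` U = U"
    proof (intro equalityI subsetI)
      fix x assume "x \<in> U"
      then have "x - F \<in> U" using F closed_U add_closed_diff by blast
      then show "x \<in> (\<lambda>F'. F' + F) ` U" by (rule rev_image_eqI) simp
    qed (use F closed_U add_closed_add in blast)
    finally show ?thesis by (simp add: B_eq)
  qed
  have car: "carrier (Ker Mod B) = {B}"
  proof -
    have "U \<noteq> {}" using add_closed_zero[OF closed_U] by blast
    then show ?thesis using coset by (auto simp: FactGroup_def RCOSETS_def Ker)
  qed
  have "B <#>\<^bsub>Ker\<^esub> B = (\<Union>F\<in>U. B #>\<^bsub>Ker\<^esub> realize i F)"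
    by (auto simp: set_mult_def r_coset_def B_eq)
  also have "\<dots> = B" using coset add_closed_zero[OF closed_U] by auto
  finally have II: "B <#>\<^bsub>Ker\<^esub> B = B" .
  have one_Mod: "\<one>\<^bsub>Ker Mod B\<^esub> = B" by (simp add: FactGroup_def)
  have "group (Ker Mod B)"
    by (rule groupI) (simp_all add: car II one_Mod)
  moreover note one_Mod
  ultimately show ?thesis by (simp add: H trivial_group_def car)
qed

lemma trivial_tate_cohomology_even: "tate0 frags rels (lact t) m \<Longrightarrow> even i \<Longrightarrow> trivial_group (tate_cohomology G M act i)"
  and trivial_tate_cohomology_odd: "tate1 frags rels (lact t) m \<Longrightarrow> odd i \<Longrightarrow> trivial_group (tate_cohomology G M act i)"
  using trivial_tate_cohomology vanishing_parity[OF vanishing_0, of i] vanishing_parity[OF vanishing_minus_1, of i]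
  by auto

end

section \<open>Lattices over a cyclic group of prime power order\<close>

lemma additive_frag_cmul:
  fixes f :: "('a \<Rightarrow>\<^sub>0 int) \<Rightarrow> ('b \<Rightarrow>\<^sub>0 int)"
  assumes "additive f" shows "f (frag_cmul k x) = frag_cmul k (f x)"
proof (induction k rule: int_induct[of _ 0])
  case base then show ?case by (simp add: additive.zero[OF assms])
next
  case (step1 i)
  then show ?case by (simp add: frag_cmul_distrib additive.add[OF assms])
next
  case (step2 i)
  then show ?case by (simp add: frag_cmul_diff_distrib additive.diff[OF assms])
qed

lemma add_closed_frag_cmul:
  assumes "add_closed S" "x \<in> S" shows "frag_cmul k x \<in> S"
proof (induction k rule: int_induct[of _ 0])
  case base then show ?case by (simp add: add_closed_zero[OF assms(1)])
next
  case (step1 i)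
  then show ?case using add_closed_add[OF assms(1)] assms(2) by (simp add: frag_cmul_distrib)
next
  case (step2 i)
  then show ?case using add_closed_diff[OF assms(1)] assms(2) by (simp add: frag_cmul_diff_distrib)
qed

lemma frag_cmul_sum_left: "frag_cmul (\<Sum>i\<in>I. k i) x = (\<Sum>i\<in>I. frag_cmul (k i) x)"
  by (induction I rule: infinite_finite_induct) (auto simp: frag_cmul_distrib)

lemma frag_cmul_diff_distrib2: "frag_cmul k (x - y) = frag_cmul k x - frag_cmul k y"
  using frag_cmul_distrib2[of k "x - y" y] by simp

text \<open>Induction on r with the binomial theorem: raising to the p-th power is additive modulo
  p.\<close>

lemma prime_dvd_diff_power:
  fixes a :: "'a::comm_ring_1"
  assumes "Factorial_Ring.prime p" shows "of_nat p dvd (a - 1) ^ (p ^ r) - (a ^ (p ^ r) - 1)"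
proof (induction r)
  case (Suc r)
  define b where "b = a ^ (p ^ r)"
  have "(a - 1) ^ (p ^ r) - (b - 1) dvd ((a - 1) ^ (p ^ r)) ^ p - (b - 1) ^ p"
    by (simp add: power_diff_sumr2)
  then have 1: "of_nat p dvd (a - 1) ^ (p ^ Suc r) - (b - 1) ^ p"
    using Suc by (metis b_def dvd_trans mult.commute power_Suc power_mult)
  have p0: "0 < p" using assms prime_gt_0_nat by blast
  have "(b + - 1) ^ p = (\<Sum>k\<le>p. of_nat (p choose k) * b ^ k * (- 1) ^ (p - k))"
    by (rule binomial_ring)
  also have "\<dots> = (\<Sum>k<p. of_nat (p choose k) * b ^ k * (- 1) ^ (p - k)) + b ^ p"
    by (simp add: lessThan_Suc_atMost[symmetric])
  also have "(\<Sum>k<p. of_nat (p choose k) * b ^ k * (- 1) ^ (p - k))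
      = (- 1) ^ p + (\<Sum>k\<in>{1..<p}. of_nat (p choose k) * b ^ k * (- 1) ^ (p - k))"
    using p0 by (simp add: lessThan_atLeast0 sum.atLeast_Suc_lessThan)
  finally have e: "(b - 1) ^ p - (b ^ p - 1) = (1 + (- 1) ^ p) + (\<Sum>k\<in>{1..<p}. of_nat (p choose k) * b ^ k * (- 1) ^ (p - k))"
    by simp
  have "(of_nat p :: 'a) dvd (\<Sum>k\<in>{1..<p}. of_nat (p choose k) * b ^ k * (- 1) ^ (p - k))"
  proof (rule dvd_sum)
    fix k assume "k \<in> {1..<p}"
    then have "p dvd (p choose k)" using assms by (intro dvd_choose_prime) auto
    then have "(of_nat p :: 'a) dvd of_nat (p choose k)" by (metis dvd_def of_nat_mult)
    then show "(of_nat p :: 'a) dvd of_nat (p choose k) * b ^ k * (- 1) ^ (p - k)" by simp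
  qed
  \<comment> \<open>The leftover sign term is 2 when p = 2 and 0 otherwise.\<close>
  moreover have "(of_nat p :: 'a) dvd 1 + (- 1) ^ p"
  proof (cases "p = 2")
    case True then show ?thesis by simp
  next
    case False
    then have "odd p" using assms primes_dvd_imp_eq two_is_prime_nat by blast
    then show ?thesis by simp
  qed
  ultimately have "of_nat p dvd (b - 1) ^ p - (b ^ p - 1)" unfolding e by (rule dvd_add[rotated])
  then have "of_nat p dvd ((a - 1) ^ (p ^ Suc r) - (b - 1) ^ p) + ((b - 1) ^ p - (b ^ p - 1))"
    using 1 by (rule dvd_add[rotated])
  moreover have "((a - 1) ^ (p ^ Suc r) - (b - 1) ^ p) + ((b - 1) ^ p - (b ^ p - 1)) = (a - 1) ^ (p ^ Suc r) - (b ^ p - 1)"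
    by simp
  moreover have "b ^ p = a ^ (p ^ Suc r)" by (simp add: b_def mult.commute flip: power_mult)
  ultimately show ?case by (simp only:)
qed simp

text \<open>Nakayama's lemma for the localisation of a finitely generated abelian group at \<open>p\<close>.\<close>

lemma prime_to_p_multiple:
  fixes H :: "('a \<Rightarrow>\<^sub>0 int) set"
  assumes "Factorial_Ring.prime (p::int)" and "finite Y" and H: "add_closed H"
    and "\<And>c h. h \<in> H \<Longrightarrow> \<exists>c' h' k. h' \<in> H \<and> k \<in> H \<and>
      (\<Sum>y\<in>Y. frag_cmul (c y) y) + h = k + frag_cmul p ((\<Sum>y\<in>Y. frag_cmul (c' y) y) + h')"
  shows "\<exists>q. coprime q p \<and> (\<forall>y\<in>Y. frag_cmul q y \<in> H)"
  using assms(2,4)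
proof (induction Y)
  case empty
  show ?case by (intro exI[of _ 1]) simp
next
  case (insert y Y)
  let ?S = "\<lambda>c. \<Sum>y\<in>Y. frag_cmul (c y) y"
  have sumI: "(\<Sum>y\<in>insert y Y. frag_cmul (c y) y) = frag_cmul (c y) y + ?S c" for c
    using insert.hyps by simp
  have S_upd: "?S (c(y := a)) = ?S c" for c a
    using insert.hyps by (intro sum.cong) auto
  note cm = frag_cmul_distrib frag_cmul_distrib2 frag_cmul_diff_distrib frag_cmul_diff_distrib2
  have S_lin: "frag_cmul a (?S c) + frag_cmul b (?S c') = ?S (\<lambda>z. a * c z + b * c' z)" for a b c c'
    by (simp add: frag_cmul_sum sum.distrib cm)
  have S1: "(\<Sum>z\<in>Y. frag_cmul (if z = y then 1 else 0) z) = 0"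
    using insert.hyps by (intro sum.neutral) auto
  have S0: "(\<Sum>z\<in>Y. frag_cmul (if z = y then 0 else c z) z) = ?S c" for c
    using insert.hyps by (intro sum.cong) auto
  \<comment> \<open>Apply the hypothesis to y itself. Moving the y-term of the right-hand side to
    the left multiplies y by 1 - p c1(y), which is prime to p.\<close>
  obtain c1 h1 k1 where 1: "h1 \<in> H" "k1 \<in> H"
    "y = k1 + frag_cmul p (frag_cmul (c1 y) y + ?S c1 + h1)"
    using insert.prems[of 0 "(\<lambda>_. 0)(y := 1)"] add_closed_zero[OF H] by (auto simp: sumI S_upd S1 S0)
  define q where "q = 1 - p * c1 y"
  have qp: "coprime q p"
  proof (rule coprimeI)
    fix d assume "d dvd q" "d dvd p"
    then have "d dvd q + p * c1 y" by (intro dvd_add) auto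
    then show "is_unit d" by (simp add: q_def)
  qed
  have qy: "frag_cmul q y = k1 + frag_cmul p (?S c1 + h1)"
  proof -
    have "frag_cmul q y = y - frag_cmul p (frag_cmul (c1 y) y)" by (simp add: q_def cm)
    also have "\<dots> = k1 + frag_cmul p (?S c1 + h1)"
      by (subst (1) 1(3)) (simp add: cm algebra_simps)
    finally show ?thesis .
  qed
  have "\<exists>c' h' k. h' \<in> H \<and> k \<in> H \<and> ?S c + h = k + frag_cmul p (?S c' + h')" if h: "h \<in> H" for c h
  proof -
    obtain c2 h2 k2 where 2: "h2 \<in> H" "k2 \<in> H"
      "?S c + h = k2 + frag_cmul p (frag_cmul (c2 y) y + ?S c2 + h2)"
      using insert.prems[OF h, of "c(y := 0)"] by (auto simp: sumI S_upd S1 S0)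
    \<comment> \<open>multiply by \<open>q = 1 - p c\<^sub>1(y)\<close>, which eliminates \<open>y\<close>, and absorb the defect into the \<open>p\<close>-multiple\<close>
    have "?S c + h = frag_cmul q (?S c + h) + frag_cmul (p * c1 y) (?S c + h)"
      by (simp add: q_def flip: frag_cmul_distrib)
    also have "frag_cmul q (?S c + h)
        = frag_cmul q k2 + frag_cmul p (frag_cmul (c2 y) (frag_cmul q y) + frag_cmul q (?S c2 + h2))"
      by (subst 2(3)) (simp add: cm mult.commute algebra_simps)
    also have "\<dots> + frag_cmul (p * c1 y) (?S c + h) = frag_cmul q k2 +
        frag_cmul p ((frag_cmul 1 (frag_cmul q (?S c2) + frag_cmul (c1 y) (?S c)) + frag_cmul (c2 y * p) (?S c1))
          + (frag_cmul (c2 y) (k1 + frag_cmul p h1) + frag_cmul q h2 + frag_cmul (c1 y) h))"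
      unfolding qy by (simp add: cm algebra_simps)
    finally show ?thesis
      unfolding S_lin
      using 1 2 h by (intro exI conjI) (auto intro!: add_closed_add add_closed_frag_cmul H)
  qed
  then obtain q' where q': "coprime q' p" "\<And>y. y \<in> Y \<Longrightarrow> frag_cmul q' y \<in> H" using insert.IH by blast
  have "frag_cmul (q' * q) y = frag_cmul q' k1 + frag_cmul p ((\<Sum>z\<in>Y. frag_cmul (c1 z) (frag_cmul q' z)) + frag_cmul q' h1)"
  proof -
    have "frag_cmul (q' * q) y = frag_cmul q' (frag_cmul q y)" by simp
    then show ?thesis unfolding qy by (simp add: cm frag_cmul_sum mult.commute mult.left_commute)
  qed
  also have "\<dots> \<in> H"
  proof -
    have "(\<Sum>z\<in>Y. frag_cmul (c1 z) (frag_cmul q' z)) \<in> H"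
      by (rule add_closed_sum[OF H], rule add_closed_frag_cmul[OF H], rule q'(2))
    then show ?thesis by (intro add_closed_add[OF H] add_closed_frag_cmul[OF H] 1)
  qed
  finally have "frag_cmul (q' * q) y \<in> H" .
  moreover have "frag_cmul (q' * q) z \<in> H" if "z \<in> Y" for z
    using add_closed_frag_cmul[OF H q'(2)[OF that], of q] by (simp add: mult.commute)
  ultimately show ?case using qp q' by (intro exI[of _ "q' * q"]) auto
qed

section \<open>Polynomials in an operator, and lattices over the cyclotomic ring\<close>

definition poly_act :: "(('f \<Rightarrow>\<^sub>0 int) \<Rightarrow> ('f \<Rightarrow>\<^sub>0 int)) \<Rightarrow> int poly \<Rightarrow> ('f \<Rightarrow>\<^sub>0 int) \<Rightarrow> ('f \<Rightarrow>\<^sub>0 int)" where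
  "poly_act s c v = fold_coeffs (\<lambda>a w. frag_cmul a v + s w) c 0"

locale frag_operator =
  fixes s :: "('f \<Rightarrow>\<^sub>0 int) \<Rightarrow> ('f \<Rightarrow>\<^sub>0 int)"
  assumes s: "additive s"
begin

abbreviation "pa \<equiv> poly_act s"

lemma pa_0 [simp]: "pa 0 v = 0"
  by (simp add: poly_act_def)

lemma pa_pCons [simp]: "pa (pCons a c) v = frag_cmul a v + s (pa c v)"
  by (cases "a = 0 \<and> c = 0") (auto simp: poly_act_def additive.zero[OF s])

lemma pa_add: "pa (c + d) v = pa c v + pa d v"
proof (induction c d rule: poly_induct2)
  case (pCons a c b d)
  then show ?case by (simp add: additive.add[OF s] frag_cmul_distrib algebra_simps)
qed simp

lemma pa_smult: "pa (smult k c) v = frag_cmul k (pa c v)"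
  by (induction c) (auto simp: additive_frag_cmul[OF s] frag_cmul_distrib2)

lemma pa_minus: "pa (- c) v = - pa c v"
  using pa_smult[of "-1" c v] by simp

lemma pa_diff: "pa (c - d) v = pa c v - pa d v"
  using pa_add[of c "- d" v] by (simp add: pa_minus)

lemma pa_mult: "pa (c * d) v = pa c (pa d v)"
  by (induction c) (auto simp: pa_add pa_smult)

lemma additive_pa: "additive (pa c)"
proof -
  have "pa c (v + w) = pa c v + pa c w" for v w
    by (induction c) (auto simp: additive.add[OF s] frag_cmul_distrib2)
  then show ?thesis by (simp add: additive_def)
qed

lemma pa_1 [simp]: "pa 1 v = v"
  by (simp add: one_pCons additive.zero[OF s] del: one_poly_eq_simps)

lemma pa_monom: "pa (Polynomial.monom 1 k) v = (s ^^ k) v"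
  by (induction k) (auto simp: monom_Suc monom_0 additive.zero[OF s])

lemma pa_sum: "pa (\<Sum>i\<in>I. c i) v = (\<Sum>i\<in>I. pa (c i) v)"
  by (induction I rule: infinite_finite_induct) (auto simp: pa_add)

lemma pa_of_nat: "pa (of_nat k) v = frag_cmul (int k) v"
  by (simp add: of_nat_poly additive.zero[OF s])

lemma pa_closed:
  assumes "add_closed V" "\<And>v. v \<in> V \<Longrightarrow> s v \<in> V" "v \<in> V" shows "pa c v \<in> V"
  by (induction c) (auto simp: add_closed_zero[OF assms(1)] assms intro!: add_closed_add add_closed_frag_cmul)

lemma pa_eq_sum:
  assumes "\<And>i. N \<le> i \<Longrightarrow> Polynomial.coeff c i = 0"
  shows "pa c v = (\<Sum>i<N. frag_cmul (Polynomial.coeff c i) ((s ^^ i) v))"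
  using assms
proof (induction c arbitrary: N)
  case (pCons a c)
  show ?case
  proof (cases N)
    case 0
    then have "pCons a c = 0" using pCons.prems by (intro poly_eqI) simp
    then show ?thesis using 0 by (simp del: pCons_eq_0_iff pa_pCons)
  next
    case (Suc M)
    have "Polynomial.coeff c i = 0" if "M \<le> i" for i using pCons.prems[of "Suc i"] Suc that by simp
    then have "pa c v = (\<Sum>i<M. frag_cmul (Polynomial.coeff c i) ((s ^^ i) v))" by (rule pCons.IH)
    then show ?thesis
      unfolding Suc sum.lessThan_Suc_shift by (simp add: additive.sum[OF s] additive_frag_cmul[OF s])
  qed
qed simp

end

text \<open>The lattice is \<open>\<int>\<^sup>B\<close>, and P = p^(r+1) is a period of s.
  \<open>s_cyclotomic\<close> makes it a module over \<open>\<int>[X]/\<Phi>\<close>, and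
  \<open>s_fixed\<close> makes X - 1 act injectively.\<close>

locale prime_power_lattice = frag_operator s for s :: "('f \<Rightarrow>\<^sub>0 int) \<Rightarrow> ('f \<Rightarrow>\<^sub>0 int)" +
  fixes B :: "'f set" and p r P P' :: nat
  assumes finite_B: "finite B" and s_B: "Poly_Mapping.keys v \<subseteq> B \<Longrightarrow> Poly_Mapping.keys (s v) \<subseteq> B"
    and prime_p: "Factorial_Ring.prime p" and P: "P = p ^ Suc r" and P': "P' = p ^ r"
    and s_P: "Poly_Mapping.keys v \<subseteq> B \<Longrightarrow> (s ^^ P) v = v"
    and s_fixed: "Poly_Mapping.keys v \<subseteq> B \<Longrightarrow> s v = v \<Longrightarrow> v = 0"
    and s_cyclotomic: "Poly_Mapping.keys v \<subseteq> B \<Longrightarrow> (\<Sum>b<p. (s ^^ (b * P')) v) = 0"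
begin

definition "V = {v. Poly_Mapping.keys v \<subseteq> B}"

text \<open>The cyclotomic polynomial of index P = p^(r+1), monic of degree \<open>cyc_deg\<close>,
  the Euler totient of P.\<close>

definition "\<Phi> = (\<Sum>b<p. Polynomial.monom (1::int) (b * P'))"

definition "\<pi> = [:-1, 1::int:]"

definition "cyc_deg = (p - 1) * P'"

lemma V: "add_closed V"
  unfolding add_closed_def V_def using keys_diff by fastforce

lemma s_V: "v \<in> V \<Longrightarrow> s v \<in> V"
  by (simp add: V_def s_B)

lemma pa_V: "v \<in> V \<Longrightarrow> pa c v \<in> V"
  by (rule pa_closed[OF V s_V])

lemma p_pos: "0 < p" "1 < p"
  using prime_gt_1_nat[OF prime_p] by auto

lemma P'_pos: "0 < P'"
  using p_pos by (simp add: P')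

lemma P_eq: "P = p * P'" "P = cyc_deg + P'"
proof -
  show "P = p * P'" by (simp add: P P')
  then show "P = cyc_deg + P'" using p_pos unfolding cyc_deg_def by (cases p) auto
qed

lemma pa_\<pi>: "pa \<pi> v = s v - v"
  by (simp add: \<pi>_def additive.zero[OF s])

lemma pa_\<Phi>: "v \<in> V \<Longrightarrow> pa \<Phi> v = 0"
  using s_cyclotomic by (simp add: V_def \<Phi>_def pa_sum pa_monom)

lemma coeff_\<Phi>: "Polynomial.coeff \<Phi> i = (if P' dvd i \<and> i \<le> cyc_deg then 1 else 0)"
proof -
  have "Polynomial.coeff \<Phi> i = (\<Sum>b<p. if b * P' = i then 1 else 0)"
    by (simp add: \<Phi>_def coeff_sum)
  also have "\<dots> = (\<Sum>b<p. if P' dvd i \<and> b = i div P' then 1 else 0)"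
    using P'_pos by (intro sum.cong) auto
  also have "\<dots> = (if P' dvd i \<and> i div P' < p then 1 else 0)" by (cases "P' dvd i") simp_all
  also have "P' dvd i \<and> i div P' < p \<longleftrightarrow> P' dvd i \<and> i \<le> cyc_deg"
  proof (intro conj_cong refl)
    assume "P' dvd i"
    then obtain b where "i = b * P'" by (metis dvdE mult.commute)
    then show "i div P' < p \<longleftrightarrow> i \<le> cyc_deg" using P'_pos p_pos by (simp add: cyc_deg_def) linarith
  qed
  finally show ?thesis .
qed

lemma coeff_\<Phi>_cyc_deg: "Polynomial.coeff \<Phi> cyc_deg = 1" "cyc_deg < i \<Longrightarrow> Polynomial.coeff \<Phi> i = 0"
  by (auto simp: coeff_\<Phi> cyc_deg_def)

lemma poly_\<Phi>_1: "poly \<Phi> 1 = int p"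
  by (simp add: \<Phi>_def poly_sum poly_monom)

lemma \<pi>_dvd_iff: "\<pi> dvd c \<longleftrightarrow> poly c 1 = 0"
  using poly_eq_0_iff_dvd[of c 1] by (simp add: \<pi>_def)

text \<open>Since \<Phi>(1) = p, the polynomial X - 1 divides \<Phi> - p, and \<Phi> acts as
  zero.\<close>

lemma p_multiple: "v \<in> V \<Longrightarrow> \<exists>w\<in>V. frag_cmul (int p) v = s w - w"
proof -
  assume v: "v \<in> V"
  have "\<pi> dvd \<Phi> - of_nat p" by (simp add: \<pi>_dvd_iff poly_\<Phi>_1)
  then obtain \<Psi> where "\<Phi> - of_nat p = \<pi> * \<Psi>" by (rule dvdE)
  then have "pa \<Phi> v - pa (of_nat p) v = pa \<pi> (pa \<Psi> v)" by (simp flip: pa_diff pa_mult)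
  then have "frag_cmul (int p) v = - pa \<pi> (pa \<Psi> v)"
    unfolding pa_\<Phi>[OF v] pa_of_nat by (metis diff_0 minus_minus)
  also have "\<dots> = s (- pa \<Psi> v) - (- pa \<Psi> v)" by (simp add: pa_\<pi> additive.minus[OF s])
  finally show ?thesis using v pa_V add_closed_minus[OF V] by blast
qed

text \<open>Modulo p, (X - 1)^P is X^P - 1, a multiple of \<Phi>. Hence (s - 1)^P maps V into p
  V.\<close>

lemma \<pi>_power: "\<exists>A C. \<pi> ^ P = \<Phi> * A + of_nat p * C"
proof -
  let ?x = "Polynomial.monom (1::int) 1"
  have \<pi>_eq: "\<pi> = ?x - 1" by (simp add: \<pi>_def monom_Suc monom_0 one_pCons)
  have "of_nat p dvd \<pi> ^ P - (?x ^ P - 1)" unfolding P \<pi>_eq by (rule prime_dvd_diff_power[OF prime_p])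
  then obtain C where C: "\<pi> ^ P = ?x ^ P - 1 + of_nat p * C" by (auto simp: dvd_def algebra_simps)
  have "\<Phi> = (\<Sum>b<p. (?x ^ P') ^ b)" by (simp add: \<Phi>_def monom_power mult.commute)
  then have "(?x ^ P') ^ p - 1 = (?x ^ P' - 1) * \<Phi>" by (simp only: power_diff_1_eq)
  then have "?x ^ P - 1 = \<Phi> * (?x ^ P' - 1)" by (simp add: P_eq(1) mult.commute flip: power_mult)
  then show ?thesis using C by metis
qed

lemma s_inj: "v \<in> V \<Longrightarrow> w \<in> V \<Longrightarrow> s v - v = s w - w \<Longrightarrow> v = w"
proof -
  assume vw: "v \<in> V" "w \<in> V" "s v - v = s w - w"
  then have "s (v - w) = v - w" by (simp add: additive.diff[OF s] algebra_simps)
  moreover have "v - w \<in> V" using vw add_closed_diff[OF V] by blast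
  ultimately have "v - w = 0" using s_fixed[of "v - w"] unfolding V_def by blast
  then show ?thesis by simp
qed

definition spanning :: "('f \<Rightarrow>\<^sub>0 int) set \<Rightarrow> bool" where
  "spanning Y \<longleftrightarrow> finite Y \<and> Y \<subseteq> V \<and>
     (\<forall>v\<in>V. \<exists>c. \<exists>w\<in>V. v = (\<Sum>y\<in>Y. frag_cmul (c y) y) + (s w - w))"

lemma basis_expansion: "v \<in> V \<Longrightarrow> v = (\<Sum>y\<in>frag_of ` B. frag_cmul (Poly_Mapping.lookup v (inv_into UNIV frag_of y)) y)"
proof -
  assume "v \<in> V"
  have inj: "inj frag_of" by (rule injI) (simp add: frag_of_eq)
  have "(\<Sum>y\<in>frag_of ` B. frag_cmul (Poly_Mapping.lookup v (inv_into UNIV frag_of y)) y)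
      = (\<Sum>b\<in>B. frag_cmul (Poly_Mapping.lookup v b) (frag_of b))"
    by (subst sum.reindex) (auto intro: inj_on_subset[OF inj] simp: inv_f_f[OF inj])
  also have "\<dots> = (\<Sum>b\<in>Poly_Mapping.keys v. frag_cmul (Poly_Mapping.lookup v b) (frag_of b))"
    using \<open>v \<in> V\<close> finite_B by (intro sum.mono_neutral_right) (auto simp: V_def in_keys_iff)
  also have "\<dots> = v" using frag_expansion[of v] by (simp add: frag_extend_def)
  finally show ?thesis ..
qed

lemma spanning_exists: "\<exists>Y. spanning Y"
proof -
  have "\<exists>c. \<exists>w\<in>V. v = (\<Sum>y\<in>frag_of ` B. frag_cmul (c y) y) + (s w - w)" if "v \<in> V" for v
    using basis_expansion[OF that] add_closed_zero[OF V] additive.zero[OF s]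
    by (intro exI[of _ "\<lambda>y. Poly_Mapping.lookup v (inv_into UNIV frag_of y)"] bexI[of _ 0]) auto
  then have "spanning (frag_of ` B)" using finite_B by (auto simp: spanning_def V_def)
  then show ?thesis by blast
qed

definition "Y = arg_min card spanning"

lemma Y: "spanning Y" "spanning Z \<Longrightarrow> card Y \<le> card Z"
proof -
  obtain Z where Z: "spanning Z" using spanning_exists by blast
  show "spanning Y" unfolding Y_def using Z by (rule arg_min_natI)
  show "spanning Z \<Longrightarrow> card Y \<le> card Z" for Z unfolding Y_def by (rule arg_min_nat_le)
qed

lemma finite_Y: "finite Y" and Y_V: "y \<in> Y \<Longrightarrow> y \<in> V"
  using Y(1) by (auto simp: spanning_def)

text \<open>Minimality makes \<open>Y\<close> a basis of the \<open>\<int>/p\<close>-vector space \<open>V / (s - 1) V\<close>.\<close>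

lemma Y_independent:
  assumes "(\<Sum>y\<in>Y. frag_cmul (c y) y) = s w - w" "w \<in> V" "y \<in> Y" shows "int p dvd c y"
proof (rule ccontr)
  assume "\<not> int p dvd c y"
  \<comment> \<open>Bezout, together with p V contained in (s - 1) V, expresses y through the other
    generators modulo s - 1, against minimality.\<close>
  then have "coprime (int p) (c y)" using prime_p by (intro prime_imp_coprime) auto
  then obtain a b where ab: "a * c y + b * int p = 1" by (metis bezout_int coprime_commute coprime_iff_gcd_eq_1)
  note cm = frag_cmul_distrib frag_cmul_distrib2 frag_cmul_diff_distrib frag_cmul_diff_distrib2
  obtain w1 where w1: "w1 \<in> V" "frag_cmul (int p) y = s w1 - w1" using p_multiple Y_V assms by blast
  define w2 where "w2 = frag_cmul a w + frag_cmul b w1"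
  have w2: "w2 \<in> V" unfolding w2_def using assms w1 by (intro add_closed_add add_closed_frag_cmul V)
  let ?Z = "Y - {y}"
  have split: "(\<Sum>x\<in>Y. frag_cmul (d x) x) = frag_cmul (d y) y + (\<Sum>x\<in>?Z. frag_cmul (d x) x)" for d
    using finite_Y assms(3) by (rule sum.remove)
  have "y = frag_cmul (a * c y) y + frag_cmul (b * int p) y" by (simp add: ab flip: frag_cmul_distrib)
  also have "frag_cmul (a * c y) y = frag_cmul a (s w - w) - frag_cmul a (\<Sum>x\<in>?Z. frag_cmul (c x) x)"
    unfolding assms(1)[symmetric] split by (simp add: cm)
  also have "frag_cmul (b * int p) y = frag_cmul b (s w1 - w1)" unfolding w1(2)[symmetric] by simp
  also have "frag_cmul a (s w - w) - frag_cmul a (\<Sum>x\<in>?Z. frag_cmul (c x) x) + frag_cmul b (s w1 - w1)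
      = (s w2 - w2) - (\<Sum>x\<in>?Z. frag_cmul (a * c x) x)"
    by (simp add: w2_def additive.add[OF s] additive_frag_cmul[OF s] cm frag_cmul_sum algebra_simps)
  finally have y: "y = (s w2 - w2) - (\<Sum>x\<in>?Z. frag_cmul (a * c x) x)" .
  have "spanning ?Z" unfolding spanning_def
  proof (intro conjI ballI)
    fix v :: "'f \<Rightarrow>\<^sub>0 int" assume "v \<in> V"
    then obtain d w' where d: "w' \<in> V" "v = (\<Sum>x\<in>Y. frag_cmul (d x) x) + (s w' - w')"
      using Y(1) unfolding spanning_def by blast
    define w'' where "w'' = frag_cmul (d y) w2 + w'"
    have "v = (\<Sum>x\<in>?Z. frag_cmul (d x - d y * (a * c x)) x) + (s w'' - w'')"
    proof -
      have "frag_cmul (d y) y = frag_cmul (d y) (s w2 - w2) - (\<Sum>x\<in>?Z. frag_cmul (d y * (a * c x)) x)"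
        by (subst y) (simp add: cm frag_cmul_sum)
      then show ?thesis
        unfolding d(2) split w''_def
        by (simp add: additive.add[OF s] additive_frag_cmul[OF s] cm sum_subtractf algebra_simps)
    qed
    moreover have "w'' \<in> V" unfolding w''_def using w2 d by (intro add_closed_add add_closed_frag_cmul V)
    ultimately show "\<exists>c. \<exists>w\<in>V. v = (\<Sum>x\<in>?Z. frag_cmul (c x) x) + (s w - w)"
      by (intro exI[of _ "\<lambda>x. d x - d y * (a * c x)"] bexI[of _ w''])
  qed (use finite_Y Y_V in auto)
  then have "card Y \<le> card ?Z" by (rule Y(2))
  then show False using finite_Y assms(3) by (metis card_Diff1_less leD)
qed

section \<open>Freeness over the cyclotomic ring up to an index prime to p\<close>

definition "comb cs = (\<Sum>y\<in>Y. pa (cs y) y)"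

lemma comb_add: "comb (\<lambda>y. cs y + ds y) = comb cs + comb ds"
  by (simp add: comb_def pa_add sum.distrib)

lemma comb_diff: "comb (\<lambda>y. cs y - ds y) = comb cs - comb ds"
  by (simp add: comb_def pa_diff sum_subtractf)

lemma comb_mult: "comb (\<lambda>y. c * cs y) = pa c (comb cs)"
  by (simp add: comb_def pa_mult additive.sum[OF additive_pa])

lemma comb_smult: "comb (\<lambda>y. smult k (cs y)) = frag_cmul k (comb cs)"
  by (simp add: comb_def pa_smult frag_cmul_sum)

lemma comb_const: "comb (\<lambda>y. [:c y:]) = (\<Sum>y\<in>Y. frag_cmul (c y) y)"
  by (simp add: comb_def additive.zero[OF s])

lemma comb_cong: "(\<And>y. y \<in> Y \<Longrightarrow> cs y = ds y) \<Longrightarrow> comb cs = comb ds"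
  by (simp add: comb_def)

lemma comb_V: "comb cs \<in> V"
  unfolding comb_def by (intro add_closed_sum[OF V] pa_V Y_V)

lemma comb_\<Phi>: "comb (\<lambda>y. \<Phi> * cs y) = 0"
  by (simp add: comb_mult pa_\<Phi> comb_V)

text \<open>Expand the remainder w in the same way, e times over.\<close>

lemma span_mod_\<pi>: "v \<in> V \<Longrightarrow> \<exists>cs. \<exists>w\<in>V. v = comb cs + pa (\<pi> ^ e) w"
proof (induction e)
  case 0
  have "comb (\<lambda>_. 0) = 0" by (simp add: comb_def)
  then show ?case using 0 by (intro exI[of _ "\<lambda>_. 0"] bexI[of _ v]) auto
next
  case (Suc e)
  then obtain cs w where w: "w \<in> V" "v = comb cs + pa (\<pi> ^ e) w" by blast
  obtain c w' where w': "w' \<in> V" "w = (\<Sum>y\<in>Y. frag_cmul (c y) y) + (s w' - w')"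
    using Y(1) w(1) unfolding spanning_def by blast
  have "v = comb (\<lambda>y. cs y + \<pi> ^ e * [:c y:]) + pa (\<pi> ^ Suc e) w'"
    unfolding w(2) w'(2) comb_add comb_mult comb_const power_Suc2 pa_mult pa_\<pi>
    by (simp add: additive.add[OF additive_pa])
  then show ?case using w'(1) by blast
qed

lemma add_closed_range_comb: "add_closed (range comb)"
proof -
  have "comb (\<lambda>_. 0) = 0" by (simp add: comb_def)
  then have "0 \<in> range comb" by (metis rangeI)
  then show ?thesis unfolding add_closed_def by (auto simp flip: comb_diff)
qed

text \<open>With e = P the remainder lies in p V, so V is the image of \<open>comb\<close> plus p V,
  and Nakayama applies.\<close>

lemma prime_to_p_span: "\<exists>q. coprime q (int p) \<and> (\<forall>v\<in>V. frag_cmul q v \<in> range comb)"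
proof -
  let ?E = "frag_of ` B"
  let ?c = "\<lambda>v y. Poly_Mapping.lookup v (inv_into UNIV frag_of y)"
  have E: "\<exists>c' h' k. h' \<in> range comb \<and> k \<in> range comb \<and>
      (\<Sum>y\<in>?E. frag_cmul (c y) y) + h = k + frag_cmul (int p) ((\<Sum>y\<in>?E. frag_cmul (c' y) y) + h')"
    if h: "h \<in> range comb" for c h
  proof -
    have "(\<Sum>y\<in>?E. frag_cmul (c y) y) + h \<in> V"
      using h comb_V by (intro add_closed_add[OF V] add_closed_sum[OF V] add_closed_frag_cmul[OF V]) (auto simp: V_def)
    then obtain cs w where w: "w \<in> V" "(\<Sum>y\<in>?E. frag_cmul (c y) y) + h = comb cs + pa (\<pi> ^ P) w"
      using span_mod_\<pi> by blast
    obtain A C where "\<pi> ^ P = \<Phi> * A + of_nat p * C" using \<pi>_power by blast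
    then have "pa (\<pi> ^ P) w = frag_cmul (int p) (pa C w)"
      using w(1) by (simp add: pa_add pa_mult pa_\<Phi> pa_V pa_of_nat)
    then have "(\<Sum>y\<in>?E. frag_cmul (c y) y) + h = comb cs + frag_cmul (int p) ((\<Sum>y\<in>?E. frag_cmul (?c (pa C w) y) y) + 0)"
      using w basis_expansion[OF pa_V[OF w(1)], of C] by simp
    then show ?thesis using add_closed_zero[OF add_closed_range_comb]
      by (intro exI[of _ "?c (pa C w)"] exI[of _ 0] exI[of _ "comb cs"] conjI rangeI)
  qed
  have "\<exists>q. coprime q (int p) \<and> (\<forall>y\<in>?E. frag_cmul q y \<in> range comb)"
    by (rule prime_to_p_multiple) (use prime_p finite_B add_closed_range_comb E in auto)
  then obtain q where q: "coprime q (int p)" "\<And>y. y \<in> ?E \<Longrightarrow> frag_cmul q y \<in> range comb" by blast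
  have "frag_cmul q v \<in> range comb" if "v \<in> V" for v
  proof -
    have "frag_cmul q v = (\<Sum>y\<in>?E. frag_cmul (?c v y) (frag_cmul q y))"
      using arg_cong[OF basis_expansion[OF that], of "frag_cmul q"] by (simp add: frag_cmul_sum mult.commute)
    also have "\<dots> \<in> range comb"
      by (intro add_closed_sum[OF add_closed_range_comb] add_closed_frag_cmul[OF add_closed_range_comb] q)
    finally show ?thesis .
  qed
  then show ?thesis using q(1) by blast
qed

text \<open>Modulo X - 1 the relation has integer coefficients, divisible by p by independence of Y,
  and p can be exchanged for \<Phi>, which contributes nothing. What remains is X - 1 applied to a
  relation, and s - 1 is injective.\<close>

lemma peel:
  assumes "comb cs = 0"
  shows "\<exists>ds As. (\<forall>y\<in>Y. cs y = \<pi> * ds y + \<Phi> * As y) \<and> comb ds = 0"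
proof -
  have "\<exists>d. cs y - [:poly (cs y) 1:] = \<pi> * d" for y
    using \<pi>_dvd_iff[of "cs y - [:poly (cs y) 1:]"] by (auto simp: dvd_def)
  then obtain d where d: "\<And>y. cs y - [:poly (cs y) 1:] = \<pi> * d y" by metis
  have "comb cs - (\<Sum>y\<in>Y. frag_cmul (poly (cs y) 1) y) = pa \<pi> (comb d)"
    unfolding comb_const[symmetric] comb_diff[symmetric] comb_mult[symmetric] d ..
  then have "(\<Sum>y\<in>Y. frag_cmul (poly (cs y) 1) y) = s (- comb d) - (- comb d)"
    unfolding assms pa_\<pi> additive.minus[OF s] by (simp add: algebra_simps)
  then have "int p dvd poly (cs y) 1" if "y \<in> Y" for y
    using Y_independent[of "\<lambda>y. poly (cs y) 1"] add_closed_minus[OF V comb_V] that by blast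
  then obtain b where b: "\<And>y. y \<in> Y \<Longrightarrow> poly (cs y) 1 = int p * b y" unfolding dvd_def by metis
  have "\<exists>e. cs y - \<Phi> * [:b y:] = \<pi> * e" if "y \<in> Y" for y
    using \<pi>_dvd_iff[of "cs y - \<Phi> * [:b y:]"] b[OF that] by (auto simp: dvd_def poly_\<Phi>_1)
  then obtain e where e: "\<And>y. y \<in> Y \<Longrightarrow> cs y - \<Phi> * [:b y:] = \<pi> * e y" by metis
  have "comb cs - comb (\<lambda>y. \<Phi> * [:b y:]) = comb (\<lambda>y. \<pi> * e y)"
    unfolding comb_diff[symmetric] by (rule comb_cong) (rule e)
  then have "s (comb e) - comb e = s 0 - 0"
    unfolding comb_\<Phi> assms comb_mult pa_\<pi> additive.zero[OF s] by simp
  then have "comb e = 0" by (rule s_inj[OF comb_V add_closed_zero[OF V]])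
  moreover have "cs y = \<pi> * e y + \<Phi> * [:b y:]" if "y \<in> Y" for y using e[OF that] by (simp add: diff_eq_eq)
  ultimately show ?thesis by (intro exI[of _ e] exI[of _ "\<lambda>y. [:b y:]"]) auto
qed

lemma peel_power:
  assumes "comb cs = 0"
  shows "\<exists>ds As. (\<forall>y\<in>Y. cs y = \<pi> ^ e * ds y + \<Phi> * As y) \<and> comb ds = 0"
proof (induction e)
  case 0
  show ?case using assms by (intro exI[of _ cs] exI[of _ "\<lambda>_. 0"]) simp
next
  case (Suc e)
  then obtain ds As where 1: "\<And>y. y \<in> Y \<Longrightarrow> cs y = \<pi> ^ e * ds y + \<Phi> * As y" "comb ds = 0" by blast
  obtain ds' As' where 2: "\<And>y. y \<in> Y \<Longrightarrow> ds y = \<pi> * ds' y + \<Phi> * As' y" "comb ds' = 0"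
    using peel[OF 1(2)] by blast
  have "cs y = \<pi> ^ Suc e * ds' y + \<Phi> * (\<pi> ^ e * As' y + As y)" if "y \<in> Y" for y
    unfolding 1(1)[OF that] 2(1)[OF that] by (simp add: algebra_simps)
  then show ?case using 2(2) by (intro exI conjI ballI)
qed

definition small :: "int poly \<Rightarrow> bool" where
  "small c \<longleftrightarrow> (\<forall>i\<ge>cyc_deg. Polynomial.coeff c i = 0)"

text \<open>Modulo p, \<Phi> is still monic of degree \<open>cyc_deg\<close>, so its only multiple
  of smaller degree is zero. The proof looks at the last coefficient of A not divisible by
  p.\<close>

lemma small_p_dvd:
  assumes c: "small c" "c = \<Phi> * A + of_nat p * D" shows "int p dvd Polynomial.coeff c i"
proof -
  have coeff_p: "Polynomial.coeff (of_nat p * D) k = int p * Polynomial.coeff D k" for k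
    by (simp add: of_nat_poly)
  have A: "int p dvd Polynomial.coeff A k" for k
  proof (rule ccontr)
    define S where "S = {k. \<not> int p dvd Polynomial.coeff A k}"
    assume "\<not> int p dvd Polynomial.coeff A k"
    then have "S \<noteq> {}" by (auto simp: S_def)
    have "S \<subseteq> {..Polynomial.degree A}" by (auto simp: S_def intro: le_degree ccontr)
    then have fin: "finite S" by (rule finite_subset) simp
    define b where "b = Max S"
    have b: "\<not> int p dvd Polynomial.coeff A b" using Max_in[OF fin \<open>S \<noteq> {}\<close>] by (simp add: b_def S_def)
    have above: "int p dvd Polynomial.coeff A k" if "b < k" for k
      using Max_ge[OF fin, of k] that by (auto simp: b_def S_def)
    have "Polynomial.coeff (\<Phi> * A) (cyc_deg + b)
        = (\<Sum>i\<le>cyc_deg + b. Polynomial.coeff \<Phi> i * Polynomial.coeff A (cyc_deg + b - i))"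
      by (rule coeff_mult)
    also have "\<dots> = Polynomial.coeff A b
        + (\<Sum>i\<in>{..cyc_deg + b} - {cyc_deg}. Polynomial.coeff \<Phi> i * Polynomial.coeff A (cyc_deg + b - i))"
      by (subst sum.remove[of _ cyc_deg]) (auto simp: coeff_\<Phi>_cyc_deg)
    finally have e: "Polynomial.coeff (\<Phi> * A) (cyc_deg + b) = \<dots>" .
    have "int p dvd (\<Sum>i\<in>{..cyc_deg + b} - {cyc_deg}. Polynomial.coeff \<Phi> i * Polynomial.coeff A (cyc_deg + b - i))"
    proof (rule dvd_sum)
      fix i assume "i \<in> {..cyc_deg + b} - {cyc_deg}"
      then consider "cyc_deg < i" | "i < cyc_deg" by fastforce
      then show "int p dvd Polynomial.coeff \<Phi> i * Polynomial.coeff A (cyc_deg + b - i)"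
        by cases (auto simp: coeff_\<Phi>_cyc_deg above)
    qed
    moreover have "int p dvd Polynomial.coeff (\<Phi> * A) (cyc_deg + b)"
    proof -
      have "Polynomial.coeff (\<Phi> * A) (cyc_deg + b) = - (int p * Polynomial.coeff D (cyc_deg + b))"
        using c(1) arg_cong[OF c(2), of "\<lambda>c. Polynomial.coeff c (cyc_deg + b)"]
        by (simp add: small_def coeff_p)
      then show ?thesis by simp
    qed
    ultimately show False using b unfolding e by (simp add: dvd_add_left_iff)
  qed
  have "int p dvd Polynomial.coeff (\<Phi> * A) i" unfolding coeff_mult by (rule dvd_sum) (simp add: A)
  then show ?thesis unfolding c(2) coeff_add coeff_p by simp
qed

text \<open>Peeling off P factors X - 1 and reducing modulo p and \<Phi> shows that all coefficients
  are divisible by p; divide and repeat. An integer divisible by every power of p is zero.\<close>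

lemma independent:
  assumes "\<And>y. y \<in> Y \<Longrightarrow> small (cs y)" "comb cs = 0" "y \<in> Y" shows "cs y = 0"
proof -
  have dvd: "int p ^ e dvd Polynomial.coeff (cs y) i"
    if "\<And>y. y \<in> Y \<Longrightarrow> small (cs y)" "comb cs = 0" "y \<in> Y" for e i cs y
    using that
  proof (induction e arbitrary: cs)
    case (Suc e)
    obtain ds As where 1: "\<And>y. y \<in> Y \<Longrightarrow> cs y = \<pi> ^ P * ds y + \<Phi> * As y"
      using peel_power[OF Suc.prems(2), of P] by blast
    obtain A C where "\<pi> ^ P = \<Phi> * A + of_nat p * C" using \<pi>_power by blast
    then have "cs y = \<Phi> * (A * ds y + As y) + of_nat p * (C * ds y)" if "y \<in> Y" for y
      using 1[OF that] by (simp add: algebra_simps)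
    then have "\<forall>i. int p dvd Polynomial.coeff (cs y) i" if "y \<in> Y" for y
      using small_p_dvd[OF Suc.prems(1)[OF that]] that by blast
    then have "[:int p:] dvd cs y" if "y \<in> Y" for y using that by (simp add: const_poly_dvd_iff)
    then obtain es where es: "\<And>y. y \<in> Y \<Longrightarrow> cs y = smult (int p) (es y)" by (simp add: dvd_def) metis
    have "frag_cmul (int p) (comb es) = 0"
      using Suc.prems(2) comb_cong[of cs "\<lambda>y. smult (int p) (es y)"] es by (simp add: comb_smult)
    then have "comb es = 0" using p_pos by simp
    moreover have "small (es y)" if "y \<in> Y" for y
      using Suc.prems(1)[OF that] es[OF that] p_pos by (simp add: small_def)
    ultimately have "int p ^ e dvd Polynomial.coeff (es y) i" using Suc.IH Suc.prems(3) by blast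
    then show ?case using es[OF Suc.prems(3)] by simp
  qed simp
  show ?thesis
  proof (rule poly_eqI, rule ccontr)
    fix i assume "Polynomial.coeff (cs y) i \<noteq> Polynomial.coeff 0 i"
    then have nz: "Polynomial.coeff (cs y) i \<noteq> 0" by simp
    define e where "e = nat \<bar>Polynomial.coeff (cs y) i\<bar>"
    have "int p ^ e \<le> \<bar>Polynomial.coeff (cs y) i\<bar>"
      using dvd_imp_le_int[OF nz dvd[OF assms, of e i]] by simp
    moreover have "e < p ^ e" using p_pos by (intro power_gt_expt) simp
    then have "int e < int p ^ e" by (metis of_nat_less_iff of_nat_power)
    ultimately show False by (simp add: e_def)
  qed
qed

lemma cyc_deg_pos: "0 < cyc_deg"
  using p_pos P'_pos by (simp add: cyc_deg_def)

text \<open>Division by \<Phi> works over the integers because \<Phi> is monic.\<close>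

lemma small_remainder: "\<exists>d A. small d \<and> c = d + \<Phi> * A"
proof (induction c)
  case 0
  show ?case by (intro exI[of _ 0]) (simp add: small_def)
next
  case (pCons a c)
  then obtain d A where d: "small d" "c = d + \<Phi> * A" by blast
  define l where "l = Polynomial.coeff d (cyc_deg - 1)"
  define d' where "d' = pCons a d - smult l \<Phi>"
  have "small d'"
    unfolding small_def
  proof (intro allI impI)
    fix i assume i: "cyc_deg \<le> i"
    obtain k where k: "i = Suc k" using i cyc_deg_pos by (cases i) auto
    show "Polynomial.coeff d' i = 0"
      using d(1) i k coeff_\<Phi>_cyc_deg(1) by (cases "i = cyc_deg") (auto simp: d'_def l_def small_def coeff_\<Phi>_cyc_deg)
  qed
  moreover have "pCons a c = d' + \<Phi> * (pCons 0 A + [:l:])"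
    by (simp add: d'_def d(2) distrib_left)
  ultimately show ?case by blast
qed

definition "q = (SOME q. coprime q (int p) \<and> (\<forall>v\<in>V. frag_cmul q v \<in> range comb))"

lemma q: "coprime q (int p)" "v \<in> V \<Longrightarrow> frag_cmul q v \<in> range comb"
  using someI_ex[OF prime_to_p_span] unfolding q_def by blast+

text \<open>These are coordinates of q v, the multiple known to lie in the free part, with respect
  to the s^i y for i < \<open>cyc_deg\<close>. They are unique by \<open>independent\<close>, hence
  additive in v.\<close>

definition coords :: "('f \<Rightarrow>\<^sub>0 int) \<Rightarrow> ('f \<Rightarrow>\<^sub>0 int) \<Rightarrow> int poly" where
  "coords v = (SOME cs. (\<forall>y. small (cs y)) \<and> (\<forall>y. y \<notin> Y \<longrightarrow> cs y = 0) \<and> frag_cmul q v = comb cs)"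

lemma coords:
  assumes "v \<in> V"
  shows "small (coords v y)" "y \<notin> Y \<Longrightarrow> coords v y = 0" "frag_cmul q v = comb (coords v)"
proof -
  obtain cs where cs: "frag_cmul q v = comb cs" using q(2)[OF assms] by blast
  obtain ds As where ds: "\<And>y. small (ds y)" "\<And>y. cs y = ds y + \<Phi> * As y"
  proof -
    have "\<forall>y. \<exists>d. small d \<and> (\<exists>A. cs y = d + \<Phi> * A)" using small_remainder by blast
    then obtain ds where "\<And>y. small (ds y)" "\<And>y. \<exists>A. cs y = ds y + \<Phi> * A" by metis
    then show ?thesis using that by metis
  qed
  have "frag_cmul q v = comb ds"
    unfolding cs using ds(2) comb_add[of ds "\<lambda>y. \<Phi> * As y"] comb_\<Phi>[of As] by (simp add: comb_def)
  also have "\<dots> = comb (\<lambda>y. if y \<in> Y then ds y else 0)" by (rule comb_cong) simp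
  finally have "\<exists>cs. (\<forall>y. small (cs y)) \<and> (\<forall>y. y \<notin> Y \<longrightarrow> cs y = 0) \<and> frag_cmul q v = comb cs"
    using ds(1) by (intro exI[of _ "\<lambda>y. if y \<in> Y then ds y else 0"]) (auto simp: small_def)
  from someI_ex[OF this] show "small (coords v y)" "y \<notin> Y \<Longrightarrow> coords v y = 0" "frag_cmul q v = comb (coords v)"
    unfolding coords_def by blast+
qed

lemma coords_unique:
  assumes "v \<in> V" "\<And>y. small (cs y)" "\<And>y. y \<notin> Y \<Longrightarrow> cs y = 0" "frag_cmul q v = comb cs"
  shows "coords v = cs"
proof
  fix y
  have "small (coords v y - cs y)" for y using coords(1)[OF assms(1), of y] assms(2)[of y] by (simp add: small_def)
  moreover have "comb (\<lambda>y. coords v y - cs y) = 0"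
    using coords(3)[OF assms(1)] assms(4) by (simp add: comb_diff)
  ultimately have "coords v y - cs y = 0" if "y \<in> Y" using independent[of "\<lambda>y. coords v y - cs y"] that by blast
  then show "coords v y = cs y" using coords(2)[OF assms(1), of y] assms(3)[of y] by fastforce
qed

lemma coords_add:
  assumes "v \<in> V" "w \<in> V" shows "coords (v + w) = (\<lambda>y. coords v y + coords w y)"
  by (rule coords_unique)
    (use assms coords[OF assms(1)] coords[OF assms(2)] in
      \<open>auto simp: small_def comb_add frag_cmul_distrib2 intro: add_closed_add[OF V]\<close>)

text \<open>Multiplication by X, then one step of division by \<Phi> to remove the coefficient that
  reaches degree \<open>cyc_deg\<close>.\<close>

lemma coords_s:
  assumes "v \<in> V"
  shows "coords (s v) = (\<lambda>y. pCons 0 (coords v y) - smult (Polynomial.coeff (coords v y) (cyc_deg - 1)) \<Phi>)"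
proof (rule coords_unique)
  show "s v \<in> V" using assms by (rule s_V)
  show "small (pCons 0 (coords v y) - smult (Polynomial.coeff (coords v y) (cyc_deg - 1)) \<Phi>)" for y
    unfolding small_def
  proof (intro allI impI)
    fix i assume i: "cyc_deg \<le> i"
    obtain k where k: "i = Suc k" using i cyc_deg_pos by (cases i) auto
    show "Polynomial.coeff (pCons 0 (coords v y) - smult (Polynomial.coeff (coords v y) (cyc_deg - 1)) \<Phi>) i = 0"
      using coords(1)[OF assms, of y] i k coeff_\<Phi>_cyc_deg(1) by (cases "i = cyc_deg") (auto simp: small_def coeff_\<Phi>_cyc_deg)
  qed
  show "y \<notin> Y \<Longrightarrow> pCons 0 (coords v y) - smult (Polynomial.coeff (coords v y) (cyc_deg - 1)) \<Phi> = 0" for y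
    using coords(2)[OF assms] by simp
  have "comb (\<lambda>y. smult (Polynomial.coeff (coords v y) (cyc_deg - 1)) \<Phi>) = 0"
    using comb_\<Phi>[of "\<lambda>y. [:Polynomial.coeff (coords v y) (cyc_deg - 1):]"] by simp
  moreover have "comb (\<lambda>y. pCons 0 (coords v y)) = s (comb (coords v))"
    by (simp add: comb_def additive.sum[OF s])
  ultimately show "frag_cmul q (s v) = comb (\<lambda>y. pCons 0 (coords v y) - smult (Polynomial.coeff (coords v y) (cyc_deg - 1)) \<Phi>)"
    by (simp add: comb_diff additive_frag_cmul[OF s, symmetric] coords(3)[OF assms])
qed

end

section \<open>Exterior powers at a prime\<close>

text \<open>If \<psi> factors through K/B by maps compatible with the operators, it annihilates the
  cohomology of A/R as soon as that of K/B vanishes. The squares commute only modulo B and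
  R.\<close>

lemma
  assumes A: "submodule_pair A R \<sigma>" and K: "submodule_pair K B T"
    and \<alpha>: "additive \<alpha>" "\<And>x. x \<in> A \<Longrightarrow> \<alpha> x \<in> K" "\<And>x. x \<in> R \<Longrightarrow> \<alpha> x \<in> B" "\<And>x. x \<in> A \<Longrightarrow> \<alpha> (\<sigma> x) - T (\<alpha> x) \<in> B"
    and \<beta>: "additive \<beta>" "\<And>x. x \<in> K \<Longrightarrow> \<beta> x \<in> A" "\<And>x. x \<in> B \<Longrightarrow> \<beta> x \<in> R" "\<And>x. x \<in> K \<Longrightarrow> \<beta> (T x) - \<sigma> (\<beta> x) \<in> R"
    and \<psi>: "\<And>x. x \<in> A \<Longrightarrow> \<beta> (\<alpha> x) - \<psi> x \<in> R"
  shows tate0_transfer: "tate0 K B T m \<Longrightarrow> x \<in> A \<Longrightarrow> \<sigma> x - x \<in> R \<Longrightarrow> \<exists>y\<in>A. \<psi> x - norm_op m \<sigma> y \<in> R"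
    and tate1_transfer: "tate1 K B T m \<Longrightarrow> x \<in> A \<Longrightarrow> norm_op m \<sigma> x \<in> R \<Longrightarrow> \<exists>y\<in>A. \<psi> x - (\<sigma> y - y) \<in> R"
proof -
  note A' = submodule_pairD[OF A] and K' = submodule_pairD[OF K]
  have funpow_mod: "f ((g ^^ k) x) - (h ^^ k) (f x) \<in> D"
    if D: "submodule_pair C D h" and f: "additive f" "\<And>x. x \<in> S \<Longrightarrow> g x \<in> S" "\<And>x. x \<in> S \<Longrightarrow> f (g x) - h (f x) \<in> D" "x \<in> S"
    for f :: "'p::ab_group_add \<Rightarrow> 'q::ab_group_add" and g h S C D x k
  proof (induction k)
    case 0 then show ?case using add_closed_zero[OF submodule_pairD(2)[OF D]] by simp
  next
    case (Suc k)
    have "h (f ((g ^^ k) x)) - h ((h ^^ k) (f x)) \<in> D"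
      using submodule_pairD(6)[OF D Suc] by (simp add: additive.diff[OF submodule_pairD(4)[OF D]])
    then show ?case
      using f(3)[OF funpow_closed[of S g, OF f(2,4), of k]] add_closed_diff_trans[OF submodule_pairD(2)[OF D]] by simp
  qed
  have norm_mod: "f (norm_op m g x) - norm_op m h (f x) \<in> D"
    if D: "submodule_pair C D h" and f: "additive f" "\<And>x. x \<in> S \<Longrightarrow> g x \<in> S" "\<And>x. x \<in> S \<Longrightarrow> f (g x) - h (f x) \<in> D" "x \<in> S"
    for f :: "'p::ab_group_add \<Rightarrow> 'q::ab_group_add" and g h S C D x
    unfolding norm_op_def additive.sum[OF f(1)] sum_subtractf[symmetric]
    by (intro add_closed_sum[OF submodule_pairD(2)[OF D]] funpow_mod[OF D f])
  have R_trans: "a - c \<in> R" if "a - b \<in> R" "b - c \<in> R" for a b c by (rule add_closed_diff_trans[OF A'(2) that])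
  have R_swap: "b - a \<in> R" if "a - b \<in> R" for a b by (rule add_closed_diff_swap[OF A'(2) that])
  have B_trans: "a - c \<in> B" if "a - b \<in> B" "b - c \<in> B" for a b c by (rule add_closed_diff_trans[OF K'(2) that])
  have B_swap: "b - a \<in> B" if "a - b \<in> B" for a b by (rule add_closed_diff_swap[OF K'(2) that])
  show "\<exists>y\<in>A. \<psi> x - norm_op m \<sigma> y \<in> R" if t: "tate0 K B T m" and x: "x \<in> A" "\<sigma> x - x \<in> R"
  proof -
    have "\<alpha> (\<sigma> x) - \<alpha> x \<in> B" using \<alpha>(3)[OF x(2)] by (simp add: additive.diff[OF \<alpha>(1)])
    then have "T (\<alpha> x) - \<alpha> x \<in> B" using B_trans B_swap \<alpha>(4)[OF x(1)] by blast
    then obtain \<xi> where \<xi>: "\<xi> \<in> K" "\<alpha> x - norm_op m T \<xi> \<in> B" using t \<alpha>(2)[OF x(1)] unfolding tate0_def by blast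
    have "\<beta> (\<alpha> x) - \<beta> (norm_op m T \<xi>) \<in> R" using \<beta>(3)[OF \<xi>(2)] by (simp add: additive.diff[OF \<beta>(1)])
    moreover have "\<beta> (norm_op m T \<xi>) - norm_op m \<sigma> (\<beta> \<xi>) \<in> R"
      by (rule norm_mod[OF A \<beta>(1) K'(5) \<beta>(4) \<xi>(1)])
    ultimately have "\<psi> x - norm_op m \<sigma> (\<beta> \<xi>) \<in> R" using \<psi>[OF x(1)] R_trans R_swap by blast
    then show ?thesis using \<beta>(2)[OF \<xi>(1)] by blast
  qed
  show "\<exists>y\<in>A. \<psi> x - (\<sigma> y - y) \<in> R" if t: "tate1 K B T m" and x: "x \<in> A" "norm_op m \<sigma> x \<in> R"
  proof -
    have "\<alpha> (norm_op m \<sigma> x) - norm_op m T (\<alpha> x) \<in> B"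
      by (rule norm_mod[OF K \<alpha>(1) A'(5) \<alpha>(4) x(1)])
    then have "norm_op m T (\<alpha> x) \<in> B" using \<alpha>(3)[OF x(2)] B_swap add_closed_cancel[OF K'(2)] by blast
    then obtain \<xi> where \<xi>: "\<xi> \<in> K" "\<alpha> x - (T \<xi> - \<xi>) \<in> B" using t \<alpha>(2)[OF x(1)] unfolding tate1_def by blast
    have "\<beta> (\<alpha> x) - (\<beta> (T \<xi>) - \<beta> \<xi>) \<in> R" using \<beta>(3)[OF \<xi>(2)] by (simp add: additive.diff[OF \<beta>(1)])
    moreover have "(\<beta> (T \<xi>) - \<beta> \<xi>) - (\<sigma> (\<beta> \<xi>) - \<beta> \<xi>) \<in> R" using \<beta>(4)[OF \<xi>(1)] by simp
    ultimately have "\<psi> x - (\<sigma> (\<beta> \<xi>) - \<beta> \<xi>) \<in> R" using \<psi>[OF x(1)] R_trans R_swap by blast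
    then show ?thesis using \<beta>(2)[OF \<xi>(1)] by blast
  qed
qed

section \<open>Exterior products in coordinates\<close>

definition wedge :: "('x \<Rightarrow> int) \<Rightarrow> ('x list \<Rightarrow> int) \<Rightarrow> 'x list \<Rightarrow> int" where
  "wedge w \<omega> = del_sum (\<lambda>x ys. w x * \<omega> ys)"

text \<open>On a list of the same length this is the determinant of the matrix with entries l v x,
  expanded along its first row; on other lists it is zero.\<close>

fun wedges :: "('v \<Rightarrow> 'x \<Rightarrow> int) \<Rightarrow> 'v list \<Rightarrow> 'x list \<Rightarrow> int" where
  "wedges l [] = (\<lambda>xs. if xs = [] then 1 else 0)"
| "wedges l (v # vs) = wedge (l v) (wedges l vs)"

lemma wedge_swap: "wedge w (wedge w' \<omega>) xs = - wedge w' (wedge w \<omega>) xs"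
proof -
  have mult: "additive (\<lambda>z. k * z)" for k :: int by (simp add: additive_def distrib_left)
  have "wedge w (wedge w' \<omega>) xs = del_sum (\<lambda>x. del_sum (\<lambda>y zs. w x * (w' y * \<omega> zs))) xs"
    unfolding wedge_def del_sum_additive[OF mult] ..
  also have "\<dots> = - del_sum (\<lambda>x. del_sum (\<lambda>y zs. w y * (w' x * \<omega> zs))) xs"
    by (rule del_sum_del_sum)
  also have "del_sum (\<lambda>x. del_sum (\<lambda>y zs. w y * (w' x * \<omega> zs))) xs = wedge w' (wedge w \<omega>) xs"
    unfolding wedge_def del_sum_additive[OF mult] by (simp add: mult.left_commute)
  finally show ?thesis .
qed

lemma wedge_add_right: "wedge w (\<lambda>xs. \<omega> xs + \<omega>' xs) xs = wedge w \<omega> xs + wedge w \<omega>' xs"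
  unfolding wedge_def by (simp add: distrib_left del_sum_add)

lemma wedge_diff_right: "wedge w (\<lambda>xs. \<omega> xs - \<omega>' xs) xs = wedge w \<omega> xs - wedge w \<omega>' xs"
  unfolding wedge_def by (simp add: right_diff_distrib del_sum_diff)

lemma wedge_add_left: "wedge (\<lambda>x. w x + w' x) \<omega> xs = wedge w \<omega> xs + wedge w' \<omega> xs"
  unfolding wedge_def by (simp add: distrib_right del_sum_add)

lemma alternating_scale: "alternating f \<Longrightarrow> alternating (\<lambda>xs. (k::int) * f xs)"
  unfolding alternating_def by (metis mult_minus_right)

lemma alternating_wedge: "alternating \<omega> \<Longrightarrow> alternating (wedge w \<omega>)"
  unfolding wedge_def by (intro alternating_del_sum alternating_scale)

lemma alternating_wedges: "alternating (wedges l vs)"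
  by (induction vs) (auto simp: alternating_wedge, simp add: alternating_def)

lemma wedges_swap: "alternating (\<lambda>vs. wedges l vs xs)"
  unfolding alternating_def
proof (intro allI)
  fix us v w vs
  show "wedges l (us @ v # w # vs) xs = - wedges l (us @ w # v # vs) xs"
  proof (induction us arbitrary: xs)
    case Nil
    then show ?case using wedge_swap[of "l v" "l w" "wedges l vs" xs] by simp
  next
    case (Cons u us)
    have "wedge (l u) (wedges l (us @ v # w # vs)) xs = wedge (l u) (\<lambda>xs. 0 - wedges l (us @ w # v # vs) xs) xs"
      by (rule arg_cong[of _ _ "\<lambda>f. wedge (l u) f xs"]) (auto intro: Cons)
    also have "\<dots> = - wedge (l u) (wedges l (us @ w # v # vs)) xs"
      unfolding wedge_diff_right by (simp add: wedge_def)
    finally show ?case by simp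
  qed
qed

lemma wedges_add:
  assumes "\<And>x. l (v + w) x = l v x + l w x"
  shows "wedges l (us @ (v + w) # vs) xs = wedges l (us @ v # vs) xs + wedges l (us @ w # vs) xs"
proof (induction us arbitrary: xs)
  case Nil
  have "l (v + w) = (\<lambda>x. l v x + l w x)" using assms by auto
  then show ?case by (simp add: wedge_add_left)
next
  case (Cons u us)
  have "wedges l (us @ (v + w) # vs) = (\<lambda>xs. wedges l (us @ v # vs) xs + wedges l (us @ w # vs) xs)"
    using Cons by auto
  then show ?case by (simp add: wedge_add_right)
qed

lemma wedges_support:
  "wedges l vs xs \<noteq> 0 \<Longrightarrow> length xs = length vs \<and> (\<forall>x\<in>set xs. \<exists>v\<in>set vs. l v x \<noteq> 0)"
proof (induction vs arbitrary: xs)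
  case (Cons v vs)
  then obtain us x ws where "xs = us @ x # ws" "l v x * wedges l vs (us @ ws) \<noteq> 0"
    unfolding wedges.simps wedge_def by (auto elim: del_sum_nonzero)
  then show ?case using Cons.IH[of "us @ ws"] by auto
qed (simp split: if_splits)

lemma mset_eq_swaps:
  assumes "mset xs = mset ys" and refl: "\<And>xs. Q xs xs" and trans: "\<And>xs ys zs. Q xs ys \<Longrightarrow> Q ys zs \<Longrightarrow> Q xs zs"
    and swap: "\<And>x y zs. set (x # y # zs) \<subseteq> set xs \<Longrightarrow> Q (x # y # zs) (y # x # zs)"
    and Cons: "\<And>x xs ys. Q xs ys \<Longrightarrow> Q (x # xs) (x # ys)"
  shows "Q xs ys"
proof -
  define S where "S = set xs"
  have "Q xs ys" if "mset xs = mset ys" "set xs \<subseteq> S" for xs ys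
    using that
  proof (induction xs arbitrary: ys)
    case Nil then show ?case by (simp add: refl)
  next
    case (Cons x xs)
    obtain as bs where ys: "ys = as @ x # bs" using Cons.prems by (metis list.set_intros(1) mset_eq_setD split_list)
    have "mset xs = mset (as @ bs)" "set xs \<subseteq> S" using Cons.prems ys by auto
    then have "Q (x # xs) (x # as @ bs)" by (intro assms(5) Cons.IH)
    moreover have "set (x # as @ bs) \<subseteq> S" using mset_eq_setD[OF Cons.prems(1)] Cons.prems(2) ys by auto
    then have "Q (x # as @ bs) (as @ x # bs)"
    proof (induction as)
      case Nil then show ?case by (simp add: refl)
    next
      case (Cons a as)
      have "Q (x # a # as @ bs) (a # x # as @ bs)" using Cons.prems by (intro swap) (auto simp: S_def)
      moreover have "Q (a # x # as @ bs) (a # as @ x # bs)" using Cons by (intro assms(5)) auto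
      ultimately show ?case using trans by fastforce
    qed
    ultimately show ?case unfolding ys by (rule trans)
  qed
  then show ?thesis using assms(1) by (simp add: S_def)
qed

text \<open>A modulo R is an abstract j-th exterior power of V, given by its generators E vs and, in
  \<open>A_univ\<close>, by its universal property for integer-valued maps. E is defined on lists of
  every length, while generation and universality refer to length j.\<close>

locale prime_power_exterior = prime_power_lattice +
  fixes A R :: "('e \<Rightarrow>\<^sub>0 int) set" and \<sigma> :: "('e \<Rightarrow>\<^sub>0 int) \<Rightarrow> ('e \<Rightarrow>\<^sub>0 int)"
    and E :: "('a \<Rightarrow>\<^sub>0 int) list \<Rightarrow> ('e \<Rightarrow>\<^sub>0 int)" and j :: nat
  assumes AR: "submodule_pair A R \<sigma>"
    and E_A: "set vs \<subseteq> V \<Longrightarrow> E vs \<in> A"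
    and E_add: "set us \<subseteq> V \<Longrightarrow> v \<in> V \<Longrightarrow> w \<in> V \<Longrightarrow> set ws \<subseteq> V \<Longrightarrow>
       E (us @ (v + w) # ws) - (E (us @ v # ws) + E (us @ w # ws)) \<in> R"
    and E_alt: "set vs \<subseteq> V \<Longrightarrow> \<not> distinct vs \<Longrightarrow> E vs \<in> R"
    and \<sigma>_E: "set vs \<subseteq> V \<Longrightarrow> \<sigma> (E vs) = E (map s vs)"
    and A_gen: "add_closed S \<Longrightarrow> (\<And>vs. set vs \<subseteq> V \<Longrightarrow> length vs = j \<Longrightarrow> E vs \<in> S) \<Longrightarrow> A \<subseteq> S"
    and A_univ: "\<And>f. (\<And>us v w ws. set us \<subseteq> V \<Longrightarrow> v \<in> V \<Longrightarrow> w \<in> V \<Longrightarrow> set ws \<subseteq> V \<Longrightarrow>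
         f (us @ (v + w) # ws) = f (us @ v # ws) + (f (us @ w # ws) :: int)) \<Longrightarrow>
       (\<And>vs. set vs \<subseteq> V \<Longrightarrow> \<not> distinct vs \<Longrightarrow> f vs = 0) \<Longrightarrow>
       \<exists>g. additive g \<and> (\<forall>vs. set vs \<subseteq> V \<longrightarrow> length vs = j \<longrightarrow> g (E vs) = f vs) \<and> (\<forall>c\<in>R. g c = 0)"
begin

lemma A: "add_closed A" and R: "add_closed R" and \<sigma>: "additive \<sigma>"
  using submodule_pairD[OF AR] by auto

lemma R_trans: "a - b \<in> R \<Longrightarrow> b - c \<in> R \<Longrightarrow> a - c \<in> R"
  by (rule add_closed_diff_trans[OF R])

lemma R_swap: "a - b \<in> R \<Longrightarrow> b - a \<in> R"
  by (rule add_closed_diff_swap[OF R])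

lemma R_add: "a - b \<in> R \<Longrightarrow> c - d \<in> R \<Longrightarrow> (a + c) - (b + d) \<in> R"
  using add_closed_add[OF R, of "a - b" "c - d"] by (simp add: algebra_simps)

lemma zero_R [simp]: "0 \<in> R"
  by (rule add_closed_zero[OF R])

lemma R_cmul: "a - b \<in> R \<Longrightarrow> frag_cmul k a - frag_cmul k b \<in> R"
  using add_closed_frag_cmul[OF R, of "a - b" k] by (simp add: frag_cmul_diff_distrib2)

lemma R_sum: "(\<And>i. i \<in> I \<Longrightarrow> f i - g i \<in> R) \<Longrightarrow> sum f I - sum g I \<in> R"
  unfolding sum_subtractf[symmetric] by (rule add_closed_sum[OF R])

lemma E_zero: "set us \<subseteq> V \<Longrightarrow> set ws \<subseteq> V \<Longrightarrow> E (us @ 0 # ws) \<in> R"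
proof -
  assume "set us \<subseteq> V" "set ws \<subseteq> V"
  from E_add[OF this(1) add_closed_zero[OF V] add_closed_zero[OF V] this(2)]
  have "- E (us @ 0 # ws) \<in> R" by simp
  then show ?thesis using add_closed_minus[OF R] by fastforce
qed

text \<open>Expand the generator with v + w in both slots.\<close>

lemma E_swap:
  assumes "set us \<subseteq> V" "v \<in> V" "w \<in> V" "set ws \<subseteq> V"
  shows "E (us @ v # w # ws) - - E (us @ w # v # ws) \<in> R"
proof -
  have vw: "v + w \<in> V" using assms add_closed_add[OF V] by blast
  have wws: "set (w # ws) \<subseteq> V" "set (v # ws) \<subseteq> V" "set ((v + w) # ws) \<subseteq> V" "set (us @ [v]) \<subseteq> V" "set (us @ [w]) \<subseteq> V" using assms vw by auto
  have 1: "E (us @ (v + w) # (v + w) # ws) \<in> R" using assms vw by (intro E_alt) auto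
  have 2: "E (us @ (v + w) # (v + w) # ws) - (E (us @ v # (v + w) # ws) + E (us @ w # (v + w) # ws)) \<in> R"
    using E_add[OF assms(1,2,3) wws(3)] .
  have 3: "E (us @ v # (v + w) # ws) - (E (us @ v # v # ws) + E (us @ v # w # ws)) \<in> R"
    using E_add[OF wws(4) assms(2,3,4)] by simp
  have 4: "E (us @ w # (v + w) # ws) - (E (us @ w # v # ws) + E (us @ w # w # ws)) \<in> R"
    using E_add[OF wws(5) assms(2,3,4)] by simp
  have 5: "E (us @ v # v # ws) \<in> R" "E (us @ w # w # ws) \<in> R" using assms by (auto intro!: E_alt)
  have "E (us @ v # w # ws) - - E (us @ w # v # ws) =
     E (us @ (v + w) # (v + w) # ws)
     - (E (us @ (v + w) # (v + w) # ws) - (E (us @ v # (v + w) # ws) + E (us @ w # (v + w) # ws)))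
     - (E (us @ v # (v + w) # ws) - (E (us @ v # v # ws) + E (us @ v # w # ws)))
     - (E (us @ w # (v + w) # ws) - (E (us @ w # v # ws) + E (us @ w # w # ws)))
     - E (us @ v # v # ws) - E (us @ w # w # ws)"
    by (simp add: algebra_simps)
  also have "\<dots> \<in> R" by (intro add_closed_diff R 1 2 3 4 5)
  finally show ?thesis .
qed

end

text \<open>The sum of \<open>\<phi> ys \<cdot> F (map c ys)\<close> over all sublists \<open>ys\<close> of the list.\<close>

fun subset_sum :: "('x \<Rightarrow> 'v) \<Rightarrow> ('v list \<Rightarrow> 'e \<Rightarrow>\<^sub>0 int) \<Rightarrow> ('x list \<Rightarrow> int) \<Rightarrow> 'x list \<Rightarrow> 'e \<Rightarrow>\<^sub>0 int" where
  "subset_sum c F \<phi> [] = frag_cmul (\<phi> []) (F [])"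
| "subset_sum c F \<phi> (x # xs) = subset_sum c F \<phi> xs + subset_sum c (\<lambda>zs. F (c x # zs)) (\<lambda>ys. \<phi> (x # ys)) xs"

lemma subset_sum_add: "subset_sum c F (\<lambda>ys. \<phi> ys + \<psi> ys) xs = subset_sum c F \<phi> xs + subset_sum c F \<psi> xs"
  by (induction xs arbitrary: F \<phi> \<psi>) (auto simp: frag_cmul_distrib)

lemma subset_sum_diff: "subset_sum c F (\<lambda>ys. \<phi> ys - \<psi> ys) xs = subset_sum c F \<phi> xs - subset_sum c F \<psi> xs"
  by (induction xs arbitrary: F \<phi> \<psi>) (auto simp: frag_cmul_diff_distrib)

lemma subset_sum_zero [simp]: "subset_sum c F (\<lambda>ys. 0) xs = 0"
  by (induction xs arbitrary: F) auto

lemma subset_sum_scale: "subset_sum c F (\<lambda>ys. k * \<phi> ys) xs = frag_cmul k (subset_sum c F \<phi> xs)"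
  by (induction xs arbitrary: F \<phi>) (auto simp: frag_cmul_distrib2)

lemma subset_sum_add_fun: "subset_sum c (\<lambda>zs. F zs + F' zs) \<phi> xs = subset_sum c F \<phi> xs + subset_sum c F' \<phi> xs"
  by (induction xs arbitrary: F F' \<phi>) (auto simp: frag_cmul_distrib2)

lemma subset_sum_diff_fun: "subset_sum c (\<lambda>zs. F zs - F' zs) \<phi> xs = subset_sum c F \<phi> xs - subset_sum c F' \<phi> xs"
  by (induction xs arbitrary: F F' \<phi>) (auto simp: frag_cmul_diff_distrib2)

lemma subset_sum_zero_fun [simp]: "subset_sum c (\<lambda>zs. 0) \<phi> xs = 0"
  by (induction xs arbitrary: \<phi>) auto

lemma subset_sum_sum_fun: "subset_sum c (\<lambda>zs. \<Sum>i\<in>I. F i zs) \<phi> xs = (\<Sum>i\<in>I. subset_sum c (F i) \<phi> xs)"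
  by (induction I rule: infinite_finite_induct) (auto simp: subset_sum_add_fun)

lemma subset_sum_cmul_fun: "subset_sum c (\<lambda>zs. frag_cmul k (F zs)) \<phi> xs = frag_cmul k (subset_sum c F \<phi> xs)"
  by (induction xs arbitrary: F \<phi>) (auto simp: frag_cmul_distrib2 mult.commute)

lemma subset_sum_closed:
  assumes "add_closed D" "\<And>zs. set zs \<subseteq> c ` set xs \<Longrightarrow> F zs \<in> D"
  shows "subset_sum c F \<phi> xs \<in> D"
  using assms(2)
proof (induction xs arbitrary: F \<phi>)
  case Nil
  then show ?case by (simp add: add_closed_frag_cmul[OF assms(1)])
next
  case (Cons x xs)
  have "subset_sum c F \<phi> xs \<in> D" using Cons.prems by (intro Cons.IH) auto
  moreover have "subset_sum c (\<lambda>zs. F (c x # zs)) (\<lambda>ys. \<phi> (x # ys)) xs \<in> D"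
    using Cons.prems by (intro Cons.IH) (auto simp: insert_mono subset_insertI2)
  ultimately show ?case by (simp add: add_closed_add[OF assms(1)])
qed

lemma subset_sum_hom:
  assumes "additive h" "\<And>zs. set zs \<subseteq> c ` g ` set xs \<Longrightarrow> h (F zs) = F' (map s zs)" "\<And>x. x \<in> set xs \<Longrightarrow> s (c (g x)) = c x"
  shows "h (subset_sum c F \<phi> (map g xs)) = subset_sum c F' (\<lambda>ys. \<phi> (map g ys)) xs"
  using assms(2,3)
proof (induction xs arbitrary: F F' \<phi>)
  case Nil
  then show ?case using Nil(1)[of "[]"] by (simp add: additive_frag_cmul[OF assms(1)])
next
  case (Cons x xs)
  have "h (subset_sum c F \<phi> (map g xs)) = subset_sum c F' (\<lambda>ys. \<phi> (map g ys)) xs"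
  proof (rule Cons.IH)
    show "h (F zs) = F' (map s zs)" if "set zs \<subseteq> c ` g ` set xs" for zs
      by (rule Cons.prems(1)) (use that in auto)
  qed (use Cons.prems in auto)
  moreover have "h (subset_sum c (\<lambda>zs. F (c (g x) # zs)) (\<lambda>ys. \<phi> (g x # ys)) (map g xs))
      = subset_sum c (\<lambda>zs. F' (c x # zs)) (\<lambda>ys. \<phi> (g x # map g ys)) xs"
  proof (rule Cons.IH)
    show "h (F (c (g x) # zs)) = F' (c x # map s zs)" if "set zs \<subseteq> c ` g ` set xs" for zs
      using Cons.prems(1)[of "c (g x) # zs"] Cons.prems(2)[of x] that by auto
  qed (use Cons.prems in auto)
  ultimately show ?case by (simp add: additive.add[OF assms(1)])
qed

lemma count_image_mset_distinct: "distinct xs \<Longrightarrow> count (image_mset f (mset xs)) c = card {x \<in> set xs. f x = c}"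
proof (induction xs)
  case (Cons x xs)
  have "{z \<in> set (x # xs). f z = c} = (if f x = c then insert x {z \<in> set xs. f z = c} else {z \<in> set xs. f z = c})"
    by auto
  then show ?case using Cons by auto
qed simp

section \<open>Cells, their orbits and rotations\<close>

context prime_power_lattice
begin

definition cell :: "('f \<Rightarrow>\<^sub>0 int) \<times> nat \<Rightarrow> ('f \<Rightarrow>\<^sub>0 int)" where
  "cell x = (s ^^ snd x) (fst x)"

text \<open>Names the orbit under s^P', which generates the subgroup of order p, by its smallest
  exponent. Pairs beyond the range keep their own label, which lies outside
  \<open>Orbs\<close>.\<close>

definition orb :: "('f \<Rightarrow>\<^sub>0 int) \<times> nat \<Rightarrow> ('f \<Rightarrow>\<^sub>0 int) \<times> nat" where
  "orb x = (fst x, if snd x < P then snd x mod P' else snd x)"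

text \<open>Lowers the exponent by one modulo n, because \<open>shift\<close> inverts the rotation;
  n is P on cells and P' on orbits. It fixes all other pairs since \<open>koszul_action\<close> asks
  for the period on the whole type.\<close>

definition rot :: "nat \<Rightarrow> ('f \<Rightarrow>\<^sub>0 int) \<times> nat \<Rightarrow> ('f \<Rightarrow>\<^sub>0 int) \<times> nat" where
  "rot n x = (fst x, if snd x < n then (snd x + (n - 1)) mod n else snd x)"

definition "cells = Y \<times> {..<P}"

definition "Orbs = Y \<times> {..<P'}"

definition Good :: "nat \<Rightarrow> (('f \<Rightarrow>\<^sub>0 int) \<times> nat) multiset set" where
  "Good j = {e. size e = j \<and> set_mset e \<subseteq> Orbs \<and> (\<forall>c. count e c < p)}"

lemma P_pos: "0 < P"
  using p_pos by (simp add: P)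

lemma P'_dvd_P: "P' dvd P" and P'_le_P: "P' \<le> P"
  using p_pos by (simp_all add: P_eq(1))

lemma orb_cells: "orb x \<in> Orbs \<longleftrightarrow> x \<in> cells"
  using P'_pos P'_le_P by (auto simp: orb_def Orbs_def cells_def mem_Times_iff)

lemma cell_V: "x \<in> cells \<Longrightarrow> cell x \<in> V"
proof -
  assume "x \<in> cells"
  then have "fst x \<in> V" using Y_V by (auto simp: cells_def)
  then show ?thesis unfolding cell_def using funpow_closed[of V s] s_V by blast
qed

lemma funpow_rot: "0 < n \<Longrightarrow> (rot n ^^ k) x = (fst x, if snd x < n then (snd x + k * (n - 1)) mod n else snd x)"
proof -
  assume n: "0 < n"
  define c where "c = n - 1"
  have rot: "rot n x = (fst x, if snd x < n then (snd x + c) mod n else snd x)" for x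
    by (simp add: rot_def c_def)
  have "(rot n ^^ k) x = (fst x, if snd x < n then (snd x + k * c) mod n else snd x)"
    by (induction k) (auto simp: rot mod_add_left_eq mod_add_right_eq ac_simps n)
  then show ?thesis by (simp add: c_def)
qed

lemma rot_period: "0 < n \<Longrightarrow> n dvd k \<Longrightarrow> (rot n ^^ k) x = x"
  by (auto simp: funpow_rot prod_eq_iff mult.assoc elim!: dvdE)

lemma s_cell_rot: "x \<in> cells \<Longrightarrow> s (cell (rot P x)) = cell x"
proof -
  assume x: "x \<in> cells"
  then have v: "fst x \<in> V" "snd x < P" using Y_V by (auto simp: cells_def)
  show ?thesis
  proof (cases "snd x")
    case 0
    have "s ((s ^^ (P - 1)) (fst x)) = (s ^^ Suc (P - 1)) (fst x)" by simp
    then show ?thesis using 0 v s_P[of "fst x"] P_pos by (simp add: rot_def cell_def V_def)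
  next
    case (Suc a)
    then have "(snd x + (P - 1)) mod P = a" using v(2) by simp
    then show ?thesis using Suc v(2) by (simp add: rot_def cell_def)
  qed
qed

lemma rot_cells: "rot P x \<in> cells \<longleftrightarrow> x \<in> cells"
  using P_pos by (auto simp: rot_def cells_def mem_Times_iff)

lemma rot_Orbs: "rot P' c \<in> Orbs \<longleftrightarrow> c \<in> Orbs"
  using P'_pos by (auto simp: rot_def Orbs_def mem_Times_iff)

lemma rot_inj: "0 < n \<Longrightarrow> inj (rot n)"
proof (rule injI)
  fix x y assume n: "0 < n" and "rot n x = rot n y"
  then have "(rot n ^^ (n - 1)) (rot n x) = (rot n ^^ (n - 1)) (rot n y)" by simp
  then have "(rot n ^^ Suc (n - 1)) x = (rot n ^^ Suc (n - 1)) y" by (simp only: funpow_Suc_right o_apply)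
  then show "x = y" using n rot_period[of n n] by simp
qed

lemma orb_rot: "orb (rot P x) = rot P' (orb x)"
proof -
  have "P - 1 = (p - 1) * P' + (P' - 1)" using P_eq(2) P'_pos by (simp add: cyc_deg_def)
  then have "(a + (P - 1)) mod P' = (a mod P' + (P' - 1)) mod P'" for a
    by (metis add.left_commute mod_add_left_eq mod_mult_self3)
  then show ?thesis
    using P_pos P'_pos P'_le_P P'_dvd_P by (auto simp: orb_def rot_def mod_mod_cancel)
qed

lemma Good_rot: "image_mset (rot P') e \<in> Good j \<longleftrightarrow> e \<in> Good j"
proof -
  note inj = rot_inj[OF P'_pos]
  have surj: "\<exists>d. c = rot P' d" for c
  proof -
    have "rot P' ((rot P' ^^ (P' - 1)) c) = (rot P' ^^ Suc (P' - 1)) c" by simp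
    then show ?thesis using rot_period[of P' P' c] P'_pos by (metis Suc_diff_1 dvd_refl)
  qed
  have cnt: "count (image_mset (rot P') e) (rot P' d) = count e d" for d
  proof -
    have "rot P' -` {rot P' d} = {d}" using inj_eq[OF inj] by blast
    then have "count (image_mset (rot P') e) (rot P' d) = sum (count e) ({d} \<inter> set_mset e)"
      by (simp only: count_image_mset)
    also have "\<dots> = count e d" by (cases "d \<in># e") (simp_all add: not_in_iff)
    finally show ?thesis .
  qed
  have "(\<forall>c. count (image_mset (rot P') e) c < p) \<longleftrightarrow> (\<forall>d. count e d < p)"
  proof
    assume "\<forall>c. count (image_mset (rot P') e) c < p"
    then show "\<forall>d. count e d < p" using cnt by metis
  next
    assume "\<forall>d. count e d < p"
    then show "\<forall>c. count (image_mset (rot P') e) c < p" using cnt surj by metis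
  qed
  moreover have "rot P' ` set_mset e \<subseteq> Orbs \<longleftrightarrow> set_mset e \<subseteq> Orbs" using rot_Orbs by auto
  ultimately show ?thesis by (simp add: Good_def)
qed

text \<open>A set of cells stable under a nontrivial rotation is stable under the subgroup of order \<open>p\<close>,
  hence contains a full orbit, which the multiplicity bound in \<open>Good\<close> excludes.\<close>

lemma rot_moves:
  assumes xs: "distinct xs" "xs \<noteq> []" and good: "\<alpha> + image_mset orb (mset xs) \<in> Good j" and k: "0 < k" "k < P"
  shows "(rot P ^^ k) ` set xs \<noteq> set xs"
proof
  assume stable: "(rot P ^^ k) ` set xs = set xs"
  have sub: "set xs \<subseteq> cells" using good orb_cells by (auto simp: Good_def)
  \<comment> \<open>As a proper divisor of the prime power P, the gcd divides P' = P / p, so a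
    Bezout combination yields stability under rotation by P'.\<close>
  have "gcd k P dvd p ^ Suc r" by (simp add: P)
  then obtain i where i: "i \<le> Suc r" "gcd k P = p ^ i" using divides_primepow_nat[OF prime_p] by blast
  have "gcd k P < P" using k le_less_trans[OF gcd_le1_nat[of k P]] by simp
  then have "i \<le> r" using i p_pos by (cases "i = Suc r") (auto simp: P)
  then have "gcd k P dvd P'" unfolding i(2) P' by (rule le_imp_power_dvd)
  then obtain g where g: "P' = gcd k P * g" by (rule dvdE)
  obtain u v where uv: "k * u = P * v + gcd k P" using bezout_nat[of k P] k by auto
  have stable_mult: "(rot P ^^ (k * n)) ` set xs = set xs" for n
  proof (induction n)
    case (Suc n)
    have "(rot P ^^ (k * Suc n)) ` set xs = (rot P ^^ k) ` (rot P ^^ (k * n)) ` set xs"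
      by (simp add: funpow_add image_comp)
    then show ?case using Suc stable by simp
  qed simp
  have closed: "(rot P ^^ (P' * b)) x \<in> set xs" if x: "x \<in> set xs" for x b
  proof -
    have "k * (u * g * b) = P' * b + P * (v * g * b)"
    proof -
      have "k * (u * g * b) = (k * u) * (g * b)" by (simp only: ac_simps)
      also have "\<dots> = (P * v + gcd k P) * (g * b)" by (simp only: uv)
      also have "\<dots> = gcd k P * g * b + P * (v * g * b)" by (simp only: distrib_right distrib_left ac_simps)
      finally show ?thesis by (simp only: g)
    qed
    then have "(rot P ^^ (k * (u * g * b))) x = (rot P ^^ (P' * b)) ((rot P ^^ (P * (v * g * b))) x)"
      by (simp add: funpow_add)
    also have "(rot P ^^ (P * (v * g * b))) x = x" by (rule rot_period) (simp_all add: P_pos)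
    finally show ?thesis using stable_mult[of "u * g * b"] x by (metis imageI)
  qed
  obtain y a where x: "(y, a) \<in> set xs" using xs(2) by (cases xs) auto
  then have a: "a < P" using sub by (auto simp: cells_def)
  \<comment> \<open>The p members of the orbit of (y, a): the factor P - 1 counts as -1 modulo P.
    They are distinct because P - 1 is prime to p.\<close>
  define f where "f b = (y, (a + P' * b * (P - 1)) mod P)" for b
  have "f b \<in> {x \<in> set xs. orb x = orb (y, a)}" for b
  proof -
    have "f b = (rot P ^^ (P' * b)) (y, a)" using a P_pos by (simp add: funpow_rot f_def)
    moreover have "orb (f b) = orb (y, a)"
      using a P_pos P'_dvd_P by (simp add: orb_def f_def mod_mod_cancel mult.assoc)
    ultimately show ?thesis using closed[OF x, of b] by simp
  qed
  then have "f ` {..<p} \<subseteq> {x \<in> set xs. orb x = orb (y, a)}" by blast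
  moreover have "inj_on f {..<p}"
  proof (rule inj_onI)
    fix b b' assume bb: "b \<in> {..<p}" "b' \<in> {..<p}" "f b = f b'"
    then have "(a + P' * b * (P - 1)) mod P = (a + P' * b' * (P - 1)) mod P" by (simp add: f_def)
    then have "int (a + P' * b * (P - 1)) mod int P = int (a + P' * b' * (P - 1)) mod int P" by (metis of_nat_mod)
    then have "int P dvd int (a + P' * b * (P - 1)) - int (a + P' * b' * (P - 1))" by (simp only: mod_eq_dvd_iff)
    also have "int (a + P' * b * (P - 1)) - int (a + P' * b' * (P - 1)) = int P' * (int (P - 1) * (int b - int b'))"
      unfolding of_nat_add of_nat_mult by (simp only: right_diff_distrib left_diff_distrib ac_simps add_diff_cancel_left)
    finally have "int P' * int p dvd int P' * (int (P - 1) * (int b - int b'))" by (simp add: P_eq(1) mult.commute)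
    then have "int p dvd int (P - 1) * (int b - int b')" using P'_pos by simp
    moreover have "\<not> int p dvd int (P - 1)"
    proof
      assume "int p dvd int (P - 1)"
      then have "p dvd P - 1" by simp
      moreover have "p dvd P" by (simp add: P)
      ultimately have "p dvd P - (P - 1)" by (rule dvd_diff_nat[rotated])
      then show False using P_pos p_pos by simp
    qed
    ultimately have "int p dvd int b - int b'"
      using prime_p prime_dvd_mult_iff[of "int p"] by auto
    then have "int b mod int p = int b' mod int p" by (simp add: mod_eq_dvd_iff)
    then show "b = b'" using bb by simp
  qed
  ultimately have "card {..<p} \<le> card {x \<in> set xs. orb x = orb (y, a)}"
    by (metis (no_types, lifting) List.finite_set card_image card_mono finite_filter finite_subset mem_Collect_eq subsetI)
  then have "p \<le> count (\<alpha> + image_mset orb (mset xs)) (orb (y, a))"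
    by (simp add: count_image_mset_distinct[OF xs(1)] del: count_image_mset)
  moreover have "count (\<alpha> + image_mset orb (mset xs)) (orb (y, a)) < p" using good unfolding Good_def by blast
  ultimately show False by simp
qed

lemma koszul_action: "koszul_action orb (rot P) (rot P') (Good j) Orbs (\<lambda>c. c) P j"
proof
  show "finite Orbs" using finite_Y by (simp add: Orbs_def)
  show "c \<in> Orbs \<Longrightarrow> orb c = c" for c using P'_le_P by (auto simp: Orbs_def orb_def)
  show "(rot P ^^ P) x = x" "(rot P' ^^ P) x = x" for x
    using P_pos P'_pos P'_dvd_P by (simp_all add: rot_period)
  show "distinct xs \<Longrightarrow> xs \<noteq> [] \<Longrightarrow> \<alpha> + image_mset orb (mset xs) \<in> Good j \<Longrightarrow> 0 < k \<Longrightarrow> k < P \<Longrightarrow>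
       (rot P ^^ k) ` set xs \<noteq> set xs" for xs \<alpha> k by (rule rot_moves)
  show "e \<in> Good j \<Longrightarrow> set_mset e \<subseteq> Orbs" "e \<in> Good j \<Longrightarrow> size e = j" for e
    by (simp_all add: Good_def)
qed (simp_all add: orb_rot Good_rot P_pos)

text \<open>This is \<Phi>(s) = 0 moved by s^a. It lets the map from formal sums of cells to V
  factor through F/K.\<close>

lemma orbit_sum:
  assumes "c \<in> Orbs" shows "(\<Sum>x\<in>{x \<in> cells. orb x = c}. cell x) = 0"
proof -
  obtain y a where c: "c = (y, a)" "y \<in> Y" "a < P'" using assms by (auto simp: Orbs_def)
  define f where "f b = (y, a + b * P')" for b
  have lt: "a + b * P' < P \<longleftrightarrow> b < p" for b
  proof -
    have "a + b * P' < P \<longleftrightarrow> (a + b * P') div P' < p"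
      unfolding P_eq(1) by (rule div_less_iff_less_mult[OF P'_pos, symmetric])
    moreover have "(a + b * P') div P' = b" using c(3) by simp
    ultimately show ?thesis by simp
  qed
  have "bij_betw f {..<p} {x \<in> cells. orb x = c}"
  proof (rule bij_betw_imageI)
    show "inj_on f {..<p}" using P'_pos by (auto simp: inj_on_def f_def)
    show "f ` {..<p} = {x \<in> cells. orb x = c}"
    proof (intro equalityI subsetI)
      fix x assume "x \<in> {x \<in> cells. orb x = c}"
      then have x: "x = (y, snd x)" "snd x < P" "snd x mod P' = a" by (auto simp: cells_def orb_def c split: if_splits)
      then have "snd x = a + (snd x div P') * P'" by (metis mod_div_mult_eq)
      then have "x = f (snd x div P')" "snd x div P' < p" using x lt[of "snd x div P'"] by (auto simp: f_def)
      then show "x \<in> f ` {..<p}" by blast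
    next
      fix x assume "x \<in> f ` {..<p}"
      then obtain b where b: "b < p" "x = (y, a + b * P')" by (auto simp: f_def)
      moreover have "a + b * P' < P" using lt b(1) by simp
      moreover have "(a + b * P') mod P' = a" using c(3) by simp
      ultimately show "x \<in> {x \<in> cells. orb x = c}" using c by (simp add: cells_def orb_def)
    qed
  qed
  then have "(\<Sum>x\<in>{x \<in> cells. orb x = c}. cell x) = (\<Sum>b<p. cell (f b))"
    by (rule sum.reindex_bij_betw[symmetric])
  also have "\<dots> = (s ^^ a) (\<Sum>b<p. (s ^^ (b * P')) y)"
    by (simp add: additive.sum[OF additive_funpow[OF s]] cell_def f_def funpow_add)
  also have "\<dots> = 0" using s_cyclotomic Y_V[OF c(2)] by (simp add: V_def additive.zero[OF additive_funpow[OF s]])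
  finally show ?thesis .
qed

definition lam :: "('f \<Rightarrow>\<^sub>0 int) \<Rightarrow> ('f \<Rightarrow>\<^sub>0 int) \<times> nat \<Rightarrow> int" where
  "lam v x = Polynomial.coeff (coords v (fst x)) (snd x)"

lemma lam_add: "v \<in> V \<Longrightarrow> w \<in> V \<Longrightarrow> lam (v + w) x = lam v x + lam w x"
  by (simp add: lam_def coords_add)

lemma lam_support: "v \<in> V \<Longrightarrow> lam v x \<noteq> 0 \<Longrightarrow> fst x \<in> Y \<and> snd x < cyc_deg"
  using coords(1)[of v "fst x"] coords(2)[of v "fst x"] by (auto simp: lam_def small_def intro: ccontr)

lemma lam_expansion:
  assumes "v \<in> V" shows "(\<Sum>x\<in>cells. frag_cmul (lam v x) (cell x)) = frag_cmul q v"
proof -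
  have "Polynomial.coeff (coords v y) i = 0" if "P \<le> i" for y i
    using coords(1)[OF assms, of y] that by (simp add: small_def P_eq(2))
  then have "frag_cmul q v = (\<Sum>y\<in>Y. \<Sum>a<P. frag_cmul (lam v (y, a)) (cell (y, a)))"
    unfolding coords(3)[OF assms] comb_def by (intro sum.cong refl) (simp add: pa_eq_sum lam_def cell_def)
  then show ?thesis by (simp add: cells_def sum.cartesian_product)
qed

text \<open>For each y, the reduction by \<Phi> in \<open>coords_s\<close> subtracts a multiple of
  the indicator of the exponents divisible by P'. Among cells these form one orbit, so the failure
  of equivariance is constant on orbits.\<close>

lemma lam_rot:
  assumes "v \<in> V" obtains \<kappa> where "\<And>x. lam (s v) x = lam v (rot P x) + \<kappa> (orb x)"
proof
  define l where "l y = Polynomial.coeff (coords v y) (cyc_deg - 1)" for y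
  define \<kappa> where "\<kappa> c = (if snd c = 0 then - l (fst c) else 0)" for c :: "('f \<Rightarrow>\<^sub>0 int) \<times> nat"
  have sm: "Polynomial.coeff (coords v y) i = 0" if "cyc_deg \<le> i" for y i
    using coords(1)[OF assms, of y] that by (simp add: small_def)
  show "lam (s v) x = lam v (rot P x) + \<kappa> (orb x)" for x
  proof -
    obtain y a where x: "x = (y, a)" by (cases x)
    have lhs: "lam (s v) x = Polynomial.coeff (pCons 0 (coords v y)) a - l y * Polynomial.coeff \<Phi> a"
      by (simp add: lam_def coords_s[OF assms] x l_def)
    show ?thesis
    proof (cases "a < P")
      case True
      have dvd_le: "P' dvd a \<Longrightarrow> a \<le> cyc_deg"
      proof -
        assume "P' dvd a"
        then obtain b where b: "a = P' * b" by (rule dvdE)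
        then have "b < p" using True P'_pos by (simp add: P_eq(1) mult.commute)
        then have "b \<le> p - 1" by simp
        then show ?thesis by (simp add: b cyc_deg_def mult.commute)
      qed
      have "Polynomial.coeff (pCons 0 (coords v y)) a = lam v (rot P x)"
      proof (cases a)
        case 0
        \<comment> \<open>Exponent 0 rotates to P - 1, where small coordinates vanish.\<close>
        have "cyc_deg \<le> P - 1" using P_eq(2) P'_pos by simp
        then show ?thesis using 0 P_pos sm by (simp add: x rot_def lam_def)
      next
        case (Suc b)
        then have "(a + (P - 1)) mod P = b" using True by simp
        then show ?thesis using Suc True by (simp add: x rot_def lam_def)
      qed
      moreover have "l y * Polynomial.coeff \<Phi> a = - \<kappa> (orb x)"
        using True dvd_le by (auto simp: coeff_\<Phi> \<kappa>_def orb_def x dvd_eq_mod_eq_0)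
      ultimately show ?thesis using lhs by simp
    next
      case False
      then have a: "cyc_deg < a" using P_eq(2) P'_pos by simp
      then obtain b where b: "a = Suc b" by (cases a) auto
      then show ?thesis using False lhs a sm[of b y] sm[of a y] coeff_\<Phi>_cyc_deg(2)[OF a]
        by (simp add: x rot_def lam_def orb_def \<kappa>_def)
    qed
  qed
qed

text \<open>Small coordinates use exponents below (p - 1) P', hence only p - 1 cells of each orbit,
  and distinct entries meet an orbit fewer than p times. So the coordinate forms of wedges survive
  the truncation.\<close>

lemma wedges_lam_Good:
  assumes "set vs \<subseteq> V" "wedges lam vs xs \<noteq> 0" "length vs = j" shows "image_mset orb (mset xs) \<in> Good j"
proof -
  have dist: "distinct xs" using alternating_not_distinct[OF alternating_wedges] assms(2) by blast
  have supp: "length xs = j" "\<And>x. x \<in> set xs \<Longrightarrow> fst x \<in> Y \<and> snd x < cyc_deg"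
    using wedges_support[OF assms(2)] assms lam_support by (auto, blast+)
  have "card {x \<in> set xs. orb x = c} < p" for c
  proof -
    have "{x \<in> set xs. orb x = c} \<subseteq> (\<lambda>b. (fst c, snd c + b * P')) ` {..<p - 1}"
    proof
      fix x assume x: "x \<in> {x \<in> set xs. orb x = c}"
      then have lt: "snd x < cyc_deg" using supp by auto
      then have "snd x < P" using P_eq(2) by simp
      then have "c = (fst x, snd x mod P')" using x by (auto simp: orb_def)
      then have "x = (fst c, snd c + (snd x div P') * P')" by (simp add: prod_eq_iff)
      moreover have "snd x div P' < p - 1"
        using lt P'_pos by (simp add: cyc_deg_def div_less_iff_less_mult)
      ultimately show "x \<in> (\<lambda>b. (fst c, snd c + b * P')) ` {..<p - 1}" by blast
    qed
    then have "card {x \<in> set xs. orb x = c} \<le> p - 1"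
      using surj_card_le[of "{..<p - 1}"] by fastforce
    then show ?thesis using p_pos by simp
  qed
  moreover have "x \<in> cells" if "x \<in> set xs" for x
  proof -
    have "cyc_deg \<le> P" using P_eq(2) by simp
    then show ?thesis using supp(2)[OF that] less_le_trans by (auto simp: cells_def mem_Times_iff)
  qed
  then have "orb ` set xs \<subseteq> Orbs" using orb_cells by blast
  ultimately show ?thesis
    using supp(1) by (simp add: Good_def count_image_mset_distinct[OF dist] del: count_image_mset)
qed

end

section \<open>Comparison of the exterior power with the truncated Koszul complex\<close>

context prime_power_exterior
begin

sublocale kz: koszul_action orb "rot P" "rot P'" "Good j" Orbs "\<lambda>c. c" P j
  by (rule koszul_action)

lemma E_sum:
  assumes "set us \<subseteq> V" "set ws \<subseteq> V" "\<And>i. i \<in> I \<Longrightarrow> v i \<in> V"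
  shows "E (us @ (\<Sum>i\<in>I. v i) # ws) - (\<Sum>i\<in>I. E (us @ v i # ws)) \<in> R"
  using assms(3)
proof (induction I rule: infinite_finite_induct)
  case (insert i I)
  have "E (us @ (v i + (\<Sum>i\<in>I. v i)) # ws) - (E (us @ v i # ws) + E (us @ (\<Sum>i\<in>I. v i) # ws)) \<in> R"
    by (rule E_add) (use insert.prems assms in \<open>auto intro!: add_closed_sum[OF V]\<close>)
  moreover have "(E (us @ v i # ws) + E (us @ (\<Sum>i\<in>I. v i) # ws)) - (E (us @ v i # ws) + (\<Sum>i\<in>I. E (us @ v i # ws))) \<in> R"
    by (rule R_add) (use insert in auto)
  ultimately have "E (us @ (v i + (\<Sum>i\<in>I. v i)) # ws) - (E (us @ v i # ws) + (\<Sum>i\<in>I. E (us @ v i # ws))) \<in> R"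
    by (rule R_trans)
  then show ?case using insert.hyps by simp
qed (use E_zero[OF assms(1,2)] in auto)

lemma E_cmul:
  assumes "set us \<subseteq> V" "v \<in> V" "set ws \<subseteq> V"
  shows "E (us @ frag_cmul k v # ws) - frag_cmul k (E (us @ v # ws)) \<in> R"
proof -
  have nat: "E (us @ frag_cmul (int n) v # ws) - frag_cmul (int n) (E (us @ v # ws)) \<in> R" for n
    using E_sum[OF assms(1,3), of "{..<n}" "\<lambda>_. v"] assms(2)
    by (simp flip: frag_cmul_sum_left[of "\<lambda>_. 1", simplified])
  show ?thesis
  proof (cases "k \<ge> 0")
    case True
    then show ?thesis using nat[of "nat k"] by simp
  next
    case False
    let ?v = "frag_cmul (- k) v"
    have kv: "frag_cmul k v \<in> V" "?v \<in> V" by (rule add_closed_frag_cmul[OF V assms(2)])+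
    have "E (us @ 0 # ws) - (E (us @ frag_cmul k v # ws) + E (us @ ?v # ws)) \<in> R"
      using E_add[OF assms(1) kv assms(3)] by (simp flip: frag_cmul_distrib)
    then have 1: "E (us @ frag_cmul k v # ws) + E (us @ ?v # ws) \<in> R"
      using E_zero[OF assms(1,3)] add_closed_cancel[OF R R_swap] by blast
    have 2: "E (us @ ?v # ws) - frag_cmul (- k) (E (us @ v # ws)) \<in> R" using nat[of "nat (- k)"] False by simp
    have "E (us @ frag_cmul k v # ws) - frag_cmul k (E (us @ v # ws))
        = (E (us @ frag_cmul k v # ws) + E (us @ ?v # ws)) - (E (us @ ?v # ws) - frag_cmul (- k) (E (us @ v # ws)))"
      by (simp flip: minus_frag_cmul)
    also have "\<dots> \<in> R" using 1 2 by (rule add_closed_diff[OF R])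
    finally show ?thesis .
  qed
qed

lemma E_map_cmul: "set us \<subseteq> V \<Longrightarrow> set vs \<subseteq> V \<Longrightarrow>
    E (us @ map (frag_cmul k) vs) - frag_cmul (k ^ length vs) (E (us @ vs)) \<in> R"
proof (induction vs arbitrary: us)
  case (Cons v vs)
  have kv: "frag_cmul k v \<in> V" "set (map (frag_cmul k) vs) \<subseteq> V"
    using Cons.prems add_closed_frag_cmul[OF V] by auto
  have "E (us @ frag_cmul k v # map (frag_cmul k) vs) - frag_cmul k (E (us @ v # map (frag_cmul k) vs)) \<in> R"
    using Cons.prems kv by (intro E_cmul) auto
  moreover have "frag_cmul k (E ((us @ [v]) @ map (frag_cmul k) vs)) - frag_cmul k (frag_cmul (k ^ length vs) (E ((us @ [v]) @ vs))) \<in> R"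
    using Cons.prems by (intro R_cmul Cons.IH) auto
  ultimately show ?case using R_trans by simp
qed simp

abbreviation "ssum F \<phi> xs \<equiv> subset_sum cell F \<phi> xs"

lemma ssum_cong:
  assumes "set xs \<subseteq> cells" "\<And>zs. set zs \<subseteq> V \<Longrightarrow> F zs - F' zs \<in> R"
  shows "ssum F \<phi> xs - ssum F' \<phi> xs \<in> R"
  unfolding subset_sum_diff_fun[symmetric]
  by (rule subset_sum_closed[OF R]) (use assms cell_V in blast)

lemma ssum_R:
  assumes "set xs \<subseteq> cells" "\<And>zs. set zs \<subseteq> V \<Longrightarrow> F zs \<in> R"
  shows "ssum F \<phi> xs \<in> R"
  by (rule subset_sum_closed[OF R]) (use assms cell_V in blast)

text \<open>Moving a deleted entry to the front of the wedge absorbs the sign in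
  \<open>del_sum\<close>; the extra terms on the right, where z also occurs in the sublist, vanish
  by alternation.\<close>

lemma ssum_del_sum:
  assumes "distinct xs" "set xs \<subseteq> cells" "set us \<subseteq> V"
  shows "ssum (\<lambda>zs. E (us @ zs)) (del_sum f) xs - (\<Sum>z\<in>set xs. ssum (\<lambda>zs. E (us @ cell z # zs)) (f z) xs) \<in> R"
  using assms
proof (induction xs arbitrary: us f)
  case Nil
  then show ?case by simp
next
  case (Cons x xs)
  have x: "cell x \<in> V" "x \<notin> set xs" and xs: "distinct xs" "set xs \<subseteq> cells" and us: "set us \<subseteq> V"
    using Cons.prems cell_V[of x] by auto
  have xsV: "z \<in> set xs \<Longrightarrow> cell z \<in> V" for z using xs cell_V by blast
  let ?A = "\<lambda>z. ssum (\<lambda>zs. E (us @ cell z # zs)) (f z) xs"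
  let ?f = "\<lambda>z ys. f z (x # ys)"
  let ?C = "\<lambda>z. ssum (\<lambda>zs. E (us @ cell x # cell z # zs)) (?f z) xs"
  let ?C' = "\<lambda>z. ssum (\<lambda>zs. E (us @ cell z # cell x # zs)) (?f z) xs"
  have 1: "ssum (\<lambda>zs. E (us @ zs)) (del_sum f) xs - (\<Sum>z\<in>set xs. ?A z) \<in> R"
    by (rule Cons.IH[OF xs us])
  have 2: "ssum (\<lambda>zs. E (us @ cell x # zs)) (del_sum ?f) xs - (\<Sum>z\<in>set xs. ?C z) \<in> R"
    using Cons.IH[OF xs, of "us @ [cell x]" ?f] us x by simp
  have 3: "?C z - - ?C' z \<in> R" if "z \<in> set xs" for z
  proof -
    have "?C z - ssum (\<lambda>zs. frag_cmul (-1) (E (us @ cell z # cell x # zs))) (?f z) xs \<in> R"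
      by (rule ssum_cong[OF xs(2)]) (use E_swap us x xsV[OF that] in auto)
    then show ?thesis unfolding subset_sum_cmul_fun by simp
  qed
  have 4: "?C' x \<in> R" by (rule ssum_R[OF xs(2)]) (use us x in \<open>auto intro!: E_alt\<close>)
  have "(\<Sum>z\<in>set xs. ?C z) - (\<Sum>z\<in>set xs. - ?C' z) \<in> R" by (intro R_sum 3)
  then have 5: "(\<Sum>z\<in>set xs. ?C z) + (\<Sum>z\<in>set xs. ?C' z) \<in> R" by (simp add: sum_negf)
  have lhs: "ssum (\<lambda>zs. E (us @ zs)) (del_sum f) (x # xs)
     = ssum (\<lambda>zs. E (us @ zs)) (del_sum f) xs + (?A x - ssum (\<lambda>zs. E (us @ cell x # zs)) (del_sum ?f) xs)"
    by (simp add: subset_sum_diff)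
  have rhs: "(\<Sum>z\<in>set (x # xs). ssum (\<lambda>zs. E (us @ cell z # zs)) (f z) (x # xs))
     = ?A x + ?C' x + ((\<Sum>z\<in>set xs. ?A z) + (\<Sum>z\<in>set xs. ?C' z))"
    using x(2) by (simp add: sum.distrib)
  have "ssum (\<lambda>zs. E (us @ zs)) (del_sum f) (x # xs) - (\<Sum>z\<in>set (x # xs). ssum (\<lambda>zs. E (us @ cell z # zs)) (f z) (x # xs))
     = (ssum (\<lambda>zs. E (us @ zs)) (del_sum f) xs - (\<Sum>z\<in>set xs. ?A z))
       - (ssum (\<lambda>zs. E (us @ cell x # zs)) (del_sum ?f) xs - (\<Sum>z\<in>set xs. ?C z))
       - ((\<Sum>z\<in>set xs. ?C z) + (\<Sum>z\<in>set xs. ?C' z)) - ?C' x"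
    unfolding lhs rhs by (simp add: algebra_simps)
  also have "\<dots> \<in> R" by (intro add_closed_diff R 1 2 4 5)
  finally show ?case .
qed

text \<open>An adjacent swap changes the sign of both \<phi> and E.\<close>

lemma ssum_permute:
  assumes "mset xs = mset ys" "set xs \<subseteq> cells" "alternating \<phi>" "set us \<subseteq> V"
  shows "ssum (\<lambda>zs. E (us @ zs)) \<phi> xs - ssum (\<lambda>zs. E (us @ zs)) \<phi> ys \<in> R"
proof -
  define Q where "Q xs ys \<longleftrightarrow> set xs = set ys \<and> (set xs \<subseteq> cells \<longrightarrow> (\<forall>\<phi> us. alternating \<phi> \<longrightarrow> set us \<subseteq> V \<longrightarrow>
    ssum (\<lambda>zs. E (us @ zs)) \<phi> xs - ssum (\<lambda>zs. E (us @ zs)) \<phi> ys \<in> R))" for xs ys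
  have "Q xs ys"
  proof (rule mset_eq_swaps[OF assms(1)])
    show "Q xs xs" for xs by (simp add: Q_def)
    show "Q xs zs" if "Q xs ys" "Q ys zs" for xs ys zs using that R_trans unfolding Q_def by blast
  next
    fix x y zs assume sub: "set (x # y # zs) \<subseteq> set xs"
    show "Q (x # y # zs) (y # x # zs)" unfolding Q_def
    proof (intro conjI impI allI)
      fix \<phi> :: "('a \<Rightarrow>\<^sub>0 int) \<times> nat \<Rightarrow> _" and us
      show "set (x # y # zs) = set (y # x # zs)" by auto
    next
      fix \<phi> :: "(('a \<Rightarrow>\<^sub>0 int) \<times> nat) list \<Rightarrow> int" and us :: "('a \<Rightarrow>\<^sub>0 int) list"
      assume \<phi>: "alternating \<phi>" and us: "set us \<subseteq> V"
      have xyz: "cell x \<in> V" "cell y \<in> V" "set zs \<subseteq> cells" using sub assms(2) cell_V[of x] cell_V[of y] by auto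
      have "(\<lambda>ys. \<phi> (x # y # ys)) = (\<lambda>ys. -1 * \<phi> (y # x # ys))"
        using alternatingD[OF \<phi>, of "[]" x y] by auto
      then have e: "ssum F (\<lambda>ys. \<phi> (x # y # ys)) zs = frag_cmul (-1) (ssum F (\<lambda>ys. \<phi> (y # x # ys)) zs)" for F
        by (simp only: subset_sum_scale)
      let ?a = "ssum (\<lambda>zs. E (us @ cell x # cell y # zs)) (\<lambda>ys. \<phi> (y # x # ys)) zs"
      let ?b = "ssum (\<lambda>zs. E (us @ cell y # cell x # zs)) (\<lambda>ys. \<phi> (y # x # ys)) zs"
      have "?b - ssum (\<lambda>zs. frag_cmul (-1) (E (us @ cell x # cell y # zs))) (\<lambda>ys. \<phi> (y # x # ys)) zs \<in> R"
        by (rule ssum_cong[OF xyz(3)]) (use E_swap us xyz in auto)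
      then have "?b + ?a \<in> R" unfolding subset_sum_cmul_fun by simp
      then have "- (?b + ?a) \<in> R" by (rule add_closed_minus[OF R])
      then show "ssum (\<lambda>zs. E (us @ zs)) \<phi> (x # y # zs) - ssum (\<lambda>zs. E (us @ zs)) \<phi> (y # x # zs) \<in> R"
        by (simp add: e algebra_simps)
    qed
  next
    fix x xs ys assume Q: "Q xs ys"
    show "Q (x # xs) (x # ys)" unfolding Q_def
    proof (intro conjI impI allI)
      show "set (x # xs) = set (x # ys)" using Q by (simp add: Q_def)
      fix \<phi> :: "(('a \<Rightarrow>\<^sub>0 int) \<times> nat) list \<Rightarrow> int" and us :: "('a \<Rightarrow>\<^sub>0 int) list"
      assume \<phi>: "alternating \<phi>" and us: "set us \<subseteq> V" and sub: "set (x # xs) \<subseteq> cells"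
      then have "set (us @ [cell x]) \<subseteq> V" "set xs \<subseteq> cells" using cell_V[of x] by auto
      then have "ssum (\<lambda>zs. E ((us @ [cell x]) @ zs)) (\<lambda>ys. \<phi> (x # ys)) xs - ssum (\<lambda>zs. E ((us @ [cell x]) @ zs)) (\<lambda>ys. \<phi> (x # ys)) ys \<in> R"
        using Q alternating_Cons[OF \<phi>, of x] unfolding Q_def by blast
      moreover have "ssum (\<lambda>zs. E (us @ zs)) \<phi> xs - ssum (\<lambda>zs. E (us @ zs)) \<phi> ys \<in> R"
        using Q \<phi> us sub unfolding Q_def by auto
      ultimately show "ssum (\<lambda>zs. E (us @ zs)) \<phi> (x # xs) - ssum (\<lambda>zs. E (us @ zs)) \<phi> (x # ys) \<in> R"
        using R_add by simp
    qed
  qed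
  then show ?thesis using assms unfolding Q_def by blast
qed

text \<open>Each vector is reassembled from the cells by \<open>lam_expansion\<close>, which returns
  q v instead of v.\<close>

lemma ssum_wedges:
  assumes "distinct xs" "set xs = cells" "set us \<subseteq> V" "set vs \<subseteq> V"
  shows "ssum (\<lambda>zs. E (us @ zs)) (wedges lam vs) xs - E (us @ map (frag_cmul q) vs) \<in> R"
  using assms(3,4)
proof (induction vs arbitrary: us)
  case Nil
  have "ssum F (\<lambda>ys. if ys = [] then 1 else 0) xs = F []" for F :: "('a \<Rightarrow>\<^sub>0 int) list \<Rightarrow> 'e \<Rightarrow>\<^sub>0 int" and xs
    by (induction xs arbitrary: F) auto
  then show ?case by simp
next
  case (Cons v vs)
  have v: "v \<in> V" "set vs \<subseteq> V" "set us \<subseteq> V" using Cons.prems by auto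
  have qvs: "set (map (frag_cmul q) vs) \<subseteq> V" using v add_closed_frag_cmul[OF V] by auto
  have cellV: "z \<in> set xs \<Longrightarrow> cell z \<in> V" for z using assms(2) cell_V by blast
  have 1: "ssum (\<lambda>zs. E (us @ zs)) (wedges lam (v # vs)) xs
      - (\<Sum>z\<in>set xs. ssum (\<lambda>zs. E (us @ cell z # zs)) (\<lambda>ys. lam v z * wedges lam vs ys) xs) \<in> R"
    unfolding wedges.simps wedge_def by (rule ssum_del_sum) (use assms v in auto)
  have "ssum (\<lambda>zs. E (us @ cell z # zs)) (\<lambda>ys. lam v z * wedges lam vs ys) xs
      - E (us @ frag_cmul (lam v z) (cell z) # map (frag_cmul q) vs) \<in> R" if z: "z \<in> set xs" for z
  proof -
    have "frag_cmul (lam v z) (ssum (\<lambda>zs. E ((us @ [cell z]) @ zs)) (wedges lam vs) xs)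
        - frag_cmul (lam v z) (E ((us @ [cell z]) @ map (frag_cmul q) vs)) \<in> R"
      using v cellV[OF z] by (intro R_cmul Cons.IH) auto
    moreover have "frag_cmul (lam v z) (E (us @ cell z # map (frag_cmul q) vs))
        - E (us @ frag_cmul (lam v z) (cell z) # map (frag_cmul q) vs) \<in> R"
      by (rule R_swap[OF E_cmul[OF v(3) cellV[OF z] qvs]])
    ultimately show ?thesis unfolding subset_sum_scale using R_trans by simp
  qed
  then have 2: "(\<Sum>z\<in>set xs. ssum (\<lambda>zs. E (us @ cell z # zs)) (\<lambda>ys. lam v z * wedges lam vs ys) xs)
      - (\<Sum>z\<in>set xs. E (us @ frag_cmul (lam v z) (cell z) # map (frag_cmul q) vs)) \<in> R"
    by (rule R_sum)
  have 3: "(\<Sum>z\<in>set xs. E (us @ frag_cmul (lam v z) (cell z) # map (frag_cmul q) vs))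
      - E (us @ (\<Sum>z\<in>set xs. frag_cmul (lam v z) (cell z)) # map (frag_cmul q) vs) \<in> R"
    by (rule R_swap[OF E_sum[OF v(3) qvs]]) (use cellV add_closed_frag_cmul[OF V] in auto)
  have 4: "(\<Sum>z\<in>set xs. frag_cmul (lam v z) (cell z)) = frag_cmul q v"
    unfolding assms(2) by (rule lam_expansion[OF v(1)])
  show ?case using R_trans[OF R_trans[OF 1 2] 3] by (simp only: 4 list.simps(9))
qed

definition "cell_list = (SOME xs. set xs = cells \<and> distinct xs)"

lemma cell_list: "set cell_list = cells" "distinct cell_list"
proof -
  have "finite cells" using finite_Y by (simp add: cells_def)
  then have "\<exists>xs. set xs = cells \<and> distinct xs" by (rule finite_distinct_list)
  from someI_ex[OF this] show "set cell_list = cells" "distinct cell_list" by (simp_all add: cell_list_def)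
qed

definition realise :: "((('a \<Rightarrow>\<^sub>0 int) \<times> nat) multiset \<Rightarrow> (('a \<Rightarrow>\<^sub>0 int) \<times> nat) list \<Rightarrow> int) \<Rightarrow> 'e \<Rightarrow>\<^sub>0 int" where
  "realise \<phi> = ssum E (\<phi> {#}) cell_list"

lemma additive_realise: "additive realise"
  by (simp add: additive_def realise_def plus_fun_def subset_sum_add)

lemma realise_A: "realise \<phi> \<in> A"
  unfolding realise_def by (rule subset_sum_closed[OF A]) (use E_A cell_V cell_list in blast)

text \<open>Grouping the cells by orbit puts an orbit sum into one slot of every term, and orbit
  sums vanish in V.\<close>

lemma realise_bdry: "\<phi> \<in> kz.bdry 0 \<Longrightarrow> realise \<phi> \<in> R"
proof -
  assume "\<phi> \<in> kz.bdry 0"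
  then obtain \<eta> where \<eta>: "\<phi> = koszul_d orb \<eta>" by (auto simp: kz.bdry_def)
  let ?e = "\<lambda>c z. ssum (\<lambda>zs. E (cell z # zs)) (\<eta> {#c#}) cell_list"
  have "realise \<phi> - (\<Sum>z\<in>set cell_list. ?e (orb z) z) \<in> R"
    unfolding realise_def \<eta> koszul_d_def
    using ssum_del_sum[of cell_list "[]" "\<lambda>x. \<eta> {#orb x#}"] cell_list by simp
  moreover have "(\<Sum>z\<in>set cell_list. ?e (orb z) z) \<in> R"
  proof -
    have "(\<Sum>z\<in>set cell_list. ?e (orb z) z) = (\<Sum>c\<in>Orbs. \<Sum>z\<in>{z \<in> cells. orb z = c}. ?e (orb z) z)"
      unfolding cell_list(1)
    proof (rule sum.group[symmetric])
      show "finite cells" "finite Orbs" using finite_Y by (simp_all add: cells_def Orbs_def)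
      show "orb ` cells \<subseteq> Orbs" using orb_cells by blast
    qed
    also have "\<dots> = (\<Sum>c\<in>Orbs. ssum (\<lambda>zs. \<Sum>z\<in>{z \<in> cells. orb z = c}. E (cell z # zs)) (\<eta> {#c#}) cell_list)"
      unfolding subset_sum_sum_fun by (intro sum.cong refl) auto
    also have "\<dots> \<in> R"
    proof (rule add_closed_sum[OF R], rule ssum_R)
      fix c and zs :: "('a \<Rightarrow>\<^sub>0 int) list" assume c: "c \<in> Orbs" and zs: "set zs \<subseteq> V"
      have "E ([] @ (\<Sum>z\<in>{z \<in> cells. orb z = c}. cell z) # zs) - (\<Sum>z\<in>{z \<in> cells. orb z = c}. E ([] @ cell z # zs)) \<in> R"
        by (rule E_sum) (use zs cell_V in auto)
      then have "E ([] @ 0 # zs) - (\<Sum>z\<in>{z \<in> cells. orb z = c}. E (cell z # zs)) \<in> R"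
        by (simp add: orbit_sum[OF c])
      moreover have "E ([] @ 0 # zs) \<in> R" by (rule E_zero) (use zs in auto)
      ultimately show "(\<Sum>z\<in>{z \<in> cells. orb z = c}. E (cell z # zs)) \<in> R"
        by (rule add_closed_cancel[OF R R_swap])
    qed (simp add: cell_list)
    finally show ?thesis .
  qed
  ultimately show ?thesis by (rule add_closed_cancel[OF R])
qed

text \<open>Rotation only permutes the list of cells, and s undoes it on each cell.\<close>

lemma realise_shift:
  assumes "\<phi> \<in> kz.K 0" shows "realise (kz.shift \<phi>) - \<sigma> (realise \<phi>) \<in> R"
proof -
  have "inj_on (rot P) cells" using rot_inj[OF P_pos] by (rule inj_on_subset) simp
  then have dist: "distinct (map (rot P) cell_list)" by (simp add: distinct_map cell_list)
  have rot_image: "rot P ` cells = cells"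
  proof (rule endo_inj_surj)
    show "finite cells" using finite_Y by (simp add: cells_def)
    show "rot P ` cells \<subseteq> cells" using rot_cells by blast
  qed fact
  then have mset: "mset (map (rot P) cell_list) = mset cell_list"
    using dist cell_list by (simp only: set_eq_iff_mset_eq_distinct[symmetric] set_map)
  have "\<sigma> (ssum E (\<phi> {#}) (map (rot P) cell_list)) = ssum E (\<lambda>ys. \<phi> {#} (map (rot P) ys)) cell_list"
  proof (rule subset_sum_hom[OF \<sigma>])
    show "\<sigma> (E zs) = E (map s zs)" if "set zs \<subseteq> cell ` rot P ` set cell_list" for zs
    proof (rule \<sigma>_E)
      show "set zs \<subseteq> V" using that cell_list(1) rot_cells cell_V by blast
    qed
  qed (use s_cell_rot cell_list in auto)
  moreover have "ssum E (\<phi> {#}) (map (rot P) cell_list) - ssum E (\<phi> {#}) cell_list \<in> R"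
    using ssum_permute[OF mset, of "\<phi> {#}" "[]"] koszulD(1)[OF assms] cell_list rot_image by simp
  then have "\<sigma> (ssum E (\<phi> {#}) (map (rot P) cell_list)) - \<sigma> (ssum E (\<phi> {#}) cell_list) \<in> R"
    using submodule_pairD(6)[OF AR] by (simp flip: additive.diff[OF \<sigma>])
  ultimately show ?thesis by (simp add: realise_def kz.shift_def)
qed

text \<open>The coefficient at the wedge monomial xs, as a functional obtained from the universal
  property.\<close>

definition expand :: "(('a \<Rightarrow>\<^sub>0 int) \<times> nat) list \<Rightarrow> ('e \<Rightarrow>\<^sub>0 int) \<Rightarrow> int" where
  "expand xs = (SOME g. additive g \<and> (\<forall>vs. set vs \<subseteq> V \<longrightarrow> length vs = j \<longrightarrow> g (E vs) = wedges lam vs xs) \<and> (\<forall>c\<in>R. g c = 0))"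

lemma expand:
  shows additive_expand: "additive (expand xs)"
    and expand_E: "set vs \<subseteq> V \<Longrightarrow> length vs = j \<Longrightarrow> expand xs (E vs) = wedges lam vs xs"
    and expand_R: "c \<in> R \<Longrightarrow> expand xs c = 0"
proof -
  have "\<exists>g. additive g \<and> (\<forall>vs. set vs \<subseteq> V \<longrightarrow> length vs = j \<longrightarrow> g (E vs) = wedges lam vs xs) \<and> (\<forall>c\<in>R. g c = 0)"
  proof (rule A_univ)
    show "wedges lam (us @ (v + w) # ws) xs = wedges lam (us @ v # ws) xs + wedges lam (us @ w # ws) xs"
      if "v \<in> V" "w \<in> V" for us v w ws by (rule wedges_add) (rule lam_add[OF that])
    show "wedges lam vs xs = 0" if "\<not> distinct vs" for vs
      by (rule alternating_not_distinct[OF wedges_swap that])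
  qed
  from someI_ex[OF this] show "additive (expand xs)"
    "set vs \<subseteq> V \<Longrightarrow> length vs = j \<Longrightarrow> expand xs (E vs) = wedges lam vs xs" "c \<in> R \<Longrightarrow> expand xs c = 0"
    by (simp_all add: expand_def)
qed

definition to_koszul :: "((('a \<Rightarrow>\<^sub>0 int) \<times> nat) list \<Rightarrow> int) \<Rightarrow> (('a \<Rightarrow>\<^sub>0 int) \<times> nat) multiset \<Rightarrow> (('a \<Rightarrow>\<^sub>0 int) \<times> nat) list \<Rightarrow> int" where
  "to_koszul \<omega> = (\<lambda>\<alpha> xs. if \<alpha> = {#} then \<omega> xs else 0)"

definition expansion :: "('e \<Rightarrow>\<^sub>0 int) \<Rightarrow> (('a \<Rightarrow>\<^sub>0 int) \<times> nat) multiset \<Rightarrow> (('a \<Rightarrow>\<^sub>0 int) \<times> nat) list \<Rightarrow> int" where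
  "expansion c = to_koszul (\<lambda>xs. expand xs c)"

lemma additive_expansion: "additive expansion"
  by (auto simp: additive_def expansion_def to_koszul_def fun_eq_iff additive.add[OF additive_expand])

lemma expansion_E: "set vs \<subseteq> V \<Longrightarrow> length vs = j \<Longrightarrow> expansion (E vs) = to_koszul (wedges lam vs)"
  by (simp add: expansion_def expand_E)

lemma A_induct [consumes 1]:
  assumes "c \<in> A" "Q 0" "\<And>c d. Q c \<Longrightarrow> Q d \<Longrightarrow> Q (c - d)" "\<And>vs. set vs \<subseteq> V \<Longrightarrow> length vs = j \<Longrightarrow> Q (E vs)"
  shows "Q c"
proof -
  have "add_closed {c. Q c}" using assms(2,3) by (simp add: add_closed_def)
  then have "A \<subseteq> {c. Q c}" by (rule A_gen) (use assms(4) in auto)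
  then show ?thesis using assms(1) by blast
qed

lemma to_koszul_K:
  "alternating \<omega> \<Longrightarrow> (\<And>xs. \<omega> xs \<noteq> 0 \<Longrightarrow> image_mset orb (mset xs) \<in> Good j) \<Longrightarrow> to_koszul \<omega> \<in> kz.K 0"
proof (rule koszulI)
  assume \<omega>: "alternating \<omega>"
  show "alternating (to_koszul \<omega> \<alpha>)" for \<alpha>
    using \<omega> by (cases "\<alpha> = {#}") (simp_all add: to_koszul_def)
qed (auto simp: to_koszul_def split: if_splits)

lemma expansion_K: "c \<in> A \<Longrightarrow> expansion c \<in> kz.K 0"
proof (induction rule: A_induct)
  case 1
  show ?case unfolding additive.zero[OF additive_expansion] by (rule add_closed_zero[OF add_closed_koszul])
next
  case (2 c d)
  then show ?case unfolding additive.diff[OF additive_expansion] by (rule add_closed_diff[OF add_closed_koszul])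
next
  case (3 vs)
  then show ?case unfolding expansion_E[OF 3]
    by (intro to_koszul_K alternating_wedges wedges_lam_Good)
qed

lemma expansion_R: "c \<in> R \<Longrightarrow> expansion c = 0"
  by (auto simp: expansion_def to_koszul_def fun_eq_iff expand_R)

text \<open>Each of the j vectors picks up one factor q.\<close>

lemma realise_expansion: "c \<in> A \<Longrightarrow> realise (expansion c) - frag_cmul (q ^ j) c \<in> R"
proof (induction rule: A_induct)
  case 1
  show ?case unfolding additive.zero[OF additive_expansion] additive.zero[OF additive_realise] by simp
next
  case (2 c d)
  have "(realise (expansion c) - frag_cmul (q ^ j) c) - (realise (expansion d) - frag_cmul (q ^ j) d) \<in> R"
    using 2 by (rule add_closed_diff[OF R])
  moreover have "realise (expansion (c - d)) - frag_cmul (q ^ j) (c - d)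
      = (realise (expansion c) - frag_cmul (q ^ j) c) - (realise (expansion d) - frag_cmul (q ^ j) d)"
    by (simp only: additive.diff[OF additive_expansion] additive.diff[OF additive_realise] frag_cmul_diff_distrib2)
      (simp only: algebra_simps)
  ultimately show ?case by (simp only:)
next
  case (3 vs)
  have "realise (expansion (E vs)) - E (map (frag_cmul q) vs) \<in> R"
    using ssum_wedges[OF cell_list(2,1), of "[]" vs] 3 by (simp add: realise_def expansion_E to_koszul_def)
  moreover have "E (map (frag_cmul q) vs) - frag_cmul (q ^ j) (E vs) \<in> R"
    using E_map_cmul[of "[]" vs q] 3 by simp
  ultimately show ?case by (rule R_trans)
qed

text \<open>Boundaries of the untruncated Koszul complex in symmetric degree 0, that is, the ideal
  generated by the orbit sums. \<open>Good j\<close> fixes the total degree, whereas the induction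
  on the factors passes through shorter products; the truncation is restored afterwards.\<close>

definition exact_forms :: "((('a \<Rightarrow>\<^sub>0 int) \<times> nat) list \<Rightarrow> int) set" where
  "exact_forms = {\<omega>. \<exists>\<eta>. (\<forall>c. alternating (\<eta> c)) \<and> \<omega> = del_sum (\<lambda>x. \<eta> (orb x))}"

lemma exact_forms_add: "\<omega> \<in> exact_forms \<Longrightarrow> \<omega>' \<in> exact_forms \<Longrightarrow> (\<lambda>xs. \<omega> xs + \<omega>' xs) \<in> exact_forms"
proof -
  assume "\<omega> \<in> exact_forms" "\<omega>' \<in> exact_forms"
  then obtain \<eta> \<eta>' where \<eta>: "\<And>c. alternating (\<eta> c)" "\<omega> = del_sum (\<lambda>x. \<eta> (orb x))"
    "\<And>c. alternating (\<eta>' c)" "\<omega>' = del_sum (\<lambda>x. \<eta>' (orb x))" by (auto simp: exact_forms_def)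
  have "alternating (\<lambda>xs. \<eta> c xs - - 1 * \<eta>' c xs)" for c
    by (intro alternating_diff alternating_scale \<eta>)
  then show ?thesis
    unfolding exact_forms_def \<eta>(2,4)
    by (intro CollectI exI[of _ "\<lambda>c xs. \<eta> c xs + \<eta>' c xs"]) (auto simp: del_sum_add)
qed

lemma exact_forms_wedge: "\<omega> \<in> exact_forms \<Longrightarrow> wedge w \<omega> \<in> exact_forms"
proof -
  assume "\<omega> \<in> exact_forms"
  then obtain \<eta> where \<eta>: "\<And>c. alternating (\<eta> c)" "\<omega> = del_sum (\<lambda>x. \<eta> (orb x))" by (auto simp: exact_forms_def)
  have mult: "additive (\<lambda>z. k * z)" for k :: int by (simp add: additive_def distrib_left)
  have "wedge w \<omega> xs = del_sum (\<lambda>x ys. -1 * wedge w (\<eta> (orb x)) ys) xs" for xs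
  proof -
    have "wedge w \<omega> xs = del_sum (\<lambda>x. del_sum (\<lambda>y zs. w x * \<eta> (orb y) zs)) xs"
      unfolding wedge_def \<eta>(2) del_sum_additive[OF mult] ..
    also have "\<dots> = - del_sum (\<lambda>x. del_sum (\<lambda>y zs. w y * \<eta> (orb x) zs)) xs" by (rule del_sum_del_sum)
    also have "\<dots> = del_sum (\<lambda>x ys. -1 * wedge w (\<eta> (orb x)) ys) xs"
      unfolding del_sum_additive[OF mult, symmetric] wedge_def by simp
    finally show ?thesis .
  qed
  then show ?thesis
    unfolding exact_forms_def
    by (intro CollectI exI[of _ "\<lambda>c ys. -1 * wedge w (\<eta> c) ys"] conjI allI alternating_scale alternating_wedge \<eta>) auto
qed

text \<open>The differential preserves the multidegree, so the part of \<eta> outside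
  \<open>Good\<close> can be discarded.\<close>

lemma exact_forms_bdry:
  assumes "\<omega> \<in> exact_forms" "to_koszul \<omega> \<in> kz.K 0" shows "to_koszul \<omega> \<in> kz.bdry 0"
proof -
  obtain \<eta> where \<eta>: "\<And>c. alternating (\<eta> c)" "\<omega> = del_sum (\<lambda>x. \<eta> (orb x))" using assms(1) by (auto simp: exact_forms_def)
  define good where "good c ys \<longleftrightarrow> add_mset c (image_mset orb (mset ys)) \<in> Good j" for c ys
  \<comment> \<open>A sum with at most one term: it recovers c from the singleton \<alpha>.\<close>
  define \<theta> where "\<theta> = (\<lambda>\<alpha> ys. \<Sum>c | \<alpha> = {#c#}. if good c ys then \<eta> c ys else 0)"
  have \<theta>1: "\<theta> {#c#} = (\<lambda>ys. if good c ys then \<eta> c ys else 0)" for c by (auto simp: \<theta>_def)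
  have \<theta>0: "\<theta> \<alpha> = (\<lambda>ys. 0)" if "\<And>c. \<alpha> \<noteq> {#c#}" for \<alpha> using that by (auto simp: \<theta>_def)
  have "\<theta> \<in> kz.K (Suc 0)"
  proof (rule koszulI)
    fix \<alpha>
    show "alternating (\<theta> \<alpha>)"
    proof (cases "\<exists>c. \<alpha> = {#c#}")
      case True
      then obtain c where c: "\<alpha> = {#c#}" by blast
      show ?thesis
        unfolding alternating_def c \<theta>1
      proof (intro allI)
        fix us x y vs
        have "good c (us @ x # y # vs) = good c (us @ y # x # vs)" by (simp add: good_def add_mset_commute)
        then show "(if good c (us @ x # y # vs) then \<eta> c (us @ x # y # vs) else 0) =
            - (if good c (us @ y # x # vs) then \<eta> c (us @ y # x # vs) else 0)"
          using alternatingD[OF \<eta>(1), of c us x y vs] by simp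
      qed
    next
      case False
      then have "\<theta> \<alpha> = (\<lambda>ys. 0)" by (intro \<theta>0) blast
      then show ?thesis by simp
    qed
    fix xs assume nz: "\<theta> \<alpha> xs \<noteq> 0"
    then obtain c where c: "\<alpha> = {#c#}" using \<theta>0 by metis
    then show "size \<alpha> = Suc 0 \<and> \<alpha> + image_mset orb (mset xs) \<in> Good j"
      using nz by (simp add: \<theta>1 good_def split: if_splits)
  qed
  moreover have "koszul_d orb \<theta> = to_koszul \<omega>"
  proof (intro ext)
    fix \<alpha> xs
    show "koszul_d orb \<theta> \<alpha> xs = to_koszul \<omega> \<alpha> xs"
    proof (cases "\<alpha> = {#}")
      case True
      have "koszul_d orb \<theta> {#} xs = del_sum (\<lambda>x ys. if image_mset orb (mset xs) \<in> Good j then \<eta> (orb x) ys else 0) xs"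
        unfolding koszul_d_def \<theta>1 by (rule del_sum_cong) (simp add: good_def)
      also have "\<dots> = \<omega> xs"
      proof (cases "image_mset orb (mset xs) \<in> Good j")
        case True
        then show ?thesis by (simp add: \<eta>(2))
      next
        case False
        then show ?thesis using koszulD(3)[OF assms(2), of "{#}" xs] by (auto simp: to_koszul_def)
      qed
      finally show ?thesis by (simp add: True to_koszul_def)
    next
      case False
      then have "\<theta> (add_mset (orb x) \<alpha>) = (\<lambda>ys. 0)" for x by (intro \<theta>0) auto
      then show ?thesis using False by (simp add: koszul_d_def to_koszul_def)
    qed
  qed
  ultimately show ?thesis unfolding kz.bdry_def by (metis image_eqI)
qed

lemma wedge_rot: "wedge w \<omega> (map h xs) = wedge (\<lambda>x. w (h x)) (\<lambda>ys. \<omega> (map h ys)) xs"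
  by (simp add: wedge_def del_sum_map)

text \<open>Change the factors one at a time: by \<open>lam_rot\<close> each change is a form
  constant on orbits, whose product with an alternating form lies in the ideal of the orbit
  sums.\<close>

lemma wedges_s_exact:
  "set vs \<subseteq> V \<Longrightarrow> (\<lambda>xs. wedges lam (map s vs) xs - wedges lam vs (map (rot P) xs)) \<in> exact_forms"
proof (induction vs)
  case Nil
  have "(\<lambda>xs. wedges lam (map s []) xs - wedges lam [] (map (rot P) xs)) = del_sum (\<lambda>x ys. 0)" by (auto simp: fun_eq_iff)
  then show ?case unfolding exact_forms_def by (intro CollectI exI[of _ "\<lambda>c ys. 0"]) simp
next
  case (Cons v vs)
  obtain \<kappa> where \<kappa>: "\<And>x. lam (s v) x = lam v (rot P x) + \<kappa> (orb x)"
    using lam_rot[of v] Cons.prems by auto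
  let ?W = "wedges lam (map s vs)" and ?W' = "\<lambda>xs. wedges lam vs (map (rot P) xs)"
  have "wedge (\<lambda>x. \<kappa> (orb x)) ?W \<in> exact_forms"
    unfolding exact_forms_def wedge_def
    by (intro CollectI exI[of _ "\<lambda>c ys. \<kappa> c * ?W ys"]) (auto intro: alternating_scale alternating_wedges)
  moreover have "wedge (\<lambda>x. lam v (rot P x)) (\<lambda>xs. ?W xs - ?W' xs) \<in> exact_forms"
    using Cons by (intro exact_forms_wedge) auto
  ultimately have "(\<lambda>xs. wedge (\<lambda>x. \<kappa> (orb x)) ?W xs + wedge (\<lambda>x. lam v (rot P x)) (\<lambda>xs. ?W xs - ?W' xs) xs) \<in> exact_forms"
    by (rule exact_forms_add)
  moreover have "wedges lam (map s (v # vs)) xs - wedges lam (v # vs) (map (rot P) xs)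
      = wedge (\<lambda>x. \<kappa> (orb x)) ?W xs + wedge (\<lambda>x. lam v (rot P x)) (\<lambda>xs. ?W xs - ?W' xs) xs" for xs
  proof -
    have "lam (s v) = (\<lambda>x. lam v (rot P x) + \<kappa> (orb x))" using \<kappa> by auto
    then show ?thesis by (simp add: wedge_add_left wedge_diff_right wedge_rot)
  qed
  ultimately show ?case by simp
qed

lemma expansion_shift: "c \<in> A \<Longrightarrow> expansion (\<sigma> c) - kz.shift (expansion c) \<in> kz.bdry 0"
proof (induction rule: A_induct)
  note bdry = submodule_pairD(2)[OF kz.submodule_pair_bdry[of 0]]
  case 1
  show ?case
    unfolding additive.zero[OF additive_expansion] additive.zero[OF \<sigma>] additive.zero[OF kz.additive_shift] diff_zero
    by (rule add_closed_zero[OF bdry])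
next
  note bdry = submodule_pairD(2)[OF kz.submodule_pair_bdry[of 0]]
  case (2 c d)
  have "(expansion (\<sigma> c) - kz.shift (expansion c)) - (expansion (\<sigma> d) - kz.shift (expansion d)) \<in> kz.bdry 0"
    using 2 by (rule add_closed_diff[OF bdry])
  moreover have "expansion (\<sigma> (c - d)) - kz.shift (expansion (c - d))
      = (expansion (\<sigma> c) - kz.shift (expansion c)) - (expansion (\<sigma> d) - kz.shift (expansion d))"
    by (simp only: additive.diff[OF additive_expansion] additive.diff[OF \<sigma>] additive.diff[OF kz.additive_shift]) (simp only: algebra_simps)
  ultimately show ?case by (simp only:)
next
  case (3 vs)
  let ?\<omega> = "\<lambda>xs. wedges lam (map s vs) xs - wedges lam vs (map (rot P) xs)"
  have sv: "set (map s vs) \<subseteq> V" "length (map s vs) = j" using 3 s_V by auto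
  have e: "expansion (\<sigma> (E vs)) - kz.shift (expansion (E vs)) = to_koszul ?\<omega>"
    unfolding \<sigma>_E[OF 3(1)] expansion_E[OF 3] expansion_E[OF sv]
    by (intro ext) (simp add: to_koszul_def kz.shift_def)
  have "to_koszul ?\<omega> \<in> kz.K 0"
    unfolding e[symmetric] \<sigma>_E[OF 3(1)]
    using 3 sv E_A expansion_K kz.shift_closed by (intro add_closed_diff[OF add_closed_koszul]) auto
  then show ?case unfolding e by (rule exact_forms_bdry[OF wedges_s_exact[OF 3(1)]])
qed

text \<open>Transfer along \<open>expansion\<close> and \<open>realise\<close>. Only
  \<open>q ^ j\<close> times a class is shown to vanish, which is enough since q is prime to
  p.\<close>

lemma
  shows local_tate0: "odd j \<Longrightarrow> c \<in> A \<Longrightarrow> \<sigma> c - c \<in> R \<Longrightarrow> \<exists>d\<in>A. frag_cmul (q ^ j) c - norm_op P \<sigma> d \<in> R"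
    and local_tate1: "even j \<Longrightarrow> c \<in> A \<Longrightarrow> norm_op P \<sigma> c \<in> R \<Longrightarrow> \<exists>d\<in>A. frag_cmul (q ^ j) c - (\<sigma> d - d) \<in> R"
proof -
  have bdry0: "0 \<in> kz.bdry 0" by (rule add_closed_zero[OF submodule_pairD(2)[OF kz.submodule_pair_bdry]])
  note tr = AR kz.submodule_pair_bdry[of 0] additive_expansion expansion_K
  show "odd j \<Longrightarrow> c \<in> A \<Longrightarrow> \<sigma> c - c \<in> R \<Longrightarrow> \<exists>d\<in>A. frag_cmul (q ^ j) c - norm_op P \<sigma> d \<in> R"
    by (rule tate0_transfer[OF AR kz.submodule_pair_bdry[of 0], where \<alpha> = expansion and \<beta> = realise and \<psi> = "frag_cmul (q ^ j)"])
      (auto simp: additive_expansion expansion_K expansion_R bdry0 expansion_shift additive_realise realise_A realise_bdry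
        realise_shift realise_expansion kz.tate0_homology)
  show "even j \<Longrightarrow> c \<in> A \<Longrightarrow> norm_op P \<sigma> c \<in> R \<Longrightarrow> \<exists>d\<in>A. frag_cmul (q ^ j) c - (\<sigma> d - d) \<in> R"
    by (rule tate1_transfer[OF AR kz.submodule_pair_bdry[of 0], where \<alpha> = expansion and \<beta> = realise and \<psi> = "frag_cmul (q ^ j)"])
      (auto simp: additive_expansion expansion_K expansion_R bdry0 expansion_shift additive_realise realise_A realise_bdry
        realise_shift realise_expansion kz.tate1_homology)
qed

end

section \<open>From the Sylow subgroups to the whole group\<close>

text \<open>The integers that send x into D form an ideal containing m. Were its positive generator
  k not 1, a prime divisor of k would divide every such Q.\<close>

lemma prime_local_global:
  fixes D :: "('e \<Rightarrow>\<^sub>0 int) set"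
  assumes D: "add_closed D" and m: "0 < m" "frag_cmul (int m) x \<in> D"
    and local: "\<And>p. Factorial_Ring.prime p \<Longrightarrow> p dvd m \<Longrightarrow> \<exists>Q. coprime Q (int p) \<and> frag_cmul Q x \<in> D"
  shows "x \<in> D"
proof -
  define k where "k = (LEAST k. 0 < k \<and> frag_cmul (int k) x \<in> D)"
  have k: "0 < k" "frag_cmul (int k) x \<in> D"
    using LeastI[of "\<lambda>k. 0 < k \<and> frag_cmul (int k) x \<in> D" m] m unfolding k_def by blast+
  have least: "k \<le> k'" if "0 < k'" "frag_cmul (int k') x \<in> D" for k'
    unfolding k_def using that by (intro Least_le) auto
  have k_dvd: "int k dvd Q" if "frag_cmul Q x \<in> D" for Q
  proof (rule ccontr)
    assume "\<not> int k dvd Q"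
    then have "Q mod int k \<noteq> 0" using dvd_eq_mod_eq_0 by blast
    moreover have "0 \<le> Q mod int k" using k(1) by simp
    ultimately have pos: "0 < Q mod int k" by linarith
    have "frag_cmul (Q mod int k) x = frag_cmul Q x - frag_cmul (Q div int k) (frag_cmul (int k) x)"
      unfolding frag_cmul_cmul frag_cmul_diff_distrib[symmetric] by (simp only: minus_div_mult_eq_mod)
    also have "\<dots> \<in> D" by (rule add_closed_diff[OF D that add_closed_frag_cmul[OF D k(2)]])
    finally have "frag_cmul (int (nat (Q mod int k))) x \<in> D" using pos by simp
    then have "k \<le> nat (Q mod int k)" using pos by (intro least) auto
    then show False using pos_mod_bound[of "int k" Q] k(1) pos by linarith
  qed
  have "k = 1"
  proof (rule ccontr)
    assume "k \<noteq> 1"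
    then obtain p where p: "Factorial_Ring.prime p" "p dvd k" using prime_factor_nat by blast
    have "k dvd m" using k_dvd[OF m(2)] by simp
    then obtain Q where Q: "coprime Q (int p)" "frag_cmul Q x \<in> D" using local p by (meson dvd_trans)
    have "int p dvd Q" using k_dvd[OF Q(2)] p(2) by (meson dvd_trans int_dvd_int_iff)
    then have "is_unit (int p)" using Q(1) by (metis coprime_common_divisor dvd_refl)
    then show False using p(1) by simp
  qed
  then show ?thesis using k(2) by simp
qed

text \<open>Transitivity of the norm: the powers below u represent the cosets of the subgroup
  generated by T^u.\<close>

lemma norm_op_mult: "norm_op u T (norm_op P (T ^^ u) x) = norm_op (P * u) T x" if T: "additive T"
proof -
  have "norm_op u T (norm_op P (T ^^ u) x) = (\<Sum>l<u. \<Sum>k<P. (T ^^ (l + u * k)) x)"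
    unfolding norm_op_def additive.sum[OF additive_funpow[OF T]] by (simp add: funpow_add funpow_mult)
  also have "\<dots> = (\<Sum>k<P. \<Sum>l<u. (T ^^ (l + k * u)) x)" by (subst sum.swap) (simp add: mult.commute)
  also have "\<dots> = (\<Sum>k<P. sum (\<lambda>i. (T ^^ i) x) {k * u..<k * u + u})"
  proof (rule sum.cong[OF refl])
    show "(\<Sum>l<u. (T ^^ (l + k * u)) x) = sum (\<lambda>i. (T ^^ i) x) {k * u..<k * u + u}" for k
      using sum.shift_bounds_nat_ivl[of "\<lambda>i. (T ^^ i) x" 0 "k * u" u] by (simp add: lessThan_atLeast0 add.commute)
  qed
  also have "\<dots> = norm_op (P * u) T x" unfolding norm_op_def by (rule sum.nat_group)
  finally show ?thesis .
qed

text \<open>Restriction to the subgroup generated by T^u followed by corestriction is multiplication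
  by the index u, which is prime to p; the product of Q and u then serves as the local
  multiplier.\<close>

lemma
  fixes A R :: "('e \<Rightarrow>\<^sub>0 int) set"
  assumes P: "submodule_pair A R T" and m: "0 < m" and period: "\<And>x. x \<in> A \<Longrightarrow> (T ^^ m) x - x \<in> R"
  shows tate0_from_primes:
    "(\<And>p. Factorial_Ring.prime p \<Longrightarrow> p dvd m \<Longrightarrow> \<exists>Pp u Q. m = Pp * u \<and> coprime u p \<and> coprime Q (int p) \<and>
       (\<forall>x\<in>A. (T ^^ u) x - x \<in> R \<longrightarrow> (\<exists>y\<in>A. frag_cmul Q x - norm_op Pp (T ^^ u) y \<in> R))) \<Longrightarrow> tate0 A R T m"
    and tate1_from_primes:
    "(\<And>p. Factorial_Ring.prime p \<Longrightarrow> p dvd m \<Longrightarrow> \<exists>Pp u Q. m = Pp * u \<and> coprime u p \<and> coprime Q (int p) \<and>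
       (\<forall>x\<in>A. norm_op Pp (T ^^ u) x \<in> R \<longrightarrow> (\<exists>y\<in>A. frag_cmul Q x - ((T ^^ u) y - y) \<in> R))) \<Longrightarrow> tate1 A R T m"
proof -
  note AR = submodule_pairD[OF P]
  note N = additive_norm_op[OF AR(4)]
  have R_trans: "a - c \<in> R" if "a - b \<in> R" "b - c \<in> R" for a b c by (rule add_closed_diff_trans[OF AR(2) that])
  have R_swap: "b - a \<in> R" if "a - b \<in> R" for a b by (rule add_closed_diff_swap[OF AR(2) that])
  have NA: "norm_op k T x \<in> A" if "x \<in> A" for k x by (rule norm_op_closed[OF AR(1,5) that])
  have NR: "norm_op k T x \<in> R" if "x \<in> R" for k x by (rule norm_op_closed[OF AR(2,6) that])
  have const_sum: "(\<Sum>l<k. x) = frag_cmul (int k) x" for k and x :: "'e \<Rightarrow>\<^sub>0 int"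
    using frag_cmul_sum_left[of "\<lambda>_. 1" "{..<k}" x] by simp
  have norm_diff: "norm_op k T x - frag_cmul (int k) x = T (\<Sum>l<k. norm_op l T x) - (\<Sum>l<k. norm_op l T x)" for k x
  proof -
    have "norm_op k T x - frag_cmul (int k) x = (\<Sum>l<k. (T ^^ l) x - x)"
      by (simp add: norm_op_def sum_subtractf const_sum)
    also have "\<dots> = (\<Sum>l<k. T (norm_op l T x) - norm_op l T x)" by (simp only: funpow_diff_eq[OF AR(4)])
    finally show ?thesis by (simp add: sum_subtractf additive.sum[OF AR(4)])
  qed
  have fixed_power: "(T ^^ k) x - x \<in> R" if "T x - x \<in> R" for k x
  proof (induction k)
    case (Suc k)
    have "T ((T ^^ k) x) - T x \<in> R" using AR(6)[OF Suc] by (simp add: additive.diff[OF AR(4)])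
    then show ?case using R_trans[OF _ that] by simp
  qed (simp add: add_closed_zero[OF AR(2)])
  have norm_fixed: "norm_op k T x - frag_cmul (int k) x \<in> R" if "T x - x \<in> R" for k x
  proof -
    have "norm_op k T x - frag_cmul (int k) x = (\<Sum>l<k. (T ^^ l) x - x)"
      by (simp add: norm_op_def sum_subtractf const_sum)
    then show ?thesis using add_closed_sum[OF AR(2)] fixed_power[OF that] by metis
  qed
  have image_closed: "add_closed {z. \<exists>y\<in>A. z - f y \<in> R}" if "additive f" for f
  proof -
    have "(z - z') - f (y - y') = (z - f y) - (z' - f y')" for z z' y y' by (simp add: additive.diff[OF that])
    then have "\<exists>w\<in>A. (z - z') - f w \<in> R" if "y \<in> A" "z - f y \<in> R" "y' \<in> A" "z' - f y' \<in> R" for z z' y y'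
      using that add_closed_diff[OF AR(1)] add_closed_diff[OF AR(2)] by metis
    moreover have "\<exists>w\<in>A. 0 - f w \<in> R"
      using add_closed_zero[OF AR(1)] add_closed_zero[OF AR(2)] additive.zero[OF that] by (intro bexI[of _ 0]) auto
    ultimately show ?thesis by (auto simp: add_closed_def)
  qed
  show "tate0 A R T m"
    if local: "\<And>p. Factorial_Ring.prime p \<Longrightarrow> p dvd m \<Longrightarrow> \<exists>Pp u Q. m = Pp * u \<and> coprime u p \<and> coprime Q (int p) \<and>
       (\<forall>x\<in>A. (T ^^ u) x - x \<in> R \<longrightarrow> (\<exists>y\<in>A. frag_cmul Q x - norm_op Pp (T ^^ u) y \<in> R))"
    unfolding tate0_def
  proof (intro ballI impI)
    fix x assume x: "x \<in> A" "T x - x \<in> R"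
    have "x \<in> {z. \<exists>y\<in>A. z - norm_op m T y \<in> R}"
    proof (rule prime_local_global[OF image_closed[OF N] m])
      show "frag_cmul (int m) x \<in> {z. \<exists>y\<in>A. z - norm_op m T y \<in> R}"
        using norm_fixed[OF x(2)] R_swap x(1) by blast
      fix p assume "Factorial_Ring.prime p" "p dvd m"
      then obtain Pp u Q where pu: "m = Pp * u" "coprime u p" "coprime Q (int p)"
        "\<forall>x\<in>A. (T ^^ u) x - x \<in> R \<longrightarrow> (\<exists>y\<in>A. frag_cmul Q x - norm_op Pp (T ^^ u) y \<in> R)"
        using local by blast
      then obtain y where y: "y \<in> A" "frag_cmul Q x - norm_op Pp (T ^^ u) y \<in> R" using x fixed_power by blast
      \<comment> \<open>Corestriction: N_u turns the norm of the subgroup into the full norm and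
        acts on the fixed x as u.\<close>
      have "norm_op u T (frag_cmul Q x) - norm_op m T y \<in> R"
        using NR[OF y(2), of u] by (simp add: additive.diff[OF N] norm_op_mult[OF AR(4)] pu(1))
      moreover have "frag_cmul Q (norm_op u T x) - frag_cmul Q (frag_cmul (int u) x) \<in> R"
        using add_closed_frag_cmul[OF AR(2) norm_fixed[OF x(2), of u], of Q] by (simp only: frag_cmul_diff_distrib2)
      ultimately have "frag_cmul (Q * int u) x - norm_op m T y \<in> R"
        using R_trans R_swap by (metis additive_frag_cmul[OF N] frag_cmul_cmul)
      moreover have "coprime (Q * int u) (int p)" using pu by simp
      ultimately show "\<exists>Q. coprime Q (int p) \<and> frag_cmul Q x \<in> {z. \<exists>y\<in>A. z - norm_op m T y \<in> R}"
        using y(1) by blast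
    qed
    then show "\<exists>y\<in>A. x - norm_op m T y \<in> R" by simp
  qed
  show "tate1 A R T m"
    if local: "\<And>p. Factorial_Ring.prime p \<Longrightarrow> p dvd m \<Longrightarrow> \<exists>Pp u Q. m = Pp * u \<and> coprime u p \<and> coprime Q (int p) \<and>
       (\<forall>x\<in>A. norm_op Pp (T ^^ u) x \<in> R \<longrightarrow> (\<exists>y\<in>A. frag_cmul Q x - ((T ^^ u) y - y) \<in> R))"
    unfolding tate1_def
  proof (intro ballI impI)
    fix x assume x: "x \<in> A" "norm_op m T x \<in> R"
    have T1: "additive (\<lambda>y. T y - y)" using AR(4) by (simp add: additive_def)
    let ?D = "{z. \<exists>y\<in>A. z - (T y - y) \<in> R}"
    have D: "add_closed ?D" by (rule image_closed[OF T1])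
    have RD: "z \<in> ?D" if "z \<in> R" for z
      using that add_closed_zero[OF AR(1)] additive.zero[OF AR(4)] by (auto intro!: bexI[of _ 0])
    have TD: "T y - y \<in> ?D" if "y \<in> A" for y
      using that add_closed_zero[OF AR(2)] by (intro CollectI bexI[of _ y]) simp_all
    have sumA: "(\<Sum>l<k. norm_op l T x) \<in> A" for k by (intro add_closed_sum[OF AR(1)] NA x)
    have N_iff: "frag_cmul (int k) x \<in> ?D" if "norm_op k T x \<in> ?D" for k
    proof -
      have "frag_cmul (int k) x = norm_op k T x - (T (\<Sum>l<k. norm_op l T x) - (\<Sum>l<k. norm_op l T x))"
        by (simp flip: norm_diff)
      then show ?thesis using add_closed_diff[OF D that TD[OF sumA]] by simp
    qed
    have "x \<in> ?D"
    proof (rule prime_local_global[OF D m])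
      show "frag_cmul (int m) x \<in> ?D" by (rule N_iff[OF RD[OF x(2)]])
      fix p assume "Factorial_Ring.prime p" "p dvd m"
      then obtain Pp u Q where pu: "m = Pp * u" "coprime u p" "coprime Q (int p)"
        "\<forall>x\<in>A. norm_op Pp (T ^^ u) x \<in> R \<longrightarrow> (\<exists>y\<in>A. frag_cmul Q x - ((T ^^ u) y - y) \<in> R)"
        using local by blast
      \<comment> \<open>Restriction in degree -1 is given by N_u, which is multiplication by u
        modulo the image of T - 1.\<close>
      have "norm_op Pp (T ^^ u) (norm_op u T x) = norm_op u T (norm_op Pp (T ^^ u) x)"
      proof (rule norm_op_commute[where S = UNIV, symmetric])
        show "norm_op u T ((T ^^ u) z) = (T ^^ u) (norm_op u T z)" for z
          by (rule norm_op_commute[where S = UNIV, symmetric]) (simp_all add: additive_funpow[OF AR(4)] funpow_swap1)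
      qed (simp_all add: N)
      then have "norm_op Pp (T ^^ u) (norm_op u T x) \<in> R" using x(2) by (simp add: norm_op_mult[OF AR(4)] pu(1))
      then obtain y where y: "y \<in> A" "frag_cmul Q (norm_op u T x) - ((T ^^ u) y - y) \<in> R" using pu(4) NA[OF x(1)] by blast
      have "frag_cmul Q (norm_op u T x) \<in> ?D"
        using y NA[OF y(1)] unfolding funpow_diff_eq[OF AR(4)] by blast
      moreover have "frag_cmul (Q * int u) x
          = frag_cmul Q (norm_op u T x) - frag_cmul Q (T (\<Sum>l<u. norm_op l T x) - (\<Sum>l<u. norm_op l T x))"
        unfolding norm_diff[symmetric] by (simp add: frag_cmul_diff_distrib2)
      moreover have "frag_cmul Q (T (\<Sum>l<u. norm_op l T x) - (\<Sum>l<u. norm_op l T x)) \<in> ?D"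
        by (rule add_closed_frag_cmul[OF D TD[OF sumA]])
      ultimately have "frag_cmul (Q * int u) x \<in> ?D"
        using add_closed_diff[OF D] by (simp only:)
      moreover have "coprime (Q * int u) (int p)" using pu by simp
      ultimately show "\<exists>Q. coprime Q (int p) \<and> frag_cmul Q x \<in> ?D" by blast
    qed
    then show "\<exists>y\<in>A. x - (T y - y) \<in> R" by simp
  qed
qed

section \<open>Exterior powers as quotients of free abelian groups on tuples\<close>

context group_ring_module
begin

definition ext_frags :: "nat \<Rightarrow> ('m list \<Rightarrow>\<^sub>0 int) set" where
  "ext_frags j = carrier (free_Abelian_group (tuples (carrier M) j))"

definition ext_rels :: "nat \<Rightarrow> ('m list \<Rightarrow>\<^sub>0 int) set" where
  "ext_rels j = generate (free_Abelian_group (tuples (carrier M) j)) (exterior_relations M j)"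

definition ext_lact :: "'g \<Rightarrow> ('m list \<Rightarrow>\<^sub>0 int) \<Rightarrow> ('m list \<Rightarrow>\<^sub>0 int)" where
  "ext_lact g = frag_extend (frag_of \<circ> map (act g))"

definition coset :: "nat \<Rightarrow> ('m list \<Rightarrow>\<^sub>0 int) \<Rightarrow> ('m list \<Rightarrow>\<^sub>0 int) set" where
  "coset j c = ext_rels j #>\<^bsub>free_Abelian_group (tuples (carrier M) j)\<^esub> c"

lemma ext_rels_normal: "ext_rels j \<lhd> free_Abelian_group (tuples (carrier M) j)"
  unfolding ext_rels_def by (rule normal_exterior[OF M.comm_group_axioms])

lemma ext_rels_frags: "ext_rels j \<subseteq> ext_frags j"
  unfolding ext_frags_def by (rule subgroup.subset[OF normal_imp_subgroup[OF ext_rels_normal]])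

lemma ext_frags_iff: "c \<in> ext_frags j \<longleftrightarrow> Poly_Mapping.keys c \<subseteq> tuples (carrier M) j"
  by (simp add: ext_frags_def)

lemma add_closed_ext_frags: "add_closed (ext_frags j)"
  unfolding add_closed_def ext_frags_iff
proof (intro conjI ballI)
  fix x y assume "x \<in> ext_frags j" "y \<in> ext_frags j"
  then show "Poly_Mapping.keys (x - y) \<subseteq> tuples (carrier M) j"
    using keys_diff[of x y] unfolding ext_frags_iff by blast
qed simp

lemma add_closed_ext_rels: "add_closed (ext_rels j)"
proof -
  let ?F = "free_Abelian_group (tuples (carrier M) j)"
  interpret F: comm_group ?F by (rule abelian_free_Abelian_group)
  have S: "subgroup (ext_rels j) ?F" by (rule normal_imp_subgroup[OF ext_rels_normal])
  have "c - d \<in> ext_rels j" if "c \<in> ext_rels j" "d \<in> ext_rels j" for c d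
  proof -
    have "Poly_Mapping.keys d \<subseteq> tuples (carrier M) j" using that ext_rels_frags ext_frags_iff by blast
    then have "- d \<in> ext_rels j" using subgroup.m_inv_closed[OF S that(2)] by simp
    then show ?thesis using subgroup.m_closed[OF S that(1), of "- d"] by simp
  qed
  then show ?thesis using subgroup.one_closed[OF S] by (simp add: add_closed_def)
qed

lemma coset_eq_iff: "c \<in> ext_frags j \<Longrightarrow> d \<in> ext_frags j \<Longrightarrow> coset j c = coset j d \<longleftrightarrow> c - d \<in> ext_rels j"
proof -
  assume cd: "c \<in> ext_frags j" "d \<in> ext_frags j"
  have "coset j c = (\<lambda>n. n + c) ` ext_rels j" for c by (auto simp: coset_def r_coset_def)
  moreover have "(\<lambda>n. n + c) ` ext_rels j = (\<lambda>n. n + d) ` ext_rels j \<longleftrightarrow> c - d \<in> ext_rels j"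
  proof
    assume "(\<lambda>n. n + c) ` ext_rels j = (\<lambda>n. n + d) ` ext_rels j"
    moreover have "c \<in> (\<lambda>n. n + c) ` ext_rels j" using add_closed_zero[OF add_closed_ext_rels] by force
    ultimately obtain n where "n \<in> ext_rels j" "c = n + d" by auto
    then show "c - d \<in> ext_rels j" by simp
  next
    have sub: "(\<lambda>n. n + c) ` ext_rels j \<subseteq> (\<lambda>n. n + d) ` ext_rels j" if "c - d \<in> ext_rels j" for c d
    proof
      fix x assume "x \<in> (\<lambda>n. n + c) ` ext_rels j"
      then obtain n where n: "n \<in> ext_rels j" "x = n + c" by auto
      then have "n + (c - d) \<in> ext_rels j" using that by (intro add_closed_add[OF add_closed_ext_rels])
      then show "x \<in> (\<lambda>n. n + d) ` ext_rels j" by (rule rev_image_eqI) (simp add: n)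
    qed
    assume "c - d \<in> ext_rels j"
    then show "(\<lambda>n. n + c) ` ext_rels j = (\<lambda>n. n + d) ` ext_rels j"
      using sub add_closed_diff_swap[OF add_closed_ext_rels] by blast
  qed
  ultimately show ?thesis by simp
qed

lemma carrier_exterior_power: "carrier (exterior_power M j) = coset j ` ext_frags j"
  by (auto simp: exterior_power_def Let_def FactGroup_def RCOSETS_def coset_def ext_rels_def ext_frags_def)

lemma coset_mult: "c \<in> ext_frags j \<Longrightarrow> d \<in> ext_frags j \<Longrightarrow>
    coset j c \<otimes>\<^bsub>exterior_power M j\<^esub> coset j d = coset j (c + d)"
  using normal.rcos_sum[OF ext_rels_normal[of j], of c d]
  by (simp add: exterior_power_def Let_def FactGroup_def coset_def ext_rels_def ext_frags_def)

lemma additive_ext_lact: "additive (ext_lact g)"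
  by (simp add: additive_def ext_lact_def frag_extend_add)

lemma ext_lact_of: "ext_lact g (frag_of xs) = frag_of (map (act g) xs)"
  by (simp add: ext_lact_def)

lemma ext_lact_frags: "g \<in> carrier G \<Longrightarrow> c \<in> ext_frags j \<Longrightarrow> ext_lact g c \<in> ext_frags j"
proof -
  assume g: "g \<in> carrier G" and c: "c \<in> ext_frags j"
  have "map (act g) xs \<in> tuples (carrier M) j" if "xs \<in> tuples (carrier M) j" for xs
    using g that by (auto simp: tuples_def)
  then have "(\<Union>xs\<in>Poly_Mapping.keys c. Poly_Mapping.keys ((frag_of \<circ> map (act g)) xs)) \<subseteq> tuples (carrier M) j"
    using c by (auto simp: ext_frags_iff)
  then show ?thesis
    unfolding ext_frags_iff ext_lact_def by (rule order_trans[OF keys_frag_extend])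
qed

lemma exterior_act_coset:
  assumes g: "g \<in> carrier G" and c: "c \<in> ext_frags j"
  shows "exterior_act M act j g (coset j c) = coset j (ext_lact g c)"
proof -
  interpret E: group_ring_module G "exterior_power M j" "exterior_act M act j" by (rule exterior_group_ring_module)
  have cc: "coset j c \<in> carrier (exterior_power M j)" using c by (auto simp: carrier_exterior_power)
  have e: "exterior_act M act j g (coset j c) = ext_lact g ` coset j c"
    using cc by (simp add: exterior_act_def ext_lact_def)
  obtain d where d: "d \<in> ext_frags j" "ext_lact g ` coset j c = coset j d"
    using E.act_closed[OF g cc] by (auto simp: e carrier_exterior_power)
  have "0 + c \<in> coset j c"
    using add_closed_zero[OF add_closed_ext_rels] by (auto simp: coset_def r_coset_def)
  then have "ext_lact g c \<in> coset j d" using d(2) by (metis add_0 imageI)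
  then have "ext_lact g c - d \<in> ext_rels j" by (auto simp: coset_def r_coset_def)
  then show ?thesis using coset_eq_iff[OF ext_lact_frags[OF g c] d(1)] d(2) e by simp
qed

lemma ext_lact_rels: assumes "g \<in> carrier G" "c \<in> ext_rels j" shows "ext_lact g c \<in> ext_rels j"
proof -
  have 0: "0 \<in> ext_frags j" and c: "c \<in> ext_frags j"
    using add_closed_zero[OF add_closed_ext_frags] assms ext_rels_frags by auto
  have "coset j c = coset j 0" using assms coset_eq_iff[OF c 0] by simp
  then have "coset j (ext_lact g c) = coset j (ext_lact g 0)"
    using exterior_act_coset[OF assms(1) c] exterior_act_coset[OF assms(1) 0] by simp
  then show ?thesis
    using coset_eq_iff[OF ext_lact_frags[OF assms(1) c] ext_lact_frags[OF assms(1) 0]]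
    by (simp add: additive.zero[OF additive_ext_lact])
qed

lemma submodule_pair_ext: "g \<in> carrier G \<Longrightarrow> submodule_pair (ext_frags j) (ext_rels j) (ext_lact g)"
  by (simp add: submodule_pair_def add_closed_ext_frags add_closed_ext_rels ext_rels_frags additive_ext_lact
      ext_lact_frags ext_lact_rels)

end

context cyclic_module
begin

lemma exterior_cyclic_module: "cyclic_module G (exterior_power M j) (exterior_act M act j) t m"
proof -
  interpret E: group_ring_module G "exterior_power M j" "exterior_act M act j" by (rule exterior_group_ring_module)
  show ?thesis by unfold_locales (use m_pos t_m powers in auto)
qed

text \<open>The cohomology lemmas present a module by formal sums of its own elements, here cosets,
  while the lattice argument uses formal sums of tuples. \<open>rep\<close> matches formal sums with
  the same value and carries vanishing from the second presentation to the first.\<close>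

lemma
  fixes j :: nat
  defines "frags' \<equiv> group_ring_module.frags (exterior_power M j)"
    and "rels' \<equiv> group_ring_module.rels (exterior_power M j)"
    and "lact' \<equiv> group_ring_module.lact (exterior_act M act j)"
  shows tate0_exterior: "tate0 (ext_frags j) (ext_rels j) (ext_lact t) m \<Longrightarrow> tate0 frags' rels' (lact' t) m"
    and tate1_exterior: "tate1 (ext_frags j) (ext_rels j) (ext_lact t) m \<Longrightarrow> tate1 frags' rels' (lact' t) m"
proof -
  interpret E: cyclic_module G "exterior_power M j" "exterior_act M act j" t m by (rule exterior_cyclic_module)
  note X = submodule_pairD[OF submodule_pair_ext[OF t, of j]]
  note defs = frags'_def rels'_def lact'_def
  define rep where "rep x c \<longleftrightarrow> x \<in> E.frags \<and> c \<in> ext_frags j \<and> E.eval_frag x = coset j c" for x c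
  have rep_ex: "\<exists>c. rep x c" if "x \<in> E.frags" for x
    using E.eval_frag_closed[OF that] that by (auto simp: rep_def carrier_exterior_power)
  have ex_rep: "\<exists>x. rep x c" if "c \<in> ext_frags j" for c
  proof -
    have "coset j c \<in> carrier (exterior_power M j)" using that by (auto simp: carrier_exterior_power)
    then have "rep (frag_of (coset j c)) c" using that by (simp add: rep_def)
    then show ?thesis by blast
  qed
  have rep_add: "rep (x + y) (c + d)" if "rep x c" "rep y d" for x y c d
    using that add_closed_add[OF E.add_closed_frags] add_closed_add[OF X(1)]
    by (auto simp: rep_def E.eval_frag_add coset_mult)
  have rep_rels: "x - y \<in> E.rels \<longleftrightarrow> c - d \<in> ext_rels j" if "rep x c" "rep y d" for x y c d
    using that by (auto simp: rep_def E.diff_rels_iff coset_eq_iff)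
  have rep_0: "rep 0 0"
    unfolding rep_def
  proof (intro conjI)
    show 0: "0 \<in> E.frags" "0 \<in> ext_frags j" using add_closed_zero[OF E.add_closed_frags] add_closed_zero[OF X(1)] by auto
    then have c0: "coset j 0 \<in> carrier (exterior_power M j)" by (auto simp: carrier_exterior_power)
    have "coset j 0 \<otimes>\<^bsub>exterior_power M j\<^esub> coset j 0 = coset j 0" using coset_mult[OF 0(2) 0(2)] by simp
    then show "E.eval_frag 0 = coset j 0" using c0 E.M.r_cancel_one' by simp
  qed
  have rep_act: "rep (E.lact t x) (ext_lact t c)" if "rep x c" for x c
    using that by (simp add: rep_def E.lact_frags E.eval_lact exterior_act_coset X(5))
  have rep_pow: "rep ((E.lact t ^^ k) x) ((ext_lact t ^^ k) c)" if "rep x c" for x c k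
    by (induction k) (use that rep_act in auto)
  have rep_norm: "rep (norm_op k (E.lact t) x) (norm_op k (ext_lact t) c)" if "rep x c" for x c k
    unfolding norm_op_def by (induction k) (use rep_0 rep_add rep_pow[OF that] in auto)
  have frags_iff: "x \<in> E.rels \<longleftrightarrow> c \<in> ext_rels j" if "rep x c" for x c
    using rep_rels[OF that rep_0] by simp
  show "tate0 frags' rels' (lact' t) m" if T: "tate0 (ext_frags j) (ext_rels j) (ext_lact t) m"
    unfolding tate0_def defs
  proof (intro ballI impI)
    fix x assume x: "x \<in> E.frags" "E.lact t x - x \<in> E.rels"
    obtain c where c: "rep x c" using rep_ex[OF x(1)] by blast
    then have "ext_lact t c - c \<in> ext_rels j" using rep_rels[OF rep_act[OF c] c] x(2) by simp
    then obtain d where d: "d \<in> ext_frags j" "c - norm_op m (ext_lact t) d \<in> ext_rels j"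
      using T c unfolding tate0_def rep_def by blast
    obtain y where y: "rep y d" using ex_rep[OF d(1)] by blast
    then have "x - norm_op m (E.lact t) y \<in> E.rels" using rep_rels[OF c rep_norm[OF y]] d(2) by simp
    then show "\<exists>y\<in>E.frags. x - norm_op m (E.lact t) y \<in> E.rels" using y rep_def by blast
  qed
  show "tate1 frags' rels' (lact' t) m" if T: "tate1 (ext_frags j) (ext_rels j) (ext_lact t) m"
    unfolding tate1_def defs
  proof (intro ballI impI)
    fix x assume x: "x \<in> E.frags" "norm_op m (E.lact t) x \<in> E.rels"
    obtain c where c: "rep x c" using rep_ex[OF x(1)] by blast
    then have "norm_op m (ext_lact t) c \<in> ext_rels j" using frags_iff[OF rep_norm[OF c]] x(2) by simp
    then obtain d where d: "d \<in> ext_frags j" "c - (ext_lact t d - d) \<in> ext_rels j"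
      using T c unfolding tate1_def rep_def by blast
    obtain y where y: "rep y d" using ex_rep[OF d(1)] by blast
    have "(x + y) - E.lact t y \<in> E.rels \<longleftrightarrow> (c + d) - ext_lact t d \<in> ext_rels j"
      by (rule rep_rels[OF rep_add[OF c y] rep_act[OF y]])
    then have "x - (E.lact t y - y) \<in> E.rels" using d(2) by (simp add: algebra_simps)
    then show "\<exists>y\<in>E.frags. x - (E.lact t y - y) \<in> E.rels" using y rep_def by blast
  qed
qed

end

lemma (in group) cyclic_group_powers:
  assumes "finite (carrier G)" "cyclic_group G"
  obtains t and m :: nat where "t \<in> carrier G" "0 < m" "t [^] m = \<one>" "bij_betw (\<lambda>k. t [^] k) {..<m} (carrier G)"
proof -
  obtain t where t: "t \<in> carrier G" "carrier G = range (\<lambda>n::int. t [^] n)" using assms(2) cyclic_group by blast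
  have m: "0 < ord t" using ord_ge_1[OF assms(1) t(1)] by simp
  then have "{0..ord t - 1} = {..<ord t}" by auto
  then have inj: "inj_on (\<lambda>k. t [^] k) {..<ord t}" using ord_inj[OF t(1)] by simp
  have "carrier G \<subseteq> (\<lambda>k. t [^] k) ` {..<ord t}"
  proof
    fix g assume "g \<in> carrier G"
    then obtain n :: int where n: "g = t [^] n" using t(2) by blast
    define k where "k = nat (n mod int (ord t))"
    have k: "int k = n mod int (ord t)" "k < ord t" using m by (simp_all add: k_def nat_less_iff)
    have "t [^] n = t [^] (int (ord t) * (n div int (ord t)) + int k)" by (simp add: k(1))
    also have "\<dots> = t [^] k" using t(1) by (simp add: int_pow_mult int_pow_pow[symmetric] int_pow_int)
    finally show "g \<in> (\<lambda>k. t [^] k) ` {..<ord t}" using n k(2) by blast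
  qed
  then have "bij_betw (\<lambda>k. t [^] k) {..<ord t} (carrier G)" using inj t(1) by (auto simp: bij_betw_def)
  then show ?thesis using that t(1) m by simp
qed

section \<open>The lattice in coordinates, and the conclusion\<close>

locale free_cyclic_lattice = cyclic_module +
  fixes n :: nat and \<theta>
  assumes \<theta>: "\<theta> \<in> iso M (free_Abelian_group {..<n})"
    and free: "g \<in> carrier G \<Longrightarrow> x \<in> carrier M \<Longrightarrow> act g x = x \<Longrightarrow> g = \<one>\<^bsub>G\<^esub> \<or> x = \<one>\<^bsub>M\<^esub>"
begin

definition lat :: "(nat \<Rightarrow>\<^sub>0 int) set" where
  "lat = {v. Poly_Mapping.keys v \<subseteq> {..<n}}"

definition "\<eta> = inv_into (carrier M) \<theta>"

lemma \<theta>_bij: "bij_betw \<theta> (carrier M) lat"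
  using \<theta> by (auto simp: iso_def lat_def bij_betw_def)

lemma \<theta>_closed: "x \<in> carrier M \<Longrightarrow> \<theta> x \<in> lat"
  using \<theta>_bij by (auto simp: bij_betw_def)

lemma \<eta>_closed: "v \<in> lat \<Longrightarrow> \<eta> v \<in> carrier M"
  unfolding \<eta>_def using \<theta>_bij by (metis bij_betw_def inv_into_into)

lemma \<theta>_\<eta>: "v \<in> lat \<Longrightarrow> \<theta> (\<eta> v) = v"
  unfolding \<eta>_def using \<theta>_bij by (metis bij_betw_inv_into_right)

lemma \<eta>_\<theta>: "x \<in> carrier M \<Longrightarrow> \<eta> (\<theta> x) = x"
  unfolding \<eta>_def using \<theta>_bij by (metis bij_betw_inv_into_left)

lemma \<theta>_mult: "x \<in> carrier M \<Longrightarrow> y \<in> carrier M \<Longrightarrow> \<theta> (x \<otimes>\<^bsub>M\<^esub> y) = \<theta> x + \<theta> y"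
  using \<theta> hom_mult[of \<theta> M "free_Abelian_group {..<n}" x y] by (simp add: iso_def)

lemma add_closed_lat: "add_closed lat"
  unfolding add_closed_def
proof (intro conjI ballI)
  fix x y assume "x \<in> lat" "y \<in> lat"
  then show "x - y \<in> lat" using keys_diff[of x y] unfolding lat_def by blast
qed (simp add: lat_def)

lemma \<eta>_add: "v \<in> lat \<Longrightarrow> w \<in> lat \<Longrightarrow> \<eta> (v + w) = \<eta> v \<otimes>\<^bsub>M\<^esub> \<eta> w"
proof -
  assume "v \<in> lat" "w \<in> lat"
  then have "v + w = \<theta> (\<eta> v \<otimes>\<^bsub>M\<^esub> \<eta> w)" by (simp add: \<theta>_mult \<eta>_closed \<theta>_\<eta>)
  then show ?thesis using \<open>v \<in> lat\<close> \<open>w \<in> lat\<close> by (simp add: \<eta>_\<theta> \<eta>_closed)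
qed

lemma \<eta>_inj: "v \<in> lat \<Longrightarrow> w \<in> lat \<Longrightarrow> \<eta> v = \<eta> w \<Longrightarrow> v = w"
  using \<theta>_\<eta> by metis

text \<open>The generator t in coordinates. Extending from basis elements makes the operator
  additive on the whole type, as \<open>frag_operator\<close> requires, while the transported action
  makes sense on \<open>lat\<close> alone.\<close>

definition mat :: "(nat \<Rightarrow>\<^sub>0 int) \<Rightarrow> (nat \<Rightarrow>\<^sub>0 int)" where
  "mat = frag_extend (\<lambda>i. \<theta> (act t (\<eta> (frag_of i))))"

lemma additive_mat: "additive mat"
  by (simp add: additive_def mat_def frag_extend_add)

lemma mat_eq: "v \<in> lat \<Longrightarrow> mat v = \<theta> (act t (\<eta> v))"
proof -
  define f where "f v = \<theta> (act t (\<eta> v))" for v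
  have f_add: "f (v + w) = f v + f w" if "v \<in> lat" "w \<in> lat" for v w
    using that by (simp add: f_def \<eta>_add act_mult \<theta>_mult \<eta>_closed)
  have zero: "0 \<in> lat" by (rule add_closed_zero[OF add_closed_lat])
  have f0: "f 0 = 0" using f_add[OF zero zero] by simp
  assume "v \<in> lat"
  then have "Poly_Mapping.keys v \<subseteq> {..<n}" by (simp add: lat_def)
  then have "mat v = f v"
  proof (induction v rule: free_Abelian_group_induct[consumes 1])
    case 1
    show ?case using f0 by (simp add: additive.zero[OF additive_mat])
  next
    case (2 x y)
    then have xy: "x \<in> lat" "y \<in> lat" "x - y \<in> lat" using add_closed_diff[OF add_closed_lat] by (auto simp: lat_def)
    then show ?case using f_add[OF xy(3,2)] 2 by (simp add: additive.diff[OF additive_mat])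
  next
    case (3 i)
    show ?case by (simp add: mat_def f_def)
  qed
  then show ?thesis by (simp add: f_def)
qed

lemma mat_closed: "v \<in> lat \<Longrightarrow> mat v \<in> lat"
  by (simp add: mat_eq \<theta>_closed \<eta>_closed)

lemma \<eta>_funpow_mat: "v \<in> lat \<Longrightarrow> \<eta> ((mat ^^ k) v) = act (t [^]\<^bsub>G\<^esub> k) (\<eta> v)"
proof (induction k)
  case 0
  then show ?case by (simp add: act_one \<eta>_closed)
next
  case (Suc k)
  have "(mat ^^ k) v \<in> lat" using funpow_closed[of lat mat] mat_closed Suc.prems by blast
  then have "\<eta> ((mat ^^ Suc k) v) = act t (\<eta> ((mat ^^ k) v))" by (simp add: mat_eq \<eta>_\<theta> \<eta>_closed)
  then show ?case unfolding pow_Suc2 using Suc by (simp add: act_act \<eta>_closed)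
qed

lemma funpow_mat_closed: "v \<in> lat \<Longrightarrow> (mat ^^ k) v \<in> lat"
  using funpow_closed[of lat mat] mat_closed by blast

lemma mat_m: "v \<in> lat \<Longrightarrow> (mat ^^ (m * k)) v = v"
proof (rule \<eta>_inj)
  assume v: "v \<in> lat"
  have "t [^]\<^bsub>G\<^esub> (m * k) = \<one>\<^bsub>G\<^esub>" by (simp add: t_m flip: G.nat_pow_pow)
  then show "\<eta> ((mat ^^ (m * k)) v) = \<eta> v" using v by (simp add: \<eta>_funpow_mat act_one \<eta>_closed)
qed (auto simp: funpow_mat_closed)

lemma mat_fixed:
  assumes v: "v \<in> lat" and k: "0 < k" "k < m" and fixed: "(mat ^^ k) v = v" shows "v = 0"
proof -
  have "act (t [^]\<^bsub>G\<^esub> k) (\<eta> v) = \<eta> v" using \<eta>_funpow_mat[OF v, of k] fixed by simp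
  moreover have "t [^]\<^bsub>G\<^esub> k \<noteq> \<one>\<^bsub>G\<^esub>"
  proof
    assume e: "t [^]\<^bsub>G\<^esub> k = \<one>\<^bsub>G\<^esub>"
    have "k = 0"
    proof (rule inj_onD[OF bij_betw_imp_inj_on[OF powers]])
      show "t [^]\<^bsub>G\<^esub> k = t [^]\<^bsub>G\<^esub> (0::nat)" unfolding e by simp
    qed (use k in auto)
    then show False using k(1) by simp
  qed
  ultimately have "\<eta> v = \<one>\<^bsub>M\<^esub>" using free[of "t [^]\<^bsub>G\<^esub> k" "\<eta> v"] \<eta>_closed[OF v] by simp
  have "0 \<in> lat" by (rule add_closed_zero[OF add_closed_lat])
  then have "\<eta> 0 \<otimes>\<^bsub>M\<^esub> \<eta> 0 = \<eta> 0" using \<eta>_add[of 0 0] by simp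
  then have "\<eta> 0 = \<one>\<^bsub>M\<^esub>" using \<eta>_closed[OF \<open>0 \<in> lat\<close>] M.r_cancel_one' by simp
  then show ?thesis using \<open>\<eta> v = \<one>\<^bsub>M\<^esub>\<close> \<eta>_inj v \<open>0 \<in> lat\<close> by metis
qed

text \<open>The value 0 in the wrong length keeps additivity, alternation and equivariance valid for
  lists of every length, as \<open>prime_power_exterior\<close> asks.\<close>

definition ext_gen :: "nat \<Rightarrow> (nat \<Rightarrow>\<^sub>0 int) list \<Rightarrow> ('c list \<Rightarrow>\<^sub>0 int)" where
  "ext_gen j vs = (if length vs = j then frag_of (map \<eta> vs) else 0)"

lemma map_\<eta>_tuples: "set vs \<subseteq> lat \<Longrightarrow> map \<eta> vs \<in> tuples (carrier M) (length vs)"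
  using \<eta>_closed by (auto simp: tuples_def)

lemma ext_gen_frags: "set vs \<subseteq> lat \<Longrightarrow> ext_gen j vs \<in> ext_frags j"
  using map_\<eta>_tuples[of vs] add_closed_zero[OF add_closed_ext_frags] by (auto simp: ext_gen_def ext_frags_iff)

lemma relation_in_ext_rels: "c \<in> exterior_relations M j \<Longrightarrow> c \<in> ext_rels j"
  unfolding ext_rels_def by (rule generate.incl)

lemma ext_gen_add:
  assumes "set us \<subseteq> lat" "v \<in> lat" "w \<in> lat" "set ws \<subseteq> lat"
  shows "ext_gen j (us @ (v + w) # ws) - (ext_gen j (us @ v # ws) + ext_gen j (us @ w # ws)) \<in> ext_rels j"
proof (cases "length (us @ v # ws) = j")
  case True
  let ?xs = "map \<eta> (us @ v # ws)" and ?k = "length us"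
  have "?xs \<in> tuples (carrier M) j" using map_\<eta>_tuples[of "us @ v # ws"] assms True by auto
  moreover have "?xs[?k := y] = map \<eta> us @ y # map \<eta> ws" for y
    using list_update_length[of "map \<eta> us" "\<eta> v" "map \<eta> ws" y] by simp
  ultimately have "frag_of (map \<eta> us @ (\<eta> v \<otimes>\<^bsub>M\<^esub> \<eta> w) # map \<eta> ws) - frag_of (map \<eta> us @ \<eta> v # map \<eta> ws)
      - frag_of (map \<eta> us @ \<eta> w # map \<eta> ws) \<in> exterior_relations M j"
    unfolding exterior_relations_def using True \<eta>_closed[OF assms(2)] \<eta>_closed[OF assms(3)]
    by (intro UnI1 CollectI exI[of _ ?xs] exI[of _ ?k] exI[of _ "\<eta> v"] exI[of _ "\<eta> w"]) auto
  then show ?thesis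
    using True by (auto simp: ext_gen_def \<eta>_add assms diff_diff_eq intro: relation_in_ext_rels)
next
  case False
  then show ?thesis by (simp add: ext_gen_def add_closed_zero[OF add_closed_ext_rels])
qed

lemma ext_gen_alt: "set vs \<subseteq> lat \<Longrightarrow> \<not> distinct vs \<Longrightarrow> ext_gen j vs \<in> ext_rels j"
proof (cases "length vs = j")
  case True
  assume vs: "set vs \<subseteq> lat" "\<not> distinct vs"
  then have "\<not> distinct (map \<eta> vs)" by (simp add: distinct_map)
  then have "frag_of (map \<eta> vs) \<in> exterior_relations M j"
    unfolding exterior_relations_def using map_\<eta>_tuples[OF vs(1)] True by (intro UnI2) blast
  then show ?thesis using True by (simp add: ext_gen_def relation_in_ext_rels)
qed (simp add: ext_gen_def add_closed_zero[OF add_closed_ext_rels])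

lemma ext_lact_gen: "set vs \<subseteq> lat \<Longrightarrow> ext_lact t (ext_gen j vs) = ext_gen j (map mat vs)"
proof -
  assume "set vs \<subseteq> lat"
  then have "map (act t) (map \<eta> vs) = map \<eta> (map mat vs)"
    by (auto simp: mat_eq \<eta>_\<theta> \<eta>_closed subset_iff)
  then show ?thesis by (simp add: ext_gen_def ext_lact_of additive.zero[OF additive_ext_lact] del: map_map)
qed

lemma funpow_ext_lact_gen: "set vs \<subseteq> lat \<Longrightarrow> (ext_lact t ^^ k) (ext_gen j vs) = ext_gen j (map (mat ^^ k) vs)"
proof (induction k)
  case (Suc k)
  have "set (map (mat ^^ k) vs) \<subseteq> lat" using Suc.prems funpow_mat_closed by auto
  then show ?case using Suc by (simp add: ext_lact_gen o_def)
qed simp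

lemma tuple_eq_map_\<eta>: "xs \<in> tuples (carrier M) j \<Longrightarrow> \<exists>vs. set vs \<subseteq> lat \<and> length vs = j \<and> frag_of xs = ext_gen j vs"
proof -
  assume xs: "xs \<in> tuples (carrier M) j"
  then have "map \<eta> (map \<theta> xs) = xs" by (auto simp: tuples_def \<eta>_\<theta> subset_iff intro!: map_idI)
  then have "frag_of xs = ext_gen j (map \<theta> xs)" using xs by (simp add: ext_gen_def tuples_def del: map_map)
  moreover have "set (map \<theta> xs) \<subseteq> lat" "length (map \<theta> xs) = j" using xs \<theta>_closed by (auto simp: tuples_def)
  ultimately show ?thesis by blast
qed

lemma ext_frags_gen:
  assumes S: "add_closed S" and "\<And>vs. set vs \<subseteq> lat \<Longrightarrow> length vs = j \<Longrightarrow> ext_gen j vs \<in> S"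
  shows "ext_frags j \<subseteq> S"
proof
  fix c assume "c \<in> ext_frags j"
  then have "Poly_Mapping.keys c \<subseteq> tuples (carrier M) j" by (simp add: ext_frags_iff)
  then show "c \<in> S"
  proof (induction c rule: free_Abelian_group_induct[consumes 1])
    case (3 xs)
    then show ?case using tuple_eq_map_\<eta>[of xs j] assms(2) by metis
  qed (use add_closed_zero[OF S] add_closed_diff[OF S] in auto)
qed

lemma exterior_universal:
  fixes f :: "(nat \<Rightarrow>\<^sub>0 int) list \<Rightarrow> int"
  assumes add: "\<And>us v w ws. set us \<subseteq> lat \<Longrightarrow> v \<in> lat \<Longrightarrow> w \<in> lat \<Longrightarrow> set ws \<subseteq> lat \<Longrightarrow>
      f (us @ (v + w) # ws) = f (us @ v # ws) + f (us @ w # ws)"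
    and alt: "\<And>vs. set vs \<subseteq> lat \<Longrightarrow> \<not> distinct vs \<Longrightarrow> f vs = 0"
  shows "\<exists>g. additive g \<and> (\<forall>vs. set vs \<subseteq> lat \<longrightarrow> length vs = j \<longrightarrow> g (ext_gen j vs) = f vs) \<and> (\<forall>c\<in>ext_rels j. g c = 0)"
proof -
  \<comment> \<open>The integers appear as the free abelian group on the one-element type, so that
    \<open>frag_extend\<close> supplies the linear extension.\<close>
  define g where "g c = Poly_Mapping.lookup (frag_extend (\<lambda>xs. frag_cmul (f (map \<theta> xs)) (frag_of ())) c) ()" for c
  have g: "additive g" by (simp add: g_def additive_def frag_extend_add lookup_add)
  have g_of: "g (frag_of xs) = f (map \<theta> xs)" for xs by (simp add: g_def)
  have g_gen: "g (ext_gen j vs) = f vs" if vs: "set vs \<subseteq> lat" "length vs = j" for vs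
  proof -
    have "map \<theta> (map \<eta> vs) = vs" using vs by (auto simp: \<theta>_\<eta> subset_iff intro!: map_idI)
    then show ?thesis using vs by (simp add: ext_gen_def g_of del: map_map)
  qed
  let ?F = "free_Abelian_group (tuples (carrier M) j)"
  interpret F: comm_group ?F by (rule abelian_free_Abelian_group)
  let ?H = "{c \<in> ext_frags j. g c = 0}"
  have "g c = 0" if c: "c \<in> exterior_relations M j" for c
  proof -
    consider (add) xs k x y where "xs \<in> tuples (carrier M) j" "k < j" "x \<in> carrier M" "y \<in> carrier M"
        "c = frag_of (xs[k := x \<otimes>\<^bsub>M\<^esub> y]) - frag_of (xs[k := x]) - frag_of (xs[k := y])"
      | (alt) xs where "xs \<in> tuples (carrier M) j" "\<not> distinct xs" "c = frag_of xs"
      using c unfolding exterior_relations_def by blast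
    then show ?thesis
    proof cases
      case add
      then have k: "k < length xs" and sub: "set xs \<subseteq> carrier M" by (auto simp: tuples_def)
      have upd: "map \<theta> (xs[k := z]) = map \<theta> (take k xs) @ \<theta> z # map \<theta> (drop (Suc k) xs)" for z
        by (simp add: upd_conv_take_nth_drop[OF k])
      have lat: "set (map \<theta> (take k xs)) \<subseteq> lat" "set (map \<theta> (drop (Suc k) xs)) \<subseteq> lat"
        using sub set_take_subset[of k xs] set_drop_subset[of "Suc k" xs] \<theta>_closed by auto
      show ?thesis
        unfolding add(5) additive.diff[OF g] g_of upd \<theta>_mult[OF add(3,4)]
        using assms(1)[OF lat(1) \<theta>_closed[OF add(3)] \<theta>_closed[OF add(4)] lat(2)] by simp
    next
      case alt
      then have "\<not> distinct (map \<theta> xs)" by (simp add: distinct_map)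
      moreover have "set (map \<theta> xs) \<subseteq> lat" using alt(1) \<theta>_closed by (auto simp: tuples_def)
      ultimately show ?thesis unfolding alt(3) g_of by (intro assms(2))
    qed
  qed
  moreover have "exterior_relations M j \<subseteq> ext_frags j"
    unfolding ext_frags_def by (rule exterior_relations_closed[OF M.comm_group_axioms])
  ultimately have sub: "exterior_relations M j \<subseteq> ?H" by blast
  have "subgroup ?H ?F"
  proof (rule F.subgroupI)
    show "?H \<noteq> {}" using add_closed_zero[OF add_closed_ext_frags] additive.zero[OF g] by blast
    fix c assume c: "c \<in> ?H"
    then have "inv\<^bsub>?F\<^esub> c = - c" by (simp add: ext_frags_iff)
    then show "inv\<^bsub>?F\<^esub> c \<in> ?H"
      using c add_closed_minus[OF add_closed_ext_frags] by (simp add: additive.minus[OF g])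
    fix d assume "d \<in> ?H"
    then show "c \<otimes>\<^bsub>?F\<^esub> d \<in> ?H" using c add_closed_add[OF add_closed_ext_frags] by (simp add: additive.add[OF g])
  qed (auto simp: ext_frags_def)
  then have "ext_rels j \<subseteq> ?H" unfolding ext_rels_def by (rule F.generate_subgroup_incl[OF sub])
  then show ?thesis using g g_gen by blast
qed

text \<open>Freeness outside the origin enters here, for two nontrivial group elements: the one
  acting by \<open>mat ^^ u\<close> and its p^r-th power.\<close>

lemma prime_power_exterior:
  assumes p: "Factorial_Ring.prime p" and m: "m = p ^ Suc r * u" and u: "0 < u"
  shows "prime_power_exterior (mat ^^ u) {..<n} p r (p ^ Suc r) (p ^ r) (ext_frags j) (ext_rels j) (ext_lact t ^^ u) (ext_gen j) j"
proof -
  have p1: "1 < p" using prime_gt_1_nat[OF p] .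
  have power: "((mat ^^ u) ^^ k) v = (mat ^^ (u * k)) v" for k v by (simp add: funpow_mult)
  have lat: "Poly_Mapping.keys v \<subseteq> {..<n} \<longleftrightarrow> v \<in> lat" for v by (simp add: lat_def)
  interpret L: prime_power_lattice "mat ^^ u" "{..<n}" p r "p ^ Suc r" "p ^ r"
  proof
    show "(mat ^^ u) (x + y) = (mat ^^ u) x + (mat ^^ u) y" for x y
      by (rule additive.add[OF additive_funpow[OF additive_mat]])
    show "Factorial_Ring.prime p" by (rule p)
  next
    fix v :: "nat \<Rightarrow>\<^sub>0 int"
    assume "Poly_Mapping.keys v \<subseteq> {..<n}"
    then have v: "v \<in> lat" by (simp add: lat)
    show "Poly_Mapping.keys ((mat ^^ u) v) \<subseteq> {..<n}" using funpow_mat_closed[OF v] lat by blast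
    show "((mat ^^ u) ^^ (p ^ Suc r)) v = v" unfolding power using mat_m[OF v, of 1] m by (simp add: mult.commute)
    show "v = 0" if "(mat ^^ u) v = v"
    proof (rule mat_fixed[OF v u _ that])
      have "1 < p ^ Suc r" using p1 by (rule one_less_power) simp
      then show "u < m" using u m by simp
    qed
    \<comment> \<open>The sum is the norm for the subgroup of order p, hence fixed by a nontrivial
      group element, hence zero by freeness.\<close>
    show "(\<Sum>b<p. ((mat ^^ u) ^^ (b * p ^ r)) v) = 0"
    proof (rule mat_fixed)
      let ?c = "mat ^^ (u * p ^ r)"
      have sum_eq: "(\<Sum>b<p. ((mat ^^ u) ^^ (b * p ^ r)) v) = norm_op p ?c v"
        unfolding norm_op_def power by (simp add: funpow_mult mult.assoc mult.commute[of "p ^ r"])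
      show "(\<Sum>b<p. ((mat ^^ u) ^^ (b * p ^ r)) v) \<in> lat"
        unfolding power by (intro add_closed_sum[OF add_closed_lat] funpow_mat_closed v)
      show "0 < u * p ^ r" using u p1 by simp
      show "u * p ^ r < m" using m u p1 by simp
      have "(?c ^^ p) v = v" using mat_m[OF v, of 1] m by (simp add: funpow_mult ac_simps)
      then have "?c (norm_op p ?c v) - norm_op p ?c v = 0"
        using norm_op_telescope[OF additive_funpow[OF additive_mat], of "u * p ^ r" p v] by simp
      then show "?c (\<Sum>b<p. ((mat ^^ u) ^^ (b * p ^ r)) v) = (\<Sum>b<p. ((mat ^^ u) ^^ (b * p ^ r)) v)"
        unfolding sum_eq by simp
    qed
  qed simp_all
  have V: "L.V = lat" by (simp add: L.V_def lat_def)
  note A = submodule_pairD[OF submodule_pair_ext[OF t, of j]]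
  show ?thesis
  proof (rule prime_power_exterior.intro[OF L.prime_power_lattice_axioms],
      rule prime_power_exterior_axioms.intro, unfold V)
    show "submodule_pair (ext_frags j) (ext_rels j) (ext_lact t ^^ u)"
      using A additive_funpow[OF A(4)] funpow_closed[of "ext_frags j" "ext_lact t"] funpow_closed[of "ext_rels j" "ext_lact t"]
      by (auto simp: submodule_pair_def)
  qed (fact ext_gen_frags ext_gen_add ext_gen_alt funpow_ext_lact_gen | rule ext_frags_gen exterior_universal; blast)+
qed

lemma prime_decomposition:
  assumes "Factorial_Ring.prime p" "p dvd m"
  obtains r u where "m = p ^ Suc r * u" "0 < u" "coprime u p"
proof -
  obtain k u where ku: "\<not> p dvd u" "m = u * p ^ k" using prime_power_canonical[OF assms(1) m_pos] by blast
  then obtain r where r: "k = Suc r" using assms(2) by (cases k) auto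
  have "0 < u" using ku(1) by (rule contrapos_np) simp
  moreover have "coprime u p" using prime_imp_coprime[OF assms(1) ku(1)] by (simp add: coprime_commute)
  moreover have "m = p ^ Suc r * u" unfolding ku(2) r by (rule mult.commute)
  ultimately show ?thesis by (intro that)
qed

lemma ext_period: "c \<in> ext_frags j \<Longrightarrow> (ext_lact t ^^ m) c - c \<in> ext_rels j"
proof -
  have "add_closed {c. (ext_lact t ^^ m) c - c = 0}"
    using additive_funpow[OF additive_ext_lact, of m t]
    by (auto simp: add_closed_def additive.zero additive.diff)
  moreover have "(ext_lact t ^^ m) (ext_gen j vs) = ext_gen j vs" if vs: "set vs \<subseteq> lat" for vs
  proof -
    have "map (mat ^^ m) vs = vs" using mat_m[of _ 1] vs by (auto intro!: map_idI)
    then show ?thesis using funpow_ext_lact_gen[OF vs] by simp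
  qed
  ultimately have "ext_frags j \<subseteq> {c. (ext_lact t ^^ m) c - c = 0}" by (intro ext_frags_gen) auto
  then show "c \<in> ext_frags j \<Longrightarrow> (ext_lact t ^^ m) c - c \<in> ext_rels j"
    using add_closed_zero[OF add_closed_ext_rels] by auto
qed

lemma
  shows exterior_tate0: "odd j \<Longrightarrow> tate0 (ext_frags j) (ext_rels j) (ext_lact t) m"
    and exterior_tate1: "even j \<Longrightarrow> tate1 (ext_frags j) (ext_rels j) (ext_lact t) m"
proof -
  show "tate0 (ext_frags j) (ext_rels j) (ext_lact t) m" if j: "odd j"
  proof (rule tate0_from_primes[OF submodule_pair_ext[OF t] m_pos ext_period])
    fix p assume p: "Factorial_Ring.prime p" "p dvd m"
    obtain r u where u: "m = p ^ Suc r * u" "0 < u" "coprime u p" by (rule prime_decomposition[OF p])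
    interpret E: prime_power_exterior "mat ^^ u" "{..<n}" p r "p ^ Suc r" "p ^ r" "ext_frags j" "ext_rels j" "ext_lact t ^^ u" "ext_gen j" j
      by (rule prime_power_exterior[OF p(1) u(1,2)])
    show "\<exists>Pp u Q. m = Pp * u \<and> coprime u p \<and> coprime Q (int p) \<and>
       (\<forall>x\<in>ext_frags j. (ext_lact t ^^ u) x - x \<in> ext_rels j \<longrightarrow> (\<exists>y\<in>ext_frags j. frag_cmul Q x - norm_op Pp (ext_lact t ^^ u) y \<in> ext_rels j))"
      using u E.q(1) E.local_tate0[OF j] by (intro exI[of _ "p ^ Suc r"] exI[of _ u] exI[of _ "E.q ^ j"]) auto
  qed
  show "tate1 (ext_frags j) (ext_rels j) (ext_lact t) m" if j: "even j"
  proof (rule tate1_from_primes[OF submodule_pair_ext[OF t] m_pos ext_period])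
    fix p assume p: "Factorial_Ring.prime p" "p dvd m"
    obtain r u where u: "m = p ^ Suc r * u" "0 < u" "coprime u p" by (rule prime_decomposition[OF p])
    interpret E: prime_power_exterior "mat ^^ u" "{..<n}" p r "p ^ Suc r" "p ^ r" "ext_frags j" "ext_rels j" "ext_lact t ^^ u" "ext_gen j" j
      by (rule prime_power_exterior[OF p(1) u(1,2)])
    show "\<exists>Pp u Q. m = Pp * u \<and> coprime u p \<and> coprime Q (int p) \<and>
       (\<forall>x\<in>ext_frags j. norm_op Pp (ext_lact t ^^ u) x \<in> ext_rels j \<longrightarrow> (\<exists>y\<in>ext_frags j. frag_cmul Q x - ((ext_lact t ^^ u) y - y) \<in> ext_rels j))"
      using u E.q(1) E.local_tate1[OF j] by (intro exI[of _ "p ^ Suc r"] exI[of _ u] exI[of _ "E.q ^ j"]) auto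
  qed
qed

end

theorem theorem0p1:
  fixes G :: "'g monoid" and L :: "'l monoid" and act :: "'g \<Rightarrow> 'l \<Rightarrow> 'l"
    and i :: int and j :: nat
  assumes "group G" and "finite (carrier G)" and "cyclic_group G"
    and "group_ring_module G L act" and "fg_free_abelian L"
    and "\<And>g x. g \<in> carrier G \<Longrightarrow> x \<in> carrier L \<Longrightarrow> act g x = x \<Longrightarrow> g = \<one>\<^bsub>G\<^esub> \<or> x = \<one>\<^bsub>L\<^esub>"
    and "odd (i + int j)"
  shows "trivial_group
    (tate_cohomology G (exterior_power L j) (exterior_act L act j) i)"
proof -
  interpret G: group G by fact
  interpret L: group_ring_module G L act by fact
  obtain t m where t: "t \<in> carrier G" "0 < (m::nat)" "t [^]\<^bsub>G\<^esub> m = \<one>\<^bsub>G\<^esub>" "bij_betw (\<lambda>k. t [^]\<^bsub>G\<^esub> k) {..<m} (carrier G)"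
    using G.cyclic_group_powers[OF assms(2,3)] by blast
  obtain n :: nat and \<theta> where \<theta>: "\<theta> \<in> iso L (free_Abelian_group {..<n})"
    using assms(5) by (auto simp: fg_free_abelian_def is_iso_def)
  interpret L: free_cyclic_lattice G L act t m n \<theta>
    by unfold_locales (use t \<theta> assms(6) in auto)
  interpret E: cyclic_module G "exterior_power L j" "exterior_act L act j" t m by (rule L.exterior_cyclic_module)
  show ?thesis
  \<comment> \<open>The parity of j decides that of i, and with it which of the two periodic degrees
    has to vanish.\<close>
  proof (cases "odd j")
    case True
    then have "even i" using assms(7) by simp
    then show ?thesis
      using E.trivial_tate_cohomology_even L.tate0_exterior L.exterior_tate0[OF True] by blast
  next
    case False
    then have "odd i" using assms(7) by simp
    then show ?thesis
      using E.trivial_tate_cohomology_odd L.tate1_exterior L.exterior_tate1[of j] False by blast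
  qed
qed

end
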